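(* Let $n\ge0$ and let $\Gamma_0\in\mathbf L(\mathfrak M,\mathfrak N),\Gamma_1,\dots,\Gamma_{2n}$ be a choice sequence. Suppose $\mathfrak D_{\Gamma_{2n}}\ne\{0\}$ and $\mathfrak D_{\Gamma^*_{2n}}\ne\{0\}$. Then the formula $$\Theta(z)=\theta_n^{(0)}(z)+c_n(z)\mathcal E(z)\left(I_{\mathfrak D_{\Gamma_{2n}}}-a_n(z)\mathcal E(z)\right)^{-1}b_n(z),\quad z\in\mathbb D,\qquad( * )$$ gives a one-to-one correspondence between all functions $\mathcal E\in\mathbf S(\mathfrak D_{\Gamma_{2n}},\mathfrak D_{\Gamma^*_{2n}})$ and all functions $\Theta\in\mathbf S(\mathfrak M,\mathfrak N)$ having the given choice sequence $\Gamma_0,\Gamma_1,\dots,\Gamma_{2n}$ as their first $2n+1$ Schur parameters. Moreover, the Schur parameters of the function $\Theta$ given by $( * )$ are $$\Gamma_0,\Gamma_1,\dots,\Gamma_{2n},\gamma_0^{(\mathcal E)},\gamma_1^{(\mathcal E)},\dots,$$ where $\gamma_0^{(\mathcal E)}\in\mathbf L(\mathfrak D_{\Gamma_{2n}},\mathfrak D_{\Gamma^*_{2n}}),\gamma_1^{(\mathcal E)},\dots$ are the Schur parameters of $\mathcal E$. Here, with $\widehat R(z)=(I_{\widehat{\mathcal K}_n}-z\widehat{\mathcal S}_{n,0})^{-1}$, $$\begin{aligned}\theta^{(0)}_n(z)&=\begin{bmatrix}\Gamma_0&D_{\Gamma_0^*}\end{bmatrix}\left(P_{\widehat{\mathcal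 H}_1}\widehat R(z)\upharpoonright\mathfrak M\right),\\ a_n(z)&=z\begin{bmatrix}D_{\Gamma_{2n}}&-\Gamma^*_{2n}\end{bmatrix}\left(P_{\widehat{\mathcal H}_{n+1}}\widehat R(z)\upharpoonright\mathfrak D_{\Gamma^*_{2n}}\right),\\ b_n(z)&=z\begin{bmatrix}D_{\Gamma_{2n}}&-\Gamma^*_{2n}\end{bmatrix}\left(P_{\widehat{\mathcal H}_{n+1}}\widehat R(z)\upharpoonright\mathfrak M\right),\\ c_n(z)&=\begin{bmatrix}\Gamma_0&D_{\Gamma_0^*}\end{bmatrix}\left(P_{\widehat{\mathcal H}_1}\widehat R(z)\upharpoonright\mathfrak D_{\Gamma^*_{2n}}\right).\end{aligned}$$
   Context: All Hilbert spaces are complex (infinite-dimensional ones are separable). $\mathbf L(H_1,H_2)$ denotes the bounded operators; $P_L$ is the orthogonal projection onto a subspace $L$ (regarded as a map into $L$), $X\upharpoonright L$ is restriction. For a contraction $T$: $D_T=(I-T^*T)^{1/2}$, $\mathfrak D_T=\overline{\operatorname{ran}}\,D_T$. $\mathbf S(\mathfrak M,\mathfrak N)$ is the Schur class: holomorphic $\Theta:\mathbb D\to\mathbf L(\mathfrak M,\mathfrak N)$ with $\|\Theta(z)\|\le1$. A choice sequence consists of contractions $\Gamma_0\in\mathbf L(\mathfrak M,\mathfrak N)$, $\Gamma_k\in\mathbf L(\mathfrak D_{\Gamma_{k-1}},\mathfrak D_{\Gamma_{k-1}^*})$, $k\ge1$. Schur parameters of $\Theta\in\mathbf S(\mathfrak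 M,\mathfrak N)$: $\Theta_0=\Theta$, $\Gamma_k=\Theta_k(0)$, and $\Theta_{k+1}\in\mathbf S(\mathfrak D_{\Gamma_k},\mathfrak D_{\Gamma_k^*})$ is the unique function with $\Theta_k(z)=\Gamma_k+zD_{\Gamma_k^*}\Theta_{k+1}(z)(I+z\Gamma_k^*\Theta_{k+1}(z))^{-1}D_{\Gamma_k}$, $z\in\mathbb D$. (The map from functions to their Schur parameters is a bijection from $\mathbf S(\mathfrak M,\mathfrak N)$ onto the set of choice sequences.) Elementary rotations (with $\mathfrak D_{\Gamma_{-1}}:=\mathfrak M$, $\mathfrak D_{\Gamma_{-1}^*}:=\mathfrak N$) are the unitary operators $$\mathbf J_{\Gamma_k}=\begin{bmatrix}\Gamma_k&D_{\Gamma_k^*}\\ D_{\Gamma_k}&-\Gamma_k^*\end{bmatrix}:\mathfrak D_{\Gamma_{k-1}}\oplus\mathfrak D_{\Gamma_k^*}\to\mathfrak D_{\Gamma_{k-1}^*}\oplus\mathfrak D_{\Gamma_k}.$$ Put $\widehat{\mathcal H}_1=\mathfrak M\oplus\mathfrak D_{\Gamma_0^*}$, $\widehat{\mathcal H}_k=\mathfrak D_{\Gamma_{2k-3}}\oplus\mathfrak D_{\Gamma_{2k-2}^*}$ ($2\le k\le n+1$), $\widehat{\mathcal K}_n=\bigoplus_{k=1}^{n+1}\widehat{\mathcal H}_k$. The operator $\widehat{\mathcal S}_{n,0}$ on $\widehat{\mathcal K}_n$ is $$\widehat{\mathcal S}_{n,0}=\Bigl(0\oplus\bigoplus_{k=1}^n\mathbf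 J_{\Gamma_{2k-1}}\oplus0\Bigr)\Bigl(\bigoplus_{k=1}^{n+1}\mathbf J_{\Gamma_{2k-2}}\Bigr),$$ where the right factor maps $\widehat{\mathcal K}_n$ to $\bigoplus_{k=1}^{n+1}(\mathfrak D_{\Gamma^*_{2k-3}}\oplus\mathfrak D_{\Gamma_{2k-2}})=\mathfrak N\oplus\bigoplus_{k=1}^n(\mathfrak D_{\Gamma_{2k-2}}\oplus\mathfrak D_{\Gamma_{2k-1}^*})\oplus\mathfrak D_{\Gamma_{2n}}$, and the left factor maps the latter to $\mathfrak M\oplus\bigoplus_{k=1}^n(\mathfrak D_{\Gamma_{2k-2}^*}\oplus\mathfrak D_{\Gamma_{2k-1}})\oplus\mathfrak D_{\Gamma_{2n}^*}=\widehat{\mathcal K}_n$ (its first zero block maps $\mathfrak N\to\mathfrak M$, its last $\mathfrak D_{\Gamma_{2n}}\to\mathfrak D_{\Gamma_{2n}^*}$). The rows $\begin{bmatrix}\Gamma_0&D_{\Gamma_0^*}\end{bmatrix}$ and $\begin{bmatrix}D_{\Gamma_{2n}}&-\Gamma^*_{2n}\end{bmatrix}$ act from $\widehat{\mathcal H}_1$ to $\mathfrak N$ and from $\widehat{\mathcal H}_{n+1}$ to $\mathfrak D_{\Gamma_{2n}}$, respectively. *)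

theory Defs
  imports "HOL-Analysis.Analysis"
begin

section \<open>Complex Hilbert spaces\<close>

class complex_vector = real_vector +
  fixes scaleC :: "complex \<Rightarrow> 'a \<Rightarrow> 'a"  (infixr "*\<^sub>C" 75)
  assumes scaleC_add_right: "c *\<^sub>C (x + y) = c *\<^sub>C x + c *\<^sub>C y"
    and scaleC_add_left: "(c + d) *\<^sub>C x = c *\<^sub>C x + d *\<^sub>C x"
    and scaleC_scaleC: "c *\<^sub>C d *\<^sub>C x = (c * d) *\<^sub>C x"
    and scaleR_scaleC: "r *\<^sub>R x = complex_of_real r *\<^sub>C x"

text \<open>The complex inner product is linear in the first argument. The last axiom makes
  \<open>inner\<close> its real part, so that \<open>norm x = sqrt (Re (cinner x x))\<close>, and positive
  definiteness of \<open>cinner\<close> is inherited from \<open>inner\<close>.\<close>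

class complex_inner = complex_vector + real_inner +
  fixes cinner :: "'a \<Rightarrow> 'a \<Rightarrow> complex"
  assumes cinner_add_left: "cinner (x + y) w = cinner x w + cinner y w"
    and cinner_scaleC_left: "cinner (c *\<^sub>C x) y = c * cinner x y"
    and cinner_commute: "cinner x y = cnj (cinner y x)"
    and inner_cinner: "inner x y = Re (cinner x y)"

class complex_hilbert = complex_inner + complete_space

instantiation complex :: complex_hilbert
begin
definition scaleC_complex :: "complex \<Rightarrow> complex \<Rightarrow> complex"
  where "scaleC_complex c x = c * x"
definition cinner_complex :: "complex \<Rightarrow> complex \<Rightarrow> complex"
  where "cinner_complex x y = x * cnj y"
instance
  by standard
    (auto simp: scaleC_complex_def cinner_complex_def algebra_simps scaleR_conv_of_real inner_complex_def)
end

instantiation prod :: (complex_vector, complex_vector) complex_vector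
begin
definition scaleC_prod :: "complex \<Rightarrow> 'a \<times> 'b \<Rightarrow> 'a \<times> 'b"
  where "scaleC_prod c p = (c *\<^sub>C fst p, c *\<^sub>C snd p)"
instance
  by standard
    (auto simp: scaleC_prod_def scaleC_add_right scaleC_add_left scaleC_scaleC
      scaleR_prod_def scaleR_scaleC)
end


section \<open>Operators between closed subspaces\<close>

text \<open>All spaces that occur are closed subspaces of the two given Hilbert spaces or finite direct
  sums of such. An operator from the closed subspace \<open>U\<close> of \<open>'a\<close> to the closed subspace
  \<open>V\<close> of \<open>'b\<close> is represented by its extension by zero to the orthogonal complement of
  \<open>U\<close>. This is an isometric bijection that respects composition and adjoints. Note that the
  identity of \<open>U\<close> is thereby the orthogonal projection onto \<open>U\<close>, not \<open>id_blinfun\<close>.\<close>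

definition bop :: "'a::complex_inner set \<Rightarrow> 'b::complex_inner set \<Rightarrow> ('a \<Rightarrow>\<^sub>L 'b) set"
  where "bop U V = {T. (\<forall>c x. blinfun_apply T (c *\<^sub>C x) = c *\<^sub>C blinfun_apply T x)
    \<and> range (blinfun_apply T) \<subseteq> V
    \<and> (\<forall>x. (\<forall>u\<in>U. cinner x u = 0) \<longrightarrow> blinfun_apply T x = 0)}"

definition adj :: "('a::complex_inner \<Rightarrow>\<^sub>L 'b::complex_inner) \<Rightarrow> 'b \<Rightarrow>\<^sub>L 'a"
  where "adj T = (THE S. \<forall>x y. cinner (blinfun_apply T x) y = cinner x (blinfun_apply S y))"

text \<open>For \<open>T\<close> a contraction defined on \<open>U\<close>: the nonnegative square root of
  \<open>I - T\<^sup>* T\<close> on \<open>U\<close>, and the closure of its range.\<close>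

definition defect_op :: "'a::complex_inner set \<Rightarrow> ('a \<Rightarrow>\<^sub>L 'b::complex_inner) \<Rightarrow> 'a \<Rightarrow>\<^sub>L 'a"
  where "defect_op U T = (THE D. D \<in> bop U U
    \<and> (\<forall>x\<in>U. cinner (blinfun_apply D x) x \<in> \<real>\<^sub>\<ge>\<^sub>0)
    \<and> (\<forall>x\<in>U. blinfun_apply D (blinfun_apply D x)
              = x - blinfun_apply (adj T) (blinfun_apply T x)))"

definition defect_space :: "'a::complex_inner set \<Rightarrow> ('a \<Rightarrow>\<^sub>L 'b::complex_inner) \<Rightarrow> 'a set"
  where "defect_space U T = closure (range (blinfun_apply (defect_op U T)))"


section \<open>Schur class and Schur parameters\<close>

text \<open>Holomorphy is complex differentiability in operator norm, i.e. the real Frechet derivative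
  is complex linear. Functions are extensional outside the unit disc, so that equality of functions
  is equality on the disc.\<close>

definition schur_class ::
    "'a::complex_inner set \<Rightarrow> 'b::complex_inner set \<Rightarrow> (complex \<Rightarrow> 'a \<Rightarrow>\<^sub>L 'b) set"
  where "schur_class U V = {\<Theta> \<in> extensional (ball 0 1). \<forall>z\<in>ball 0 1.
    \<Theta> z \<in> bop U V \<and> norm (\<Theta> z) \<le> 1 \<and>
    (\<exists>\<Theta>'. (\<Theta> has_derivative \<Theta>') (at z) \<and>
      (\<forall>h x. blinfun_apply (\<Theta>' h) x = h *\<^sub>C blinfun_apply (\<Theta>' 1) x))}"

definition schur_next ::
    "'a::complex_inner set \<Rightarrow> 'b::complex_inner set \<Rightarrow> (complex \<Rightarrow> 'a \<Rightarrow>\<^sub>L 'b) \<Rightarrow> complex \<Rightarrow> 'a \<Rightarrow>\<^sub>L 'b"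
  where "schur_next U V \<Theta> = (let \<Gamma> = \<Theta> 0 in
    THE \<Theta>'. \<Theta>' \<in> schur_class (defect_space U \<Gamma>) (defect_space V (adj \<Gamma>)) \<and>
      (\<forall>z\<in>ball 0 1. \<forall>x\<in>U. blinfun_apply (\<Theta> z) x = blinfun_apply \<Gamma> x +
        z *\<^sub>C blinfun_apply (defect_op V (adj \<Gamma>)) (blinfun_apply (\<Theta>' z)
          (the_inv_into (defect_space U \<Gamma>)
            (\<lambda>u. u + z *\<^sub>C blinfun_apply (adj \<Gamma>) (blinfun_apply (\<Theta>' z) u))
            (blinfun_apply (defect_op U \<Gamma>) x)))))"

text \<open>One step of the Schur algorithm; the state carries the domain and codomain of the current
  function.\<close>

fun schur_step ::
    "'a::complex_inner set \<times> 'b::complex_inner set \<times> (complex \<Rightarrow> 'a \<Rightarrow>\<^sub>L 'b)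
      \<Rightarrow> 'a set \<times> 'b set \<times> (complex \<Rightarrow> 'a \<Rightarrow>\<^sub>L 'b)"
  where "schur_step (U, V, \<Theta>) =
    (defect_space U (\<Theta> 0), defect_space V (adj (\<Theta> 0)), schur_next U V \<Theta>)"

definition schur_param ::
    "'a::complex_inner set \<Rightarrow> 'b::complex_inner set \<Rightarrow> (complex \<Rightarrow> 'a \<Rightarrow>\<^sub>L 'b) \<Rightarrow> nat \<Rightarrow> 'a \<Rightarrow>\<^sub>L 'b"
  where "schur_param U V \<Theta> k = (case (schur_step ^^ k) (U, V, \<Theta>) of (_, _, \<Theta>k) \<Rightarrow> \<Theta>k 0)"


section \<open>Choice sequences\<close>

text \<open>The index is shifted by one: \<open>dspace \<Gamma> k\<close> is the defect space of \<open>\<Gamma>\<close> at \<open>k - 1\<close>,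
  which is the domain of \<open>\<Gamma> k\<close>; in particular \<open>dspace \<Gamma> 0\<close> is the whole space.
  Applied to the sequence of adjoints it gives the codomains.\<close>

primrec dspace :: "(nat \<Rightarrow> 'a::complex_inner \<Rightarrow>\<^sub>L 'b::complex_inner) \<Rightarrow> nat \<Rightarrow> 'a set"
  where
    "dspace \<Gamma> 0 = UNIV"
  | "dspace \<Gamma> (Suc k) = defect_space (dspace \<Gamma> k) (\<Gamma> k)"

abbreviation dspace_adj :: "(nat \<Rightarrow> 'a::complex_inner \<Rightarrow>\<^sub>L 'b::complex_inner) \<Rightarrow> nat \<Rightarrow> 'b set"
  where "dspace_adj \<Gamma> \<equiv> dspace (\<lambda>k. adj (\<Gamma> k))"

text \<open>Only the members with index at most \<open>m\<close> are constrained.\<close>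

definition choice_sequence_upto ::
    "nat \<Rightarrow> (nat \<Rightarrow> 'a::complex_inner \<Rightarrow>\<^sub>L 'b::complex_inner) \<Rightarrow> bool"
  where "choice_sequence_upto m \<Gamma> \<longleftrightarrow>
    (\<forall>k\<le>m. \<Gamma> k \<in> bop (dspace \<Gamma> k) (dspace_adj \<Gamma> k) \<and> norm (\<Gamma> k) \<le> 1)"

definition dop :: "(nat \<Rightarrow> 'a::complex_inner \<Rightarrow>\<^sub>L 'b::complex_inner) \<Rightarrow> nat \<Rightarrow> 'a \<Rightarrow> 'a"
  where "dop \<Gamma> k = blinfun_apply (defect_op (dspace \<Gamma> k) (\<Gamma> k))"

abbreviation dop_adj :: "(nat \<Rightarrow> 'a::complex_inner \<Rightarrow>\<^sub>L 'b::complex_inner) \<Rightarrow> nat \<Rightarrow> 'b \<Rightarrow> 'b"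
  where "dop_adj \<Gamma> \<equiv> dop (\<lambda>k. adj (\<Gamma> k))"


section \<open>The truncated block operator and its transfer functions\<close>

fun rotation :: "(nat \<Rightarrow> 'a::complex_inner \<Rightarrow>\<^sub>L 'b::complex_inner) \<Rightarrow> nat \<Rightarrow> 'a \<times> 'b \<Rightarrow> 'b \<times> 'a"
  where "rotation \<Gamma> k (x, y) =
    (blinfun_apply (\<Gamma> k) x + dop_adj \<Gamma> k y, dop \<Gamma> k x - blinfun_apply (adj (\<Gamma> k)) y)"

definition Hhat :: "(nat \<Rightarrow> 'a::complex_inner \<Rightarrow>\<^sub>L 'b::complex_inner) \<Rightarrow> nat \<Rightarrow> ('a \<times> 'b) set"
  where "Hhat \<Gamma> k = dspace \<Gamma> (2 * k - 2) \<times> dspace_adj \<Gamma> (2 * k - 1)"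

text \<open>Elements of the direct sum are families indexed by \<open>{1..n+1}\<close>, set to \<open>0\<close> elsewhere.\<close>

definition Khat :: "nat \<Rightarrow> (nat \<Rightarrow> 'a::complex_inner \<Rightarrow>\<^sub>L 'b::complex_inner) \<Rightarrow> (nat \<Rightarrow> 'a \<times> 'b) set"
  where "Khat n \<Gamma> = {f. \<forall>k. if k \<in> {1..n+1} then f k \<in> Hhat \<Gamma> k else f k = 0}"

definition right_factor ::
    "nat \<Rightarrow> (nat \<Rightarrow> 'a::complex_inner \<Rightarrow>\<^sub>L 'b::complex_inner) \<Rightarrow> (nat \<Rightarrow> 'a \<times> 'b) \<Rightarrow> nat \<Rightarrow> 'b \<times> 'a"
  where "right_factor n \<Gamma> f =
    (\<lambda>k. if k \<in> {1..n+1} then rotation \<Gamma> (2 * k - 2) (f k) else 0)"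

text \<open>The left factor acts on the regrouped family: for \<open>1 \<le> k \<le> n\<close>, the rotation of index
  \<open>2 k - 1\<close> sends the pair \<open>(snd (g k), fst (g (k + 1)))\<close> to the second component at
  \<open>k\<close> and the first component at \<open>k + 1\<close> of the result.\<close>

definition left_factor ::
    "nat \<Rightarrow> (nat \<Rightarrow> 'a::complex_inner \<Rightarrow>\<^sub>L 'b::complex_inner) \<Rightarrow> (nat \<Rightarrow> 'b \<times> 'a) \<Rightarrow> nat \<Rightarrow> 'a \<times> 'b"
  where "left_factor n \<Gamma> g =
    (\<lambda>k. if k \<in> {1..n+1} then
       (if k = 1 then 0 else snd (rotation \<Gamma> (2 * k - 3) (snd (g (k - 1)), fst (g k))),
        if k = n + 1 then 0 else fst (rotation \<Gamma> (2 * k - 1) (snd (g k), fst (g (k + 1)))))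
     else 0)"

definition Shat ::
    "nat \<Rightarrow> (nat \<Rightarrow> 'a::complex_inner \<Rightarrow>\<^sub>L 'b::complex_inner) \<Rightarrow> (nat \<Rightarrow> 'a \<times> 'b) \<Rightarrow> nat \<Rightarrow> 'a \<times> 'b"
  where "Shat n \<Gamma> f = left_factor n \<Gamma> (right_factor n \<Gamma> f)"

definition pencil ::
    "nat \<Rightarrow> (nat \<Rightarrow> 'a::complex_inner \<Rightarrow>\<^sub>L 'b::complex_inner) \<Rightarrow> complex
      \<Rightarrow> (nat \<Rightarrow> 'a \<times> 'b) \<Rightarrow> nat \<Rightarrow> 'a \<times> 'b"
  where "pencil n \<Gamma> z f = (\<lambda>k. f k - z *\<^sub>C Shat n \<Gamma> f k)"

definition Rhat ::
    "nat \<Rightarrow> (nat \<Rightarrow> 'a::complex_inner \<Rightarrow>\<^sub>L 'b::complex_inner) \<Rightarrow> complex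
      \<Rightarrow> (nat \<Rightarrow> 'a \<times> 'b) \<Rightarrow> nat \<Rightarrow> 'a \<times> 'b"
  where "Rhat n \<Gamma> z = the_inv_into (Khat n \<Gamma>) (pencil n \<Gamma> z)"

text \<open>The embeddings into the direct sum of the first summand of \<open>Hhat \<Gamma> 1\<close> and of the second
  summand of \<open>Hhat \<Gamma> (n + 1)\<close>.\<close>

definition emb_first :: "'a::zero \<Rightarrow> nat \<Rightarrow> 'a \<times> 'b::zero"
  where "emb_first x = (\<lambda>k. if k = 1 then (x, 0) else 0)"

definition emb_last :: "nat \<Rightarrow> 'b::zero \<Rightarrow> nat \<Rightarrow> 'a::zero \<times> 'b"
  where "emb_last n y = (\<lambda>k. if k = n + 1 then (0, y) else 0)"

fun row_first :: "(nat \<Rightarrow> 'a::complex_inner \<Rightarrow>\<^sub>L 'b::complex_inner) \<Rightarrow> 'a \<times> 'b \<Rightarrow> 'b"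
  where "row_first \<Gamma> (x, y) = blinfun_apply (\<Gamma> 0) x + dop_adj \<Gamma> 0 y"

fun row_last :: "nat \<Rightarrow> (nat \<Rightarrow> 'a::complex_inner \<Rightarrow>\<^sub>L 'b::complex_inner) \<Rightarrow> 'a \<times> 'b \<Rightarrow> 'a"
  where "row_last n \<Gamma> (x, y) = dop \<Gamma> (2 * n) x - blinfun_apply (adj (\<Gamma> (2 * n))) y"

text \<open>\<open>theta_fun\<close> and \<open>b_fun\<close> act on the whole space, \<open>a_fun\<close> and \<open>c_fun\<close> are meaningful on
  \<open>dspace_adj \<Gamma> (2 * n + 1)\<close> only.\<close>

definition theta_fun ::
    "nat \<Rightarrow> (nat \<Rightarrow> 'a::complex_inner \<Rightarrow>\<^sub>L 'b::complex_inner) \<Rightarrow> complex \<Rightarrow> 'a \<Rightarrow> 'b"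
  where "theta_fun n \<Gamma> z x = row_first \<Gamma> (Rhat n \<Gamma> z (emb_first x) 1)"

definition a_fun ::
    "nat \<Rightarrow> (nat \<Rightarrow> 'a::complex_inner \<Rightarrow>\<^sub>L 'b::complex_inner) \<Rightarrow> complex \<Rightarrow> 'b \<Rightarrow> 'a"
  where "a_fun n \<Gamma> z y = z *\<^sub>C row_last n \<Gamma> (Rhat n \<Gamma> z (emb_last n y) (n + 1))"

definition b_fun ::
    "nat \<Rightarrow> (nat \<Rightarrow> 'a::complex_inner \<Rightarrow>\<^sub>L 'b::complex_inner) \<Rightarrow> complex \<Rightarrow> 'a \<Rightarrow> 'a"
  where "b_fun n \<Gamma> z x = z *\<^sub>C row_last n \<Gamma> (Rhat n \<Gamma> z (emb_first x) (n + 1))"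

definition c_fun ::
    "nat \<Rightarrow> (nat \<Rightarrow> 'a::complex_inner \<Rightarrow>\<^sub>L 'b::complex_inner) \<Rightarrow> complex \<Rightarrow> 'b \<Rightarrow> 'b"
  where "c_fun n \<Gamma> z y = row_first \<Gamma> (Rhat n \<Gamma> z (emb_last n y) 1)"

end

theory Submission
  imports Defs "HOL-Complex_Analysis.Complex_Analysis"
begin

text \<open>The linear fractional formula of one Schur step says that, with \<open>u\<close> the internal state,
  the rotation of \<open>\<Gamma>\<close> maps \<open>(x, z E(z) u)\<close> to \<open>(\<Theta>(z) x, u)\<close>. Solvability for \<open>E\<close>, given
  \<open>\<Theta>\<close> with \<open>\<Theta>(0) = \<Gamma>\<close>, rests on Caratheodory's inequality: the function
  \<open>\<langle>(I - \<Gamma>\<^sup>* \<Theta>(z)) x, x\<rangle>\<close> has nonnegative real part and the value \<open>\<parallel>D x\<parallel>\<^sup>2\<close> at \<open>0\<close>, so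
  \<open>I - \<Gamma>\<^sup>* \<Theta>(z) = D K(z) D\<close> with \<open>K(z)\<close> bounded and strictly accretive, hence invertible. Then
  \<open>\<Theta>(z) = \<Gamma> + D\<^sub>* N(z) D\<close> with \<open>N(z) = z E(z) K(z)\<close>, and the Schwarz lemma for \<open>N K\<^sup>-\<^sup>1\<close> makes
  \<open>E\<close> a Schur function.

  Composing \<open>2 n + 1\<close> such steps at a fixed \<open>z\<close> gives \<open>(y\<^sub>k, x\<^sub>k\<^sub>+\<^sub>1) = J\<^sub>k (x\<^sub>k, z y\<^sub>k\<^sub>+\<^sub>1)\<close> with
  \<open>x\<^sub>0 = x\<close>, \<open>y\<^sub>0 = \<Theta>(z) x\<close>. The family of the pairs \<open>(z\<^sup>k\<^sup>-\<^sup>1 x\<^sub>2\<^sub>k\<^sub>-\<^sub>2, z\<^sup>k y\<^sub>2\<^sub>k\<^sub>-\<^sub>1)\<close> solves the equation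
  of the pencil, whose solution is unique as the block operator is a contraction; this is the formula.
  The feedback operator is invertible because \<open>\<parallel>a\<^sub>n(z)\<parallel> \<le> \<bar>z\<bar>\<close>.\<close>

section \<open>Complex Hilbert spaces\<close>

text \<open>The obstacle is that \<open>D\<close> has only dense range in its defect space and in
  general no bounded inverse there. The Schur step can therefore not be solved by algebra alone: a
  quotient by \<open>D\<close> is at first given on a dense set, and each one needs a norm bound
  before it extends. Caratheodory's inequality supplies the bound for the quadratic form, in terms
  of the squared norm of \<open>D x\<close> and of |z| alone; polarization passes it on to the
  sesquilinear form, which is what a division by \<open>D\<close> on both sides requires. Constants
  depending on |z| alone serve a second purpose: they are local bounds on the disc, under which
  holomorphy of the matrix elements on dense sets already gives holomorphy in operator norm. The
  comparison of \<open>N\<close> with \<open>K\<close> behind the Schwarz lemma is no estimate of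
  this kind; it comes from the isometry of the adjoint rotation. The correspondence itself rests on
  solvability of one step in both directions and on its uniqueness; the formula is then read off
  from an arbitrary chain of steps.\<close>

instance complex_hilbert \<subseteq> banach ..

lemma cinner_add_right: "cinner x (y + w) = cinner x y + cinner x w"
  by (metis cinner_add_left cinner_commute complex_cnj_add)

lemma cinner_scaleC_right: "cinner x (c *\<^sub>C y) = cnj c * cinner x y"
  by (metis cinner_scaleC_left cinner_commute complex_cnj_mult)

lemma cinner_self: "cinner x x = complex_of_real ((norm x)\<^sup>2)"
proof (rule complex_eqI)
  show "Re (cinner x x) = Re (complex_of_real ((norm x)\<^sup>2))"
    by (simp add: inner_cinner[symmetric] power2_norm_eq_inner)
  show "Im (cinner x x) = Im (complex_of_real ((norm x)\<^sup>2))"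
    using cinner_commute[of x x] by (metis Im_complex_of_real Reals_cnj_iff complex_is_Real_iff)
qed

lemma cmod_cinner_self: "cmod (cinner x x) = norm x * norm x"
  unfolding cinner_self norm_of_real by (simp add: power2_eq_square)

lemma scaleC_one: "1 *\<^sub>C x = x" for x :: "'a::complex_vector"
  using scaleR_scaleC[of 1 x] by simp

lemma scaleC_zero_left: "0 *\<^sub>C x = 0" for x :: "'a::complex_vector"
  using scaleR_scaleC[of 0 x] by simp

lemma scaleC_zero_right: "c *\<^sub>C 0 = 0" for c
  using scaleC_add_right[of c 0 0] by simp

lemma scaleC_minus_right: "c *\<^sub>C (- x) = - (c *\<^sub>C x)" for x :: "'a::complex_vector"
  using scaleC_add_right[of c x "- x"] by (simp add: scaleC_zero_right eq_neg_iff_add_eq_0 add.commute)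

lemma scaleC_minus_left: "(- c) *\<^sub>C x = - (c *\<^sub>C x)" for x :: "'a::complex_vector"
  using scaleC_add_left[of c "- c" x] by (simp add: scaleC_zero_left eq_neg_iff_add_eq_0 add.commute)

lemma scaleC_diff_right: "c *\<^sub>C (x - y) = c *\<^sub>C x - c *\<^sub>C y" for x :: "'a::complex_vector"
  using scaleC_add_right[of c x "- y"] by (simp add: scaleC_minus_right)

lemma norm_scaleC: "norm (c *\<^sub>C x) = cmod c * norm x"
  for x :: "'a::complex_inner"
proof -
  have "cinner (c *\<^sub>C x) (c *\<^sub>C x) = c * cnj c * cinner x x"
    by (simp add: cinner_scaleC_left cinner_scaleC_right)
  then have "complex_of_real ((norm (c *\<^sub>C x))\<^sup>2) = c * cnj c * complex_of_real ((norm x)\<^sup>2)"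
    by (simp only: cinner_self)
  also have "\<dots> = complex_of_real ((cmod c * norm x)\<^sup>2)"
    by (simp add: complex_mult_cnj cmod_def power_mult_distrib)
  finally have "(norm (c *\<^sub>C x))\<^sup>2 = (cmod c * norm x)\<^sup>2"
    using of_real_eq_iff by blast
  then show ?thesis by (simp add: power2_eq_iff_nonneg)
qed

lemma cmod_cinner_le: "cmod (cinner x y) \<le> norm x * norm y"
proof (cases "cinner x y = 0")
  case False
  define c where "c = cnj (cinner x y) / cmod (cinner x y)"
  have "cmod c = 1" using False by (simp add: c_def norm_divide)
  have "c * cinner x y = complex_of_real (cmod (cinner x y))"
    using False by (simp add: c_def complex_norm_square[symmetric] power2_eq_square mult.commute)
  then have "cmod (cinner x y) = inner (c *\<^sub>C x) y"
    by (simp add: inner_cinner cinner_scaleC_left)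
  also have "\<dots> \<le> norm (c *\<^sub>C x) * norm y" by (rule norm_cauchy_schwarz)
  finally show ?thesis by (simp add: norm_scaleC \<open>cmod c = 1\<close>)
qed simp

text \<open>Bilinearity is meant over the reals, so conjugate linearity in the second argument is no
  obstacle, and the general rules for limits, continuity and derivatives become available for inner
  products.\<close>

interpretation cinner: bounded_bilinear cinner
proof (rule bounded_bilinear.intro)
  show "\<exists>K. \<forall>a b. norm (cinner a b) \<le> norm a * norm b * K"
    by (intro exI[of _ 1]) (simp add: cmod_cinner_le)
qed (simp_all add: cinner_add_left cinner_add_right scaleR_scaleC cinner_scaleC_left
    cinner_scaleC_right scaleR_conv_of_real scaleC_complex_def)

interpretation scaleC: bounded_bilinear "scaleC :: complex \<Rightarrow> 'a::complex_inner \<Rightarrow> 'a"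
proof (rule bounded_bilinear.intro)
  show "\<exists>K. \<forall>(a::complex) b::'a. norm (a *\<^sub>C b) \<le> norm a * norm b * K"
    by (intro exI[of _ 1]) (simp add: norm_scaleC)
qed (simp_all add: scaleC_add_left scaleC_add_right scaleR_scaleC scaleC_scaleC
    scaleR_conv_of_real scaleC_complex_def mult.commute)

declare cinner.zero_left [simp] cinner.zero_right [simp] scaleC.zero_left [simp]

lemma norm_add_sq: "(norm (x + y))\<^sup>2 = (norm x)\<^sup>2 + (norm y)\<^sup>2 + 2 * Re (cinner x y)"
  for x y :: "'a::complex_inner"
  by (simp add: power2_norm_eq_inner inner_add_left inner_add_right inner_commute
      inner_cinner[symmetric])

lemma norm_diff_sq: "(norm (x - y))\<^sup>2 = (norm x)\<^sup>2 + (norm y)\<^sup>2 - 2 * Re (cinner x y)"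
  for x y :: "'a::complex_inner" using norm_add_sq[of x "- y"] by (simp add: cinner.minus_right)

lemma cinner_eq_zero_commute: "cinner x y = 0 \<longleftrightarrow> cinner y x = 0"
  by (metis cinner_commute complex_cnj_zero)

lemma cinner_self_eq_zero: "cinner x x = 0 \<longleftrightarrow> x = 0"
  by (simp add: cinner_self)

lemma cinner_eqI: "(\<And>w. cinner x w = cinner y w) \<Longrightarrow> x = y"
  by (metis cinner.diff_left cinner_self_eq_zero right_minus_eq)

lemma cinner_eqI': "(\<And>w. cinner w x = cinner w y) \<Longrightarrow> x = y"
  by (rule cinner_eqI) (subst (1 2) cinner_commute, simp)

section \<open>Closed subspaces and orthogonal projections\<close>

text \<open>\<open>bop\<close> makes sense for arbitrary sets; this predicate carries the closed
  complex subspace structure that the correspondence between operators on \<open>U\<close> and their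
  extensions by zero relies on.\<close>

definition csub :: "'a::complex_inner set \<Rightarrow> bool"
  where "csub U \<longleftrightarrow> closed U \<and> 0 \<in> U \<and> (\<forall>x\<in>U. \<forall>y\<in>U. x + y \<in> U) \<and> (\<forall>c. \<forall>x\<in>U. c *\<^sub>C x \<in> U)"

lemma csub_closed: "csub U \<Longrightarrow> closed U"
  and csub_zero: "csub U \<Longrightarrow> 0 \<in> U"
  and csub_add: "csub U \<Longrightarrow> x \<in> U \<Longrightarrow> y \<in> U \<Longrightarrow> x + y \<in> U"
  and csub_scaleC: "csub U \<Longrightarrow> x \<in> U \<Longrightarrow> c *\<^sub>C x \<in> U"
  by (auto simp: csub_def)

lemma csub_scaleR: "csub U \<Longrightarrow> x \<in> U \<Longrightarrow> r *\<^sub>R x \<in> U"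
  by (simp add: scaleR_scaleC csub_scaleC)

lemma csub_minus: "csub U \<Longrightarrow> x \<in> U \<Longrightarrow> - x \<in> U"
  using csub_scaleR[of U x "- 1"] by simp

lemma csub_diff: "csub U \<Longrightarrow> x \<in> U \<Longrightarrow> y \<in> U \<Longrightarrow> x - y \<in> U"
  using csub_add[of U x "- y"] csub_minus[of U y] by simp

lemma csub_UNIV: "csub UNIV"
  by (simp add: csub_def)

lemma parallelogram:
  "(norm (x - y))\<^sup>2 + 4 * (norm (w - (1/2) *\<^sub>R (x + y)))\<^sup>2 = 2 * (norm (w - x))\<^sup>2 + 2 * (norm (w - y))\<^sup>2"
  for x :: "'a::real_inner" by (simp add: power2_norm_eq_inner algebra_simps inner_commute)

lemma orthogonal_projection_exists:
  fixes x :: "'a::complex_hilbert"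
  assumes U: "csub U"
  shows "\<exists>p\<in>U. \<forall>u\<in>U. cinner (x - p) u = 0"
proof -
  define d where "d = (INF u\<in>U. norm (x - u))"
  have ne: "(\<lambda>u. norm (x - u)) ` U \<noteq> {}" using csub_zero[OF U] by auto
  have bdd: "bdd_below ((\<lambda>u. norm (x - u)) ` U)" by (rule bdd_belowI[of _ 0]) auto
  have d: "d \<le> norm (x - u)" if "u \<in> U" for u
    unfolding d_def using bdd that by (rule cINF_lower)
  have "d \<ge> 0" unfolding d_def using csub_zero[OF U] by (intro cINF_greatest) auto
  have "\<exists>u\<in>U. norm (x - u) < d + 1 / Suc n" for n
    using cINF_less_iff[OF _ bdd, of "d + 1 / Suc n"] csub_zero[OF U]
    unfolding d_def[symmetric] by auto
  then obtain u where u: "\<And>n. u n \<in> U" "\<And>n. norm (x - u n) < d + 1 / Suc n" by metis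
  have lim: "(\<lambda>n. norm (x - u n)) \<longlonglongrightarrow> d"
  proof (rule tendsto_sandwich[where f = "\<lambda>_. d" and h = "\<lambda>n. d + 1 / real (Suc n)"])
    show "(\<lambda>n. d + 1 / Suc n) \<longlonglongrightarrow> d"
      using tendsto_add[OF tendsto_const[of d] LIMSEQ_Suc[OF lim_1_over_n]] by simp
    show "\<forall>\<^sub>F n in sequentially. norm (x - u n) \<le> d + 1 / real (Suc n)"
      using u(2) by (intro always_eventually allI less_imp_le)
    show "\<forall>\<^sub>F n in sequentially. d \<le> norm (x - u n)"
      using u(1) by (intro always_eventually allI d)
  qed simp
  have "Cauchy u"
  proof (rule metric_CauchyI)
    fix e :: real assume "e > 0"
    have "(\<lambda>n. (norm (x - u n))\<^sup>2) \<longlonglongrightarrow> d\<^sup>2"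
      using lim by (intro tendsto_intros)
    then obtain N where N: "\<And>n. n \<ge> N \<Longrightarrow> (norm (x - u n))\<^sup>2 < d\<^sup>2 + e\<^sup>2 / 4"
      using order_tendstoD(2)[of _ "d\<^sup>2" sequentially "d\<^sup>2 + e\<^sup>2 / 4"] \<open>e > 0\<close>
      by (auto simp: eventually_sequentially)
    have "dist (u m) (u n) < e" if "m \<ge> N" "n \<ge> N" for m n
    proof -
      have "d \<le> norm (x - (1/2) *\<^sub>R (u m + u n))" by (intro d csub_scaleR csub_add U u)
      then have "d\<^sup>2 \<le> (norm (x - (1/2) *\<^sub>R (u m + u n)))\<^sup>2"
        using \<open>d \<ge> 0\<close> by (intro power_mono)
      then have "(norm (u m - u n))\<^sup>2 < e\<^sup>2"
        using parallelogram[of "u m" "u n" x] N[OF that(1)] N[OF that(2)] by linarith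
      then show ?thesis
        using \<open>e > 0\<close> by (simp add: dist_norm power_less_imp_less_base less_imp_le)
    qed
    then show "\<exists>M. \<forall>m\<ge>M. \<forall>n\<ge>M. dist (u m) (u n) < e" by blast
  qed
  then obtain p where p: "u \<longlonglongrightarrow> p"
    by (auto simp: Cauchy_convergent_iff convergent_def)
  have "p \<in> U" using csub_closed[OF U] u(1) p by (rule closed_sequentially)
  have "norm (x - p) = d" by (rule LIMSEQ_unique[OF _ lim]) (intro tendsto_intros p)
  have re: "inner (x - p) w = 0" if "w \<in> U" for w
  proof (cases "w = 0")
    case False
    \<comment> \<open>This \<open>t\<close> minimizes the distance from \<open>x\<close> to
      \<open>p + t w\<close>; since \<open>p\<close> is already nearest, nothing can be gained,
      which forces the real inner product to vanish.\<close>
    define t where "t = inner (x - p) w / (norm w)\<^sup>2"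
    have "d \<le> norm (x - (p + t *\<^sub>R w))"
      by (intro d csub_add csub_scaleR U \<open>p \<in> U\<close> that)
    then have "(norm (x - p))\<^sup>2 \<le> (norm ((x - p) - t *\<^sub>R w))\<^sup>2"
      using \<open>d \<ge> 0\<close> \<open>norm (x - p) = d\<close> by (simp add: power_mono algebra_simps)
    also have "\<dots> = (norm (x - p))\<^sup>2 - 2 * t * inner (x - p) w + t\<^sup>2 * (norm w)\<^sup>2"
      by (simp only: power2_norm_eq_inner inner_diff_left inner_diff_right inner_scaleR_left
          inner_scaleR_right) (simp add: inner_commute power2_eq_square algebra_simps)
    also have "t\<^sup>2 * (norm w)\<^sup>2 = t * inner (x - p) w"
      using False by (simp add: t_def power2_eq_square)
    finally have "t * inner (x - p) w \<le> 0" by simp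
    then have "(inner (x - p) w)\<^sup>2 / (norm w)\<^sup>2 \<le> 0"
      by (simp add: t_def power2_eq_square)
    then show ?thesis using False by (simp add: divide_le_0_iff)
  qed simp
  \<comment> \<open>The real orthogonality to \<open>i w\<close> is the vanishing of the imaginary
    part.\<close>
  have "cinner (x - p) w = 0" if "w \<in> U" for w
  proof (rule complex_eqI)
    show "Re (cinner (x - p) w) = Re 0" using re[OF that] by (simp add: inner_cinner)
    show "Im (cinner (x - p) w) = Im 0"
      using re[OF csub_scaleC[OF U that, of \<i>]] by (simp add: inner_cinner cinner_scaleC_right)
  qed
  then show ?thesis using \<open>p \<in> U\<close> by blast
qed

section \<open>Calculus of operators between closed subspaces\<close>

lemma ex_blinfun:
  fixes f :: "'a::complex_inner \<Rightarrow> 'b::complex_inner"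
  assumes "\<And>x y. f (x + y) = f x + f y" "\<And>c x. f (c *\<^sub>C x) = c *\<^sub>C f x"
    "\<And>x. norm (f x) \<le> K * norm x"
  shows "\<exists>T. blinfun_apply T = f"
proof -
  have "bounded_linear f"
    by (rule bounded_linear_intro[of _ K]) (auto simp: assms scaleR_scaleC mult.commute)
  then show ?thesis by (metis bounded_linear_Blinfun_apply)
qed

lemma bopI:
  assumes "\<And>c x. blinfun_apply T (c *\<^sub>C x) = c *\<^sub>C blinfun_apply T x" "\<And>x. blinfun_apply T x \<in> V"
    "\<And>x. (\<And>u. u \<in> U \<Longrightarrow> cinner x u = 0) \<Longrightarrow> blinfun_apply T x = 0"
  shows "T \<in> bop U V"
  using assms by (auto simp: bop_def)

lemma bop_scaleC: "T \<in> bop U V \<Longrightarrow> blinfun_apply T (c *\<^sub>C x) = c *\<^sub>C blinfun_apply T x"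
  and bop_range: "T \<in> bop U V \<Longrightarrow> blinfun_apply T x \<in> V"
  and bop_zero: "T \<in> bop U V \<Longrightarrow> (\<And>u. u \<in> U \<Longrightarrow> cinner x u = 0) \<Longrightarrow> blinfun_apply T x = 0"
  by (auto simp: bop_def)

lemma bop_compose: "S \<in> bop V W \<Longrightarrow> T \<in> bop U V \<Longrightarrow> S o\<^sub>L T \<in> bop U W"
  by (auto intro!: bopI simp: bop_scaleC bop_range bop_zero blinfun.zero_right)

lemma bop_add: "csub V \<Longrightarrow> S \<in> bop U V \<Longrightarrow> T \<in> bop U V \<Longrightarrow> S + T \<in> bop U V"
  by (auto intro!: bopI simp: bop_scaleC bop_range bop_zero blinfun.add_left scaleC_add_right csub_add)

lemma bop_diff: "csub V \<Longrightarrow> S \<in> bop U V \<Longrightarrow> T \<in> bop U V \<Longrightarrow> S - T \<in> bop U V"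
  by (auto intro!: bopI simp: bop_scaleC bop_range bop_zero blinfun.diff_left scaleC_diff_right csub_diff)

lemma bop_scaleR: "csub V \<Longrightarrow> T \<in> bop U V \<Longrightarrow> r *\<^sub>R T \<in> bop U V"
  by (auto intro!: bopI simp: bop_scaleC bop_range bop_zero blinfun.scaleR_left scaleR_scaleC
      scaleC_scaleC csub_scaleC scaleC_zero_right mult.commute)

lemma bop_0: "csub V \<Longrightarrow> 0 \<in> bop U V"
  by (auto intro!: bopI simp: csub_zero scaleC_zero_right)

lemma tendsto_blinfun_apply:
  "(T \<longlongrightarrow> S) F \<Longrightarrow> ((\<lambda>n. blinfun_apply (T n) x) \<longlongrightarrow> blinfun_apply S x) F"
  by (intro tendsto_intros)

lemma bop_lim:
  assumes V: "csub V" and lim: "T \<longlonglongrightarrow> S" and T: "\<And>n. T n \<in> bop U V"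
  shows "S \<in> bop U V"
proof (rule bopI)
  note l = tendsto_blinfun_apply[OF lim]
  show "blinfun_apply S (c *\<^sub>C x) = c *\<^sub>C blinfun_apply S x" for c x
    using LIMSEQ_unique[OF l[of "c *\<^sub>C x"]] scaleC.tendsto[OF tendsto_const l, of c x] bop_scaleC[OF T]
    by simp
  show "blinfun_apply S x \<in> V" for x
    using csub_closed[OF V] bop_range[OF T] l by (rule closed_sequentially)
  show "blinfun_apply S x = 0" if "\<And>u. u \<in> U \<Longrightarrow> cinner x u = 0" for x
    using l[of x] bop_zero[OF T that] LIMSEQ_unique[OF _ tendsto_const] by auto
qed

lemma orthogonal_projection_unique:
  assumes U: "csub U" and "p \<in> U" "\<And>u. u \<in> U \<Longrightarrow> cinner (x - p) u = 0"
    and "q \<in> U" "\<And>u. u \<in> U \<Longrightarrow> cinner (x - q) u = 0"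
  shows "p = q"
proof -
  have "p - q \<in> U" by (intro csub_diff assms)
  then have "cinner (x - q) (p - q) - cinner (x - p) (p - q) = 0" by (simp add: assms)
  then have "cinner (p - q) (p - q) = 0" by (simp add: cinner.diff_left)
  then show ?thesis by (simp add: cinner_self_eq_zero)
qed

text \<open>Under extension by zero this is the identity operator of \<open>U\<close>; it takes the
  place of I in all expressions such as I - \<Gamma>*\<Gamma>.\<close>

definition proj :: "'a::complex_hilbert set \<Rightarrow> 'a \<Rightarrow>\<^sub>L 'a"
  where "proj U = (SOME P. \<forall>x. blinfun_apply P x \<in> U \<and> (\<forall>u\<in>U. cinner (x - blinfun_apply P x) u = 0))"

lemma
  assumes U: "csub U"
  shows proj_in: "blinfun_apply (proj U) x \<in> U"
    and proj_orth: "u \<in> U \<Longrightarrow> cinner (x - blinfun_apply (proj U) x) u = 0"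
proof -
  obtain p where p: "\<And>x. p x \<in> U" "\<And>x u. u \<in> U \<Longrightarrow> cinner (x - p x) u = 0"
    using orthogonal_projection_exists[OF U] by metis
  note uniq = orthogonal_projection_unique[OF U p]
  have "\<exists>P. blinfun_apply P = p"
  proof (rule ex_blinfun[where K = 1])
    show "p (x + y) = p x + p y" for x y using p(2)[of _ x] p(2)[of _ y]
      by (intro uniq csub_add U p(1)) (simp_all add: cinner.diff_left cinner_add_left)
    show "p (c *\<^sub>C x) = c *\<^sub>C p x" for c x using p(2)[of _ x]
      by (intro uniq csub_scaleC U p(1)) (simp_all add: cinner.diff_left cinner_scaleC_left)
    show "norm (p x) \<le> 1 * norm x" for x
    proof -
      have "(norm x)\<^sup>2 = (norm (x - p x))\<^sup>2 + (norm (p x))\<^sup>2"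
        using norm_add_sq[of "x - p x" "p x"] p by simp
      then have "(norm (p x))\<^sup>2 \<le> (norm x)\<^sup>2" by simp
      then show ?thesis by (simp add: abs_le_square_iff[symmetric])
    qed
  qed
  then have "\<exists>P. \<forall>x. blinfun_apply P x \<in> U \<and> (\<forall>u\<in>U. cinner (x - blinfun_apply P x) u = 0)"
    using p by metis
  from someI_ex[OF this] show "blinfun_apply (proj U) x \<in> U"
    and "u \<in> U \<Longrightarrow> cinner (x - blinfun_apply (proj U) x) u = 0"
    by (simp_all add: proj_def)
qed

lemma proj_eqI:
  "csub U \<Longrightarrow> q \<in> U \<Longrightarrow> (\<And>u. u \<in> U \<Longrightarrow> cinner (x - q) u = 0) \<Longrightarrow> blinfun_apply (proj U) x = q"
  by (rule orthogonal_projection_unique[OF _ proj_in proj_orth])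

lemma proj_id: "csub U \<Longrightarrow> x \<in> U \<Longrightarrow> blinfun_apply (proj U) x = x"
  by (rule proj_eqI) auto

lemma proj_bop: "csub U \<Longrightarrow> proj U \<in> bop U U"
proof (rule bopI)
  assume U: "csub U"
  show "proj U (c *\<^sub>C x) = c *\<^sub>C proj U x" for c x using proj_orth[OF U, of _ x]
    by (intro proj_eqI csub_scaleC U proj_in) (simp add: cinner.diff_left cinner_scaleC_left)
  show "proj U x = 0" if "\<And>u. u \<in> U \<Longrightarrow> cinner x u = 0" for x
    using that U by (intro proj_eqI csub_zero) auto
qed (rule proj_in)

lemma proj_norm_sq: "csub U \<Longrightarrow> (norm x)\<^sup>2 = (norm (x - proj U x))\<^sup>2 + (norm (proj U x))\<^sup>2"
  using norm_add_sq[of "x - proj U x" "proj U x"] proj_orth[of U "proj U x" x] proj_in[of U x] by simp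

lemma norm_proj_le: "csub U \<Longrightarrow> norm (proj U x) \<le> norm x"
  using proj_norm_sq[of U x] by - (rule power2_le_imp_le, simp_all)

lemma bop_proj: "csub U \<Longrightarrow> T \<in> bop U V \<Longrightarrow> blinfun_apply T (proj U x) = blinfun_apply T x"
  using bop_zero[of T U V "x - proj U x"] by (simp add: blinfun.diff_right proj_orth)

lemma cinner_proj_right: "csub U \<Longrightarrow> u \<in> U \<Longrightarrow> cinner u (proj U x) = cinner u x"
  using proj_orth[of U u x] cinner_eq_zero_commute[of "x - proj U x" u]
  by (simp add: cinner.diff_right)

lemma cinner_proj_left: "csub U \<Longrightarrow> u \<in> U \<Longrightarrow> cinner (proj U x) u = cinner x u"
  using proj_orth[of U u x] by (simp add: cinner.diff_left)

text \<open>A closed subspace equals its double orthogonal complement. This locates the values of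
  operators that are known only through inner products, such as adjoints and derivatives.\<close>

lemma csub_mem_iff: "csub U \<Longrightarrow> (\<And>w. (\<And>u. u \<in> U \<Longrightarrow> cinner w u = 0) \<Longrightarrow> cinner w y = 0) \<Longrightarrow> y \<in> U"
  for y :: "'a::complex_hilbert"
proof -
  assume U: "csub U" and *: "\<And>w. (\<And>u. u \<in> U \<Longrightarrow> cinner w u = 0) \<Longrightarrow> cinner w y = 0"
  have "cinner (y - proj U y) y = 0" using *[of "y - proj U y"] proj_orth[OF U] by blast
  then have "cinner (y - proj U y) (y - proj U y) = 0"
    using proj_orth[OF U proj_in[OF U]] by (simp add: cinner.diff_right)
  then show "y \<in> U" using proj_in[OF U, of y] by (simp add: cinner_self_eq_zero)
qed

lemma closure_sequenceE:
  fixes S :: "'a::first_countable_topology set"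
  assumes "x \<in> closure S"
  obtains a where "\<And>n. a n \<in> S" "a \<longlonglongrightarrow> x"
  using assms by (auto simp: closure_sequential)

text \<open>Both operators vanish on the orthogonal complement of \<open>U\<close>, so
  \<open>U\<close> decides, and there continuity reduces the matter to \<open>A\<close>. Typically
  \<open>U\<close> is a defect space and \<open>A\<close> the image of a defect operator.\<close>

lemma bop_ext:
  fixes T :: "'a::complex_hilbert \<Rightarrow>\<^sub>L 'b::complex_inner"
  assumes U: "csub U" and T: "T \<in> bop U V" and S: "S \<in> bop U V" and A: "U \<subseteq> closure A"
    and eq: "\<And>x. x \<in> A \<Longrightarrow> blinfun_apply T x = blinfun_apply S x"
  shows "T = S"
proof (rule blinfun_eqI)
  fix x
  have "T u = S u" if "u \<in> U" for u
  proof -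
    obtain a where a: "\<And>n. a n \<in> A" "a \<longlonglongrightarrow> u"
      using subsetD[OF A \<open>u \<in> U\<close>] by (rule closure_sequenceE) blast
    have "(\<lambda>n. T (a n)) \<longlonglongrightarrow> T u" "(\<lambda>n. S (a n)) \<longlonglongrightarrow> S u"
      by (intro tendsto_intros a)+
    then show ?thesis unfolding eq[OF a(1)] by (rule LIMSEQ_unique)
  qed
  then show "T x = S x"
    using bop_proj[OF U T, of x] bop_proj[OF U S, of x] proj_in[OF U, of x] by simp
qed

lemma bop_norm_le:
  fixes T :: "'a::complex_hilbert \<Rightarrow>\<^sub>L 'b::complex_inner"
  assumes U: "csub U" and T: "T \<in> bop U V" and A: "U \<subseteq> closure A" "K \<ge> 0"
    and le: "\<And>x. x \<in> A \<Longrightarrow> norm (blinfun_apply T x) \<le> K * norm x"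
  shows "norm T \<le> K"
proof (rule norm_blinfun_bound[OF \<open>K \<ge> 0\<close>])
  fix x
  have *: "norm (T u) \<le> K * norm u" if "u \<in> U" for u
  proof -
    obtain a where a: "\<And>n. a n \<in> A" "a \<longlonglongrightarrow> u"
      using subsetD[OF A(1) \<open>u \<in> U\<close>] by (rule closure_sequenceE) blast
    have "(\<lambda>n. norm (T (a n))) \<longlonglongrightarrow> norm (T u)" "(\<lambda>n. K * norm (a n)) \<longlonglongrightarrow> K * norm u"
      by (intro tendsto_intros a)+
    then show ?thesis by (rule LIMSEQ_le) (auto intro: le a)
  qed
  have "norm (T x) \<le> K * norm (proj U x)"
    using *[OF proj_in[OF U], of x] by (simp add: bop_proj[OF U T])
  also have "\<dots> \<le> K * norm x"
    by (intro mult_left_mono norm_proj_le U \<open>K \<ge> 0\<close>)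
  finally show "norm (T x) \<le> K * norm x" .
qed

section \<open>Adjoints\<close>

lemma riesz:
  fixes \<phi> :: "'a::complex_hilbert \<Rightarrow> complex"
  assumes add: "\<And>x y. \<phi> (x + y) = \<phi> x + \<phi> y" and sc: "\<And>c x. \<phi> (c *\<^sub>C x) = c * \<phi> x"
    and bd: "\<And>x. cmod (\<phi> x) \<le> K * norm x"
  shows "\<exists>y. \<forall>x. \<phi> x = cinner x y"
proof (cases "\<forall>x. \<phi> x = 0")
  case True
  then show ?thesis by (intro exI[of _ 0]) (simp add: cinner.zero_right)
next
  case False
  then obtain x0 where x0: "\<phi> x0 \<noteq> 0" by blast
  have bl: "bounded_linear \<phi>" by (rule bounded_linear_intro[of _ K])
      (auto simp: add sc bd scaleR_scaleC scaleC_complex_def mult.commute)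
  have dif: "\<phi> (x - y) = \<phi> x - \<phi> y" for x y
    using bl by (simp add: bounded_linear.linear linear_diff)
  define U where "U = {x. \<phi> x = 0}"
  have "closed U"
    unfolding U_def by (intro closed_Collect_eq continuous_intros linear_continuous_on bl)
  then have U: "csub U" using sc[of 0 0] by (auto simp: csub_def U_def add sc scaleC_zero_left)
  define w where "w = x0 - proj U x0"
  have w: "cinner w u = 0" if "u \<in> U" for u using proj_orth[OF U that] by (simp add: w_def)
  have \<phi>w: "\<phi> w = \<phi> x0" using proj_in[OF U, of x0] by (simp add: w_def dif U_def)
  then have "w \<noteq> 0" using x0 sc[of 0 0] by (auto simp: scaleC_zero_left)
  \<comment> \<open>The vector \<open>w\<close> spans the orthogonal complement of the kernel of the
    functional; the coefficient is dictated by the value of the functional at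
    \<open>w\<close>.\<close>
  have "\<phi> x = cinner x ((cnj (\<phi> w) / (norm w)\<^sup>2) *\<^sub>C w)" for x
  proof -
    have "x - (\<phi> x / \<phi> w) *\<^sub>C w \<in> U"
      using x0 \<phi>w by (simp add: U_def dif sc)
    then have "cinner (x - (\<phi> x / \<phi> w) *\<^sub>C w) w = 0"
      using w cinner_eq_zero_commute by blast
    then have "cinner x w = \<phi> x / \<phi> w * (norm w)\<^sup>2"
      by (simp add: cinner.diff_left cinner_scaleC_left cinner_self)
    then show ?thesis
      using x0 \<phi>w \<open>w \<noteq> 0\<close> by (simp add: cinner_scaleC_right field_simps)
  qed
  then show ?thesis by blast
qed

lemma adj_exists:
  fixes T :: "'a::complex_hilbert \<Rightarrow>\<^sub>L 'b::complex_hilbert"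
  assumes sc: "\<And>c x. T (c *\<^sub>C x) = c *\<^sub>C T x"
  shows "cinner (T x) y = cinner x (adj T y)" and "norm (adj T) \<le> norm T"
proof -
  have "\<exists>s. \<forall>x. cinner (T x) y = cinner x s" for y
  proof (rule riesz[where K = "norm T * norm y"])
    show "cmod (cinner (T x) y) \<le> norm T * norm y * norm x" for x
    proof -
      have "cmod (cinner (T x) y) \<le> norm (T x) * norm y" by (rule cmod_cinner_le)
      also have "\<dots> \<le> norm T * norm x * norm y" by (intro mult_right_mono norm_blinfun) simp
      finally show ?thesis by (simp add: mult_ac)
    qed
  qed (auto simp: blinfun.add_right cinner_add_left sc cinner_scaleC_left)
  then obtain s where s: "\<And>x y. cinner (T x) y = cinner x (s y)" by metis
  have nm: "norm (s y) \<le> norm T * norm y" for y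
  proof (cases "s y = 0")
    case False
    have "norm (s y) * norm (s y) = cmod (cinner (T (s y)) y)" by (simp add: s cmod_cinner_self)
    also have "\<dots> \<le> norm (T (s y)) * norm y" by (rule cmod_cinner_le)
    also have "\<dots> \<le> norm T * norm (s y) * norm y" by (intro mult_right_mono norm_blinfun) simp
    finally show ?thesis using False by (simp add: mult.assoc mult.left_commute)
  qed simp
  have "\<exists>S. blinfun_apply S = s"
  proof (rule ex_blinfun[where K = "norm T", OF _ _ nm])
    show "s (x + y) = s x + s y" for x y
      by (rule cinner_eqI') (simp add: cinner_add_right s[symmetric])
    show "s (c *\<^sub>C x) = c *\<^sub>C s x" for c x
      by (rule cinner_eqI') (simp add: cinner_scaleC_right s[symmetric])
  qed
  then obtain S where S: "blinfun_apply S = s" ..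
  have "adj T = S" unfolding adj_def
  proof (rule the_equality)
    fix S' assume "\<forall>x y. cinner (T x) y = cinner x (blinfun_apply S' y)"
    then show "S' = S" by - (rule blinfun_eqI, rule cinner_eqI', simp add: S s)
  qed (simp add: S s)
  then show "cinner (T x) y = cinner x (adj T y)" by (simp add: S s)
  show "norm (adj T) \<le> norm T"
    unfolding \<open>adj T = S\<close> by (rule norm_blinfun_bound) (simp_all add: S nm)
qed

context
  fixes T :: "'a::complex_hilbert \<Rightarrow>\<^sub>L 'b::complex_hilbert" and U V
  assumes T: "T \<in> bop U V"
begin

lemma adj: "cinner (T x) y = cinner x (adj T y)"
  by (rule adj_exists) (rule bop_scaleC[OF T])

lemma adj': "cinner (adj T y) x = cinner y (T x)"
  by (metis adj cinner_commute)

lemma adj_bop: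
  assumes U: "csub U" and V: "csub V"
  shows "adj T \<in> bop V U"
proof (rule bopI)
  show "adj T (c *\<^sub>C y) = c *\<^sub>C adj T y" for c y
    by (rule cinner_eqI) (simp add: adj' cinner_scaleC_left)
  show "adj T y \<in> U" for y
    by (rule csub_mem_iff[OF U]) (simp add: adj[symmetric] bop_zero[OF T] cinner.zero_left)
  show "adj T y = 0" if "\<And>u. u \<in> V \<Longrightarrow> cinner y u = 0" for y
    by (rule cinner_eqI) (simp add: adj' that bop_range[OF T] cinner.zero_left)
qed

lemma adj_unique: "(\<And>x y. cinner (T x) y = cinner x (blinfun_apply S y)) \<Longrightarrow> adj T = S"
  by - (rule blinfun_eqI, rule cinner_eqI', simp add: adj[symmetric])

lemma norm_adj_le: "norm (adj T) \<le> norm T"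
  by (rule adj_exists) (rule bop_scaleC[OF T])

end

lemma adj_adj:
  fixes T :: "'a::complex_hilbert \<Rightarrow>\<^sub>L 'b::complex_hilbert"
  assumes "T \<in> bop U V" "csub U" "csub V"
  shows "adj (adj T) = T"
  by (rule adj_unique[OF adj_bop[OF assms] adj'[OF assms(1)]])

section \<open>Extension by continuity\<close>

text \<open>Douglas factorization: the domination makes \<open>D x\<close> to \<open>T x\<close> a
  well defined bounded map on the range of \<open>D\<close>. It extends by continuity to the closure
  \<open>R\<close> and by zero to the complement. Every division by a defect operator goes through
  this lemma.\<close>

lemma factor_exists:
  fixes D :: "'a::complex_hilbert \<Rightarrow>\<^sub>L 'b::complex_hilbert" and T :: "'a \<Rightarrow>\<^sub>L 'c::complex_hilbert"
  assumes D: "D \<in> bop U V" and T: "T \<in> bop U W" and U: "csub U" and W: "csub W"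
    and le: "\<And>x. x \<in> U \<Longrightarrow> norm (T x) \<le> C * norm (D x)"
    and R: "csub R" "R = closure (range (blinfun_apply D))" and "C \<ge> 0"
  shows "\<exists>N\<in>bop R W. (\<forall>x. blinfun_apply N (D x) = T x) \<and> norm N \<le> C"
proof -
  have le': "norm (T x) \<le> C * norm (D x)" for x
    using le[OF proj_in[OF U, of x]] bop_proj[OF U T] bop_proj[OF U D] by simp
  have conv: "\<exists>w. (\<lambda>n. T (x n)) \<longlonglongrightarrow> w" if lim: "(\<lambda>n. D (x n)) \<longlonglongrightarrow> y" for x y
  proof -
    have "Cauchy (\<lambda>n. T (x n))"
    proof (rule metric_CauchyI)
      fix e :: real assume "e > 0"
      \<comment> \<open>The denominator is \<open>C + 1\<close> because \<open>C\<close> may be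
        0.\<close>
      have "e / (C + 1) > 0" using \<open>e > 0\<close> \<open>C \<ge> 0\<close> by simp
      then obtain M where M: "\<And>m n. m \<ge> M \<Longrightarrow> n \<ge> M \<Longrightarrow> dist (D (x m)) (D (x n)) < e / (C + 1)"
        using metric_CauchyD[OF LIMSEQ_imp_Cauchy[OF lim]] by metis
      have "dist (T (x m)) (T (x n)) < e" if "m \<ge> M" "n \<ge> M" for m n
      proof -
        have "dist (T (x m)) (T (x n)) \<le> C * dist (D (x m)) (D (x n))"
          using le'[of "x m - x n"] by (simp add: dist_norm blinfun.diff_right)
        also have "\<dots> \<le> (C + 1) * dist (D (x m)) (D (x n))" by (intro mult_right_mono) auto
        also have "\<dots> < (C + 1) * (e / (C + 1))"
          using M[OF that] \<open>C \<ge> 0\<close> by (intro mult_strict_left_mono) auto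
        finally show ?thesis using \<open>C \<ge> 0\<close> by simp
      qed
      then show "\<exists>M. \<forall>m\<ge>M. \<forall>n\<ge>M. dist (T (x m)) (T (x n)) < e" by blast
    qed
    then show ?thesis by (auto simp: Cauchy_convergent_iff convergent_def)
  qed
  have "\<exists>x w. (\<lambda>n. D (x n)) \<longlonglongrightarrow> proj R y \<and> (\<lambda>n. T (x n)) \<longlonglongrightarrow> w" for y
  proof -
    obtain a where a: "\<And>n. a n \<in> range (blinfun_apply D)" "a \<longlonglongrightarrow> proj R y"
      using proj_in[OF R(1), of y] unfolding R(2) by (rule closure_sequenceE) blast
    have "\<forall>n. \<exists>v. a n = D v" using a(1) by auto
    then obtain x where "\<forall>n. a n = D (x n)" by (rule choice[THEN exE])
    then have "a = (\<lambda>n. D (x n))" by auto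
    then show ?thesis using a conv by blast
  qed
  then obtain x f where xf: "\<And>y. (\<lambda>n. D (x y n)) \<longlonglongrightarrow> proj R y" "\<And>y. (\<lambda>n. T (x y n)) \<longlonglongrightarrow> f y"
    by metis
  \<comment> \<open>The value does not depend on the approximating sequence. Additivity and
    homogeneity of \<open>f\<close> follow by combining sequences.\<close>
  have uniq: "f y = w" if "(\<lambda>n. D (v n)) \<longlonglongrightarrow> proj R y" "(\<lambda>n. T (v n)) \<longlonglongrightarrow> w" for v y w
  proof -
    have "(\<lambda>n. D (x y n - v n)) \<longlonglongrightarrow> proj R y - proj R y"
      unfolding blinfun.diff_right by (intro tendsto_diff xf that)
    then have "(\<lambda>n. C * norm (D (x y n - v n))) \<longlonglongrightarrow> 0"
      using tendsto_mult_right_zero tendsto_norm_zero by fastforce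
    then have "(\<lambda>n. T (x y n - v n)) \<longlonglongrightarrow> 0"
      by (rule Lim_null_comparison[rotated]) (simp add: le')
    moreover have "(\<lambda>n. T (x y n - v n)) \<longlonglongrightarrow> f y - w"
      unfolding blinfun.diff_right by (intro tendsto_diff xf that)
    ultimately show ?thesis using LIMSEQ_unique by fastforce
  qed
  have fsc: "f (c *\<^sub>C y) = c *\<^sub>C f y" for c y
    by (rule uniq[of "\<lambda>n. c *\<^sub>C x y n"])
      (unfold bop_scaleC[OF D] bop_scaleC[OF T] bop_scaleC[OF proj_bop[OF R(1)]],
        (intro scaleC.tendsto tendsto_const xf)+)
  have fle: "norm (f y) \<le> C * norm y" for y
  proof -
    have "norm (f y) \<le> C * norm (proj R y)"
      by (rule LIMSEQ_le[OF tendsto_norm[OF xf(2)] tendsto_mult[OF tendsto_const tendsto_norm[OF xf(1)]]])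
        (simp add: le')
    also have "\<dots> \<le> C * norm y"
      by (intro mult_left_mono norm_proj_le R \<open>C \<ge> 0\<close>)
    finally show ?thesis .
  qed
  have "f (y + z) = f y + f z" for y z
    by (rule uniq[of "\<lambda>n. x y n + x z n"]) (unfold blinfun.add_right, (intro tendsto_add xf)+)
  then have "\<exists>N. blinfun_apply N = f" by (rule ex_blinfun[OF _ fsc fle])
  then obtain N where N: "blinfun_apply N = f" ..
  have z: "f y = 0" if "proj R y = 0" for y
    by (rule uniq[of "\<lambda>_. 0"]) (simp_all add: that blinfun.zero_right)
  have DR: "D v \<in> R" for v unfolding R(2) by (rule closure_subset[THEN subsetD]) simp
  have ND: "N (D v) = T v" for v
    unfolding N by (rule uniq[of "\<lambda>_. v"]) (simp_all add: proj_id R(1) DR)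
  have "N \<in> bop R W"
  proof (rule bopI)
    show "N (c *\<^sub>C y) = c *\<^sub>C N y" for c y unfolding N by (rule fsc)
    show "N y \<in> W" for y
      unfolding N using csub_closed[OF W] bop_range[OF T] xf(2) by (rule closed_sequentially)
    show "N y = 0" if "\<And>u. u \<in> R \<Longrightarrow> cinner y u = 0" for y
      unfolding N using bop_zero[OF proj_bop[OF R(1)] that] z by blast
  qed
  moreover have "norm N \<le> C"
    using \<open>C \<ge> 0\<close> fle by (intro norm_blinfun_bound) (simp_all add: N)
  ultimately show ?thesis using ND by (intro bexI[of _ N] conjI allI)
qed

section \<open>Defect operators\<close>

text \<open>The square root of \<open>I - X\<close> is \<open>I - Y\<close> for the limit \<open>Y\<close> of the iteration
  \<open>Y \<mapsto> (X + Y\<^sup>2) / 2\<close>, which is majorized by the same iteration for \<open>X = 1\<close>.\<close>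

primrec sq_iter :: "('a::real_normed_vector \<Rightarrow>\<^sub>L 'a) \<Rightarrow> nat \<Rightarrow> ('a \<Rightarrow>\<^sub>L 'a)"
  where
    "sq_iter X 0 = 0"
  | "sq_iter X (Suc n) = (1 / 2) *\<^sub>R (X + (sq_iter X n o\<^sub>L sq_iter X n))"

primrec sq_iter_real :: "nat \<Rightarrow> real"
  where
    "sq_iter_real 0 = 0"
  | "sq_iter_real (Suc n) = (1 + (sq_iter_real n)\<^sup>2) / 2"

lemma sq_iter_real_bounds: "0 \<le> sq_iter_real n" "sq_iter_real n \<le> 1"
  by (induction n) (auto simp: power_le_one)

lemma sq_iter_real_le_Suc: "sq_iter_real n \<le> sq_iter_real (Suc n)"
  using zero_le_power2[of "1 - sq_iter_real n"] by (simp add: power2_diff)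

lemma norm_sq_iter_le:
  assumes "norm X \<le> 1"
  shows "norm (sq_iter X n) \<le> sq_iter_real n"
proof (induction n)
  case (Suc n)
  have "norm (X + (sq_iter X n o\<^sub>L sq_iter X n)) \<le> 1 + sq_iter_real n * sq_iter_real n"
    using assms Suc
    by (intro norm_triangle_mono order_trans[OF norm_blinfun_compose] mult_mono) (auto simp: sq_iter_real_bounds)
  then show ?case by (simp add: power2_eq_square)
qed simp

lemma norm_sq_iter_diff_le:
  assumes "norm X \<le> 1"
  shows "norm (sq_iter X (Suc n) - sq_iter X n) \<le> sq_iter_real (Suc n) - sq_iter_real n"
proof (induction n)
  case 0
  then show ?case using assms by simp
next
  case (Suc n)
  let ?Y = "sq_iter X" and ?y = sq_iter_real
  \<comment> \<open>A^2 - B^2 = A (A - B) + (A - B) B holds without commutativity, and its scalar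
    instance produces exactly the increments of the majorant.\<close>
  have "?Y (Suc (Suc n)) - ?Y (Suc n) =
      (1 / 2) *\<^sub>R ((?Y (Suc n) o\<^sub>L (?Y (Suc n) - ?Y n)) + ((?Y (Suc n) - ?Y n) o\<^sub>L ?Y n))"
    by (rule blinfun_eqI)
      (simp only: sq_iter.simps(2)[of X "Suc n"] sq_iter.simps(2)[of X n, THEN sym] blinfun.bilinear_simps
        blinfun_apply_blinfun_compose, simp add: blinfun.bilinear_simps algebra_simps)
  also have "norm \<dots> \<le> (1 / 2) * (?y (Suc n) * (?y (Suc n) - ?y n) + (?y (Suc n) - ?y n) * ?y n)"
    unfolding norm_scaleR
    by (intro mult_mono norm_triangle_mono order_trans[OF norm_blinfun_compose] norm_sq_iter_le assms Suc)
      (auto simp del: sq_iter_real.simps simp: sq_iter_real_bounds sq_iter_real_le_Suc)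
  also have "\<dots> = ?y (Suc (Suc n)) - ?y (Suc n)"
    by (simp only: sq_iter_real.simps(2)[of "Suc n"]) (simp add: power2_eq_square field_simps)
  finally show ?case .
qed

lemma norm_sq_iter_diff_le':
  assumes "norm X \<le> 1" "m \<le> n"
  shows "norm (sq_iter X n - sq_iter X m) \<le> sq_iter_real n - sq_iter_real m"
  using assms(2)
proof (induction n rule: dec_induct)
  case (step n)
  have "norm (sq_iter X (Suc n) - sq_iter X m)
      \<le> norm (sq_iter X (Suc n) - sq_iter X n) + norm (sq_iter X n - sq_iter X m)"
    using norm_triangle_ineq[of "sq_iter X (Suc n) - sq_iter X n" "sq_iter X n - sq_iter X m"] by simp
  then show ?case using norm_sq_iter_diff_le[OF assms(1), of n] step.IH by linarith
qed simp

definition sq_lim :: "('a::banach \<Rightarrow>\<^sub>L 'a) \<Rightarrow> ('a \<Rightarrow>\<^sub>L 'a)"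
  where "sq_lim X = lim (sq_iter X)"

lemma sq_iter_tendsto:
  assumes "norm X \<le> 1"
  shows "sq_iter X \<longlonglongrightarrow> sq_lim X"
proof -
  have "convergent sq_iter_real" using sq_iter_real_bounds(2) sq_iter_real_le_Suc
    by (intro Bseq_mono_convergent BseqI'[of _ 1] incseq_SucI[THEN incseqD])
      (auto simp del: sq_iter_real.simps simp: sq_iter_real_bounds(1) lift_Suc_mono_le)
  then have C: "Cauchy sq_iter_real" by (rule convergent_Cauchy)
  have "Cauchy (sq_iter X)"
  proof (rule CauchyI')
    fix e :: real assume "e > 0"
    then obtain M where M: "\<And>m n. m \<ge> M \<Longrightarrow> n \<ge> M \<Longrightarrow> norm (sq_iter_real m - sq_iter_real n) < e"
      using CauchyD[OF C] by blast
    have "norm (sq_iter X m - sq_iter X n) < e" if "m \<ge> M" "n > m" for m n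
      using norm_sq_iter_diff_le'[OF assms, of m n] M[of n m] that by (simp add: norm_minus_commute)
    then show "\<exists>M. \<forall>m\<ge>M. \<forall>n>m. dist (sq_iter X m) (sq_iter X n) < e"
      by (auto simp: dist_norm)
  qed
  then show ?thesis unfolding sq_lim_def by (simp add: Cauchy_convergent_iff convergent_LIMSEQ_iff)
qed

text \<open>The fixed point equation of the iteration, solved for the square; it says (I - Y)^2 = I
  - X for the limit Y.\<close>

lemma sq_lim_eq:
  assumes "norm X \<le> 1"
  shows "sq_lim X (sq_lim X x) = 2 *\<^sub>R sq_lim X x - X x"
proof -
  note l = sq_iter_tendsto[OF assms]
  have "(\<lambda>n. sq_iter X (Suc n) x) \<longlonglongrightarrow> (1 / 2) *\<^sub>R (X x + sq_lim X (sq_lim X x))"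
    unfolding sq_iter.simps blinfun.bilinear_simps blinfun_apply_blinfun_compose
    by (intro tendsto_intros l)
  moreover have "(\<lambda>n. sq_iter X (Suc n) x) \<longlonglongrightarrow> sq_lim X x"
    using tendsto_blinfun_apply[OF l] by (rule LIMSEQ_Suc)
  ultimately have "sq_lim X x = (1 / 2) *\<^sub>R (X x + sq_lim X (sq_lim X x))"
    using LIMSEQ_unique by blast
  then have "2 *\<^sub>R sq_lim X x = X x + sq_lim X (sq_lim X x)"
    by (metis (no_types) divide_self_if mult.commute scaleR_one scaleR_scaleR times_divide_eq_left
        zero_neq_numeral mult_1)
  then show ?thesis by simp
qed

lemma norm_sq_lim_le: "norm X \<le> 1 \<Longrightarrow> norm (sq_lim X) \<le> 1"
  by (rule LIMSEQ_le_const2[OF tendsto_norm[OF sq_iter_tendsto]])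
    (auto intro: order_trans[OF norm_sq_iter_le] sq_iter_real_bounds)

lemma sq_lim_bop:
  assumes U: "csub U" and "norm X \<le> 1" "X \<in> bop U U"
  shows "sq_lim X \<in> bop U U"
proof (rule bop_lim[OF U sq_iter_tendsto])
  show "sq_iter X n \<in> bop U U" for n
    by (induction n) (auto intro!: bop_0 bop_scaleR bop_add bop_compose assms)
qed (rule assms)

text \<open>\<open>S\<close> intertwines all iterates, which are polynomials in \<open>X\<close> and
  \<open>X'\<close>, and hence their limits. With \<open>X' = X\<close> this shows that whatever
  commutes with \<open>X\<close> commutes with the root, which gives its uniqueness; with
  \<open>S\<close> the contraction itself it relates the defect operators of a contraction and of
  its adjoint.\<close>

lemma sq_lim_intertwine:
  fixes S :: "'a::banach \<Rightarrow>\<^sub>L 'b::banach"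
  assumes "norm X \<le> 1" "norm X' \<le> 1" and S: "\<And>x. S (blinfun_apply X x) = blinfun_apply X' (S x)"
  shows "S (sq_lim X x) = sq_lim X' (S x)"
proof -
  have *: "S (sq_iter X n x) = sq_iter X' n (S x)" for n x
    by (induction n arbitrary: x) (simp_all add: blinfun.bilinear_simps S)
  have "(\<lambda>n. S (sq_iter X n x)) \<longlonglongrightarrow> S (sq_lim X x)"
    by (intro tendsto_intros sq_iter_tendsto assms)
  moreover have "(\<lambda>n. sq_iter X' n (S x)) \<longlonglongrightarrow> sq_lim X' (S x)"
    by (intro tendsto_intros sq_iter_tendsto assms)
  ultimately show ?thesis using LIMSEQ_unique by (simp add: *) blast
qed

lemma sq_lim_hermitian:
  fixes X :: "'a::complex_hilbert \<Rightarrow>\<^sub>L 'a"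
  assumes "norm X \<le> 1" and X: "\<And>x y. cinner (X x) y = cinner x (X y)"
  shows "cinner (sq_lim X x) y = cinner x (sq_lim X y)"
proof -
  have *: "cinner (sq_iter X n x) y = cinner x (sq_iter X n y)" for n x y
    by (induction n arbitrary: x y)
      (simp_all add: blinfun.bilinear_simps X cinner.add_left cinner.add_right cinner.scaleR_left
        cinner.scaleR_right)
  have "(\<lambda>n. cinner (sq_iter X n x) y) \<longlonglongrightarrow> cinner (sq_lim X x) y"
    "(\<lambda>n. cinner x (sq_iter X n y)) \<longlonglongrightarrow> cinner x (sq_lim X y)"
    by (intro cinner.tendsto tendsto_intros sq_iter_tendsto assms)+
  then show ?thesis using LIMSEQ_unique by (simp add: *) blast
qed

text \<open>A quadratic form that is real on a complex space is Hermitian: expand it at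
  \<open>x + y\<close> and at \<open>x + i y\<close>. Projections then remove the restriction to
  \<open>U\<close>.\<close>

lemma positive_hermitian:
  fixes D :: "'a::complex_hilbert \<Rightarrow>\<^sub>L 'a"
  assumes U: "csub U" and D: "D \<in> bop U U" and pos: "\<And>x. x \<in> U \<Longrightarrow> cinner (D x) x \<in> \<real>\<^sub>\<ge>\<^sub>0"
  shows "cinner (D x) y = cinner x (D y)"
proof -
  have im: "Im (cinner (D x) x) = 0" if "x \<in> U" for x
    using pos[OF that] by (simp add: complex_nonneg_Reals_iff)
  have h: "cinner (D x) y = cinner x (D y)" if x: "x \<in> U" and y: "y \<in> U" for x y
  proof -
    have "Im (cinner (D x) y + cinner (D y) x) = 0"
      using im[OF csub_add[OF U x y]] im[OF x] im[OF y]
      by (simp add: blinfun.add_right cinner.add_left cinner.add_right)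
    moreover have "Re (cinner (D x) y - cinner (D y) x) = 0"
      using im[OF csub_add[OF U x csub_scaleC[OF U y, of \<i>]]] im[OF x] im[OF y]
      by (simp add: blinfun.add_right cinner.add_left cinner.add_right bop_scaleC[OF D]
          cinner_scaleC_left cinner_scaleC_right)
    ultimately show ?thesis by (subst cinner_commute[of x]) (auto intro: complex_eqI)
  qed
  have "cinner (D x) y = cinner (D (proj U x)) (proj U y)"
    by (simp add: bop_proj[OF U D] cinner_proj_right[OF U] bop_range[OF D])
  also have "\<dots> = cinner (proj U x) (D (proj U y))" by (intro h proj_in U)
  also have "\<dots> = cinner x (D y)"
    by (simp add: bop_proj[OF U D] cinner_proj_left[OF U] bop_range[OF D])
  finally show ?thesis .
qed

lemma positive_kernel:
  fixes D :: "'a::complex_hilbert \<Rightarrow>\<^sub>L 'a"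
  assumes U: "csub U" and D: "D \<in> bop U U" and pos: "\<And>x. x \<in> U \<Longrightarrow> cinner (D x) x \<in> \<real>\<^sub>\<ge>\<^sub>0"
    and w: "w \<in> U" "cinner (D w) w = 0"
  shows "D w = 0"
proof -
  define a where "a = (norm (D w))\<^sup>2"
  define b where "b = Re (cinner (D (D w)) (D w))"
  \<comment> \<open>Moving from \<open>w\<close> in the direction - \<open>D w\<close> would make
    the form negative to first order in \<open>t\<close>. The step length a / (b + 1), instead of a
    / b, stays defined when \<open>b\<close> is 0.\<close>
  define t where "t = - a / (b + 1)"
  have "b \<ge> 0" using pos[OF bop_range[OF D]] by (simp add: b_def complex_nonneg_Reals_iff)
  have a: "cinner (D w) (D w) = complex_of_real a" "cinner (D (D w)) w = complex_of_real a"
    using positive_hermitian[OF U D pos, of "D w" w] by (auto simp: a_def cinner_self)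
  have "0 \<le> Re (cinner (D (w + t *\<^sub>R D w)) (w + t *\<^sub>R D w))"
    using pos[OF csub_add[OF U w(1) csub_scaleR[OF U bop_range[OF D]]]]
    by (simp add: complex_nonneg_Reals_iff)
  also have "\<dots> = 2 * t * a + t\<^sup>2 * b"
    by (simp add: blinfun.bilinear_simps cinner.add_left cinner.add_right cinner.scaleR_left
        cinner.scaleR_right a b_def w power2_eq_square algebra_simps)
  also have a_eq: "a = - (t * (b + 1))" using \<open>b \<ge> 0\<close> by (simp add: t_def)
  also have "2 * t * - (t * (b + 1)) + t\<^sup>2 * b = - (t\<^sup>2 * (b + 2))"
    by (simp add: algebra_simps power2_eq_square)
  finally have "t = 0" using \<open>b \<ge> 0\<close> by (simp add: mult_le_0_iff)
  then have "a = 0" by (simp add: a_eq)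
  then show ?thesis by (simp add: a_def)
qed

text \<open>With \<open>w = D x - E x\<close>, commutation gives (D + E) w = D^2 x - E^2 x = 0. Two
  nonnegative forms with sum 0 both vanish at \<open>w\<close>, so \<open>D w = E w = 0\<close>, and
  finally <w, w> = <x, D w - E w> = 0.\<close>

lemma positive_sqrt_unique:
  fixes D E :: "'a::complex_hilbert \<Rightarrow>\<^sub>L 'a"
  assumes U: "csub U" and D: "D \<in> bop U U" "E \<in> bop U U"
    and pos: "\<And>x. x \<in> U \<Longrightarrow> cinner (D x) x \<in> \<real>\<^sub>\<ge>\<^sub>0" "\<And>x. x \<in> U \<Longrightarrow> cinner (E x) x \<in> \<real>\<^sub>\<ge>\<^sub>0"
    and sq: "\<And>x. x \<in> U \<Longrightarrow> D (D x) = E (E x)" and comm: "\<And>x. D (E x) = E (D x)"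
  shows "D = E"
proof (rule bop_ext[OF U D, of U])
  fix x assume x: "x \<in> U"
  define w where "w = D x - E x"
  have w: "w \<in> U" by (auto simp: w_def intro: csub_diff U bop_range D)
  have nn: "Re (cinner (D w) w) \<ge> 0" "Re (cinner (E w) w) \<ge> 0"
    using pos w by (auto simp: complex_nonneg_Reals_iff)
  have "D w + E w = 0" by (simp add: w_def blinfun.diff_right sq[OF x] comm)
  then have "cinner (D w) w + cinner (E w) w = 0" by (simp add: cinner.add_left[symmetric])
  then have "Re (cinner (D w) w) + Re (cinner (E w) w) = 0"
    by (metis plus_complex.simps(1) zero_complex.simps(1))
  then have "Re (cinner (D w) w) = 0" "Re (cinner (E w) w) = 0" using nn by linarith+
  then have "cinner (D w) w = 0" "cinner (E w) w = 0"
    using pos w by (auto simp: complex_nonneg_Reals_iff complex_eq_iff)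
  then have "D w = 0" "E w = 0" using positive_kernel[OF U] D pos w by blast+
  have "cinner w w = cinner (D x) w - cinner (E x) w" by (subst (1) w_def) (rule cinner.diff_left)
  also have "\<dots> = cinner x (D w) - cinner x (E w)"
    by (simp add: positive_hermitian[OF U D(1) pos(1)] positive_hermitian[OF U D(2) pos(2)])
  also have "\<dots> = 0" by (simp add: \<open>D w = 0\<close> \<open>E w = 0\<close>)
  finally show "D x = E x" by (simp add: cinner_self_eq_zero w_def)
qed (rule closure_subset)

lemma closure_sequenceI:
  fixes S :: "'a::first_countable_topology set"
  shows "(\<And>n. a n \<in> S) \<Longrightarrow> a \<longlonglongrightarrow> x \<Longrightarrow> x \<in> closure S"
  by (auto simp: closure_sequential)

section \<open>Defect operators and defect spaces of a contraction and of its adjoint\<close>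

locale contraction =
  fixes U :: "'a::complex_hilbert set" and V :: "'b::complex_hilbert set" and G :: "'a \<Rightarrow>\<^sub>L 'b"
  assumes U: "csub U" and V: "csub V" and G: "G \<in> bop U V" and norm_G: "norm G \<le> 1"
begin

abbreviation Gs where "Gs \<equiv> adj G"
abbreviation D where "D \<equiv> defect_op U G"
abbreviation Ds where "Ds \<equiv> defect_op V Gs"
abbreviation DU where "DU \<equiv> defect_space U G"
abbreviation DV where "DV \<equiv> defect_space V Gs"

lemma norm_G_le: "norm (G x) \<le> norm x"
  using norm_blinfun[of G x] mult_right_mono[OF norm_G norm_ge_zero[of x]] by simp

lemma Gs: "Gs \<in> bop V U"
  using G U V by (rule adj_bop)

lemma Gs_Gs: "adj Gs = G"
  using G U V by (rule adj_adj)

lemma norm_Gs: "norm Gs \<le> 1"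
  using norm_adj_le[OF G] norm_G by linarith

lemma norm_GsG: "norm (Gs o\<^sub>L G) \<le> 1"
  using norm_blinfun_compose[of Gs G] mult_mono[OF norm_Gs norm_G] by simp

lemma GsG_bop: "Gs o\<^sub>L G \<in> bop U U"
  using Gs G by (rule bop_compose)

text \<open>The definite description in \<open>defect_op\<close> is resolved here. The operator I -
  Y with Y the limit of the iteration is a root, nonnegative because Y has norm at most 1. A
  competitor F satisfies X = I - F^2 on \<open>U\<close>, hence commutes with X and therefore with
  Y, so the two roots commute and must agree.\<close>

lemma defect_op_eq: "D = proj U - sq_lim (Gs o\<^sub>L G)"
  and defect_op_bop: "D \<in> bop U U"
  and defect_op_pos: "x \<in> U \<Longrightarrow> cinner (D x) x \<in> \<real>\<^sub>\<ge>\<^sub>0"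
  and defect_op_sq: "x \<in> U \<Longrightarrow> D (D x) = x - Gs (G x)"
proof -
  define X where "X = Gs o\<^sub>L G"
  define Y where "Y = sq_lim X"
  have nX: "norm X \<le> 1" and X: "X \<in> bop U U" by (auto simp: X_def norm_GsG GsG_bop)
  have Y: "Y \<in> bop U U" unfolding Y_def by (intro sq_lim_bop U nX X)
  have Xh: "cinner (X x) y = cinner x (X y)" for x y
    by (simp add: X_def adj[OF G, symmetric] adj'[OF G])
  have Yh: "cinner (Y x) y = cinner x (Y y)" for x y
    unfolding Y_def using nX Xh by (rule sq_lim_hermitian)
  define E where "E = proj U - Y"
  have E: "E \<in> bop U U" unfolding E_def by (intro bop_diff U proj_bop Y)
  have Ex: "E x = x - Y x" if "x \<in> U" for x
    using that by (simp add: E_def blinfun.diff_left proj_id U)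
  have pos: "cinner (E x) x \<in> \<real>\<^sub>\<ge>\<^sub>0" if x: "x \<in> U" for x
  proof -
    have "Im (cinner (Y x) x) = 0" using Yh[of x x] cinner_commute[of "Y x" x]
      by (metis Reals_cnj_iff complex_is_Real_iff)
    moreover have "Re (cinner (Y x) x) \<le> (norm x)\<^sup>2"
    proof -
      have "Re (cinner (Y x) x) \<le> norm (Y x) * norm x"
        using complex_Re_le_cmod cmod_cinner_le order_trans by blast
      also have "\<dots> \<le> (1 * norm x) * norm x" unfolding Y_def
        by (intro mult_right_mono order_trans[OF norm_blinfun] norm_sq_lim_le nX) auto
      finally show ?thesis by (simp add: power2_eq_square)
    qed
    ultimately show ?thesis
      by (simp add: Ex[OF x] cinner.diff_left cinner_self complex_nonneg_Reals_iff)
  qed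
  have sq: "E (E x) = x - Gs (G x)" if x: "x \<in> U" for x
  proof -
    have "Y (Y x) = 2 *\<^sub>R Y x - Gs (G x)"
      using sq_lim_eq[OF nX, of x, folded Y_def] by (simp add: X_def)
    then show ?thesis by (simp add: Ex csub_diff U bop_range[OF Y] x blinfun.diff_right scaleR_2)
  qed
  have D: "D = E" unfolding defect_op_def
  proof (rule the_equality)
    fix F assume *: "F \<in> bop U U \<and> (\<forall>x\<in>U. cinner (F x) x \<in> \<real>\<^sub>\<ge>\<^sub>0) \<and> (\<forall>x\<in>U. F (F x) = x - Gs (G x))"
    then have F: "F \<in> bop U U" by blast
    have FX: "F (X x) = X (F x)" for x
    proof -
      have "F (X x) = F (X (proj U x))" by (simp add: bop_proj[OF U X])
      also have "X (proj U x) = proj U x - F (F (proj U x))"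
        using * proj_in[OF U, of x] by (simp add: X_def)
      also have "F (proj U x - F (F (proj U x))) = F x - F (F (F x))"
        by (simp add: blinfun.diff_right bop_proj[OF U F])
      also have "\<dots> = X (F x)" using * bop_range[OF F, of x] by (simp add: X_def)
      finally show ?thesis .
    qed
    have "F (Y x) = Y (F x)" for x unfolding Y_def by (rule sq_lim_intertwine[OF nX nX FX])
    then have "F (E x) = E (F x)" for x
      by (simp add: E_def blinfun.diff_left blinfun.diff_right bop_proj[OF U F] proj_id[OF U bop_range[OF F]])
    then show "F = E" using * pos sq by (intro positive_sqrt_unique[OF U F E]) auto
  qed (use E pos sq in blast)
  show "D = proj U - sq_lim (Gs o\<^sub>L G)" by (simp add: D E_def Y_def X_def)
  show "D \<in> bop U U" by (simp add: D E)
  show "cinner (D x) x \<in> \<real>\<^sub>\<ge>\<^sub>0" if "x \<in> U" by (simp add: D pos that)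
  show "D (D x) = x - Gs (G x)" if "x \<in> U" by (simp add: D sq that)
qed

text \<open>Every fact of this locale has a twin with \<Gamma> and its adjoint exchanged;
  \<open>Gs_Gs\<close> restores \<Gamma> where the twin mentions the double adjoint.\<close>

lemma dual: "contraction V U Gs"
  by unfold_locales (use U V Gs norm_Gs in auto)

lemmas defect_op_adj_bop = contraction.defect_op_bop[OF dual]
  and defect_op_adj_sq = contraction.defect_op_sq[OF dual, unfolded Gs_Gs]

lemma defect_op_hermitian: "cinner (D x) y = cinner x (D y)"
  using U defect_op_bop defect_op_pos by (rule positive_hermitian)

lemma norm_defect_op_sq: "x \<in> U \<Longrightarrow> (norm (D x))\<^sup>2 = (norm x)\<^sup>2 - (norm (G x))\<^sup>2"
proof -
  assume x: "x \<in> U"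
  have "complex_of_real ((norm (D x))\<^sup>2) = cinner x (D (D x))"
    by (simp only: cinner_self[symmetric] defect_op_hermitian)
  also have "\<dots> = complex_of_real ((norm x)\<^sup>2 - (norm (G x))\<^sup>2)"
    by (simp add: defect_op_sq[OF x] cinner.diff_right adj[OF G, symmetric] cinner_self)
  finally show ?thesis using of_real_eq_iff by blast
qed

lemma G_defect_op: "G (D x) = Ds (G x)"
proof -
  have "G (sq_lim (Gs o\<^sub>L G) x) = sq_lim (G o\<^sub>L Gs) (G x)"
    using contraction.norm_GsG[OF dual] by (intro sq_lim_intertwine norm_GsG) (simp_all add: Gs_Gs)
  then show ?thesis
    by (simp add: defect_op_eq contraction.defect_op_eq[OF dual] Gs_Gs blinfun.diff_left
        blinfun.diff_right bop_proj[OF U G] proj_id[OF V bop_range[OF G]])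
qed

lemma csub_DU: "csub DU"
  unfolding csub_def
proof (intro conjI ballI allI)
  let ?R = "range (blinfun_apply D)"
  have R: "u \<in> DU" if "u \<in> ?R" for u
    using that unfolding defect_space_def by (rule subsetD[OF closure_subset])
  \<comment> \<open>A continuous map that sends the range of \<open>D\<close> into \<open>DU\<close>
    sends its closure there as well. Addition is treated one summand at a time.\<close>
  have map: "f x \<in> DU" if "continuous_on DU f" "\<And>u. u \<in> ?R \<Longrightarrow> f u \<in> DU" "x \<in> DU" for f x
    using subsetD[OF image_closure_subset[of ?R f DU] imageI[of x]] that
    by (simp add: defect_space_def image_subset_iff)
  show "0 \<in> DU" by (rule R) (metis blinfun.zero_right rangeI)
  show "closed DU" by (simp add: defect_space_def)
  show "c *\<^sub>C x \<in> DU" if "x \<in> DU" for c x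
  proof (rule map[OF linear_continuous_on[OF scaleC.bounded_linear_right] _ that])
    show "c *\<^sub>C u \<in> DU" if "u \<in> ?R" for u
      using that by (intro R) (auto simp: bop_scaleC[OF defect_op_bop, symmetric])
  qed
  have add: "D v + y \<in> DU" if "y \<in> DU" for v y
    by (rule map[OF _ _ that]) (auto intro!: R continuous_intros simp: blinfun.add_right[symmetric])
  show "x + y \<in> DU" if "x \<in> DU" "y \<in> DU" for x y
    by (rule map[OF _ _ that(1)]) (auto intro!: continuous_intros add that(2))
qed

lemma defect_op_in: "D x \<in> DU"
  unfolding defect_space_def by (rule subsetD[OF closure_subset]) simp

lemma DU_subset: "DU \<subseteq> U"
  unfolding defect_space_def using bop_range[OF defect_op_bop] csub_closed[OF U]
  by (intro closure_minimal) auto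

lemma defect_op_bop_DU: "D \<in> bop U DU"
  using defect_op_bop defect_op_in by (auto simp: bop_def)

lemma DU_dense_image: "DU \<subseteq> closure (blinfun_apply D ` U)"
proof -
  have "range (blinfun_apply D) \<subseteq> blinfun_apply D ` U"
    using bop_proj[OF U defect_op_bop] proj_in[OF U] by (metis image_subsetI imageI)
  then show ?thesis unfolding defect_space_def by (rule closure_mono)
qed

text \<open>\<open>D\<close> is Hermitian, so its kernel is orthogonal to its range and to the
  closure of the range. This injectivity is the only means of cancelling a defect operator on the
  left.\<close>

lemma defect_op_inj:
  assumes "u \<in> DU" "D u = 0"
  shows "u = 0"
proof -
  obtain a where a: "\<And>n. a n \<in> range (blinfun_apply D)" "a \<longlonglongrightarrow> u"
    using assms(1) unfolding defect_space_def by (rule closure_sequenceE) blast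
  have "(\<lambda>n. cinner (a n) u) \<longlonglongrightarrow> cinner u u"
    by (intro cinner.tendsto a tendsto_const)
  moreover have "cinner (a n) u = 0" for n
    using a(1)[of n] by (auto simp: defect_op_hermitian assms(2))
  ultimately have "cinner u u = 0" using LIMSEQ_unique[OF _ tendsto_const] by simp
  then show ?thesis by (simp add: cinner_self_eq_zero)
qed

text \<open>The intertwining relation moves the range of \<open>D\<close> into that of
  \<open>Ds\<close>, and the closure follows. The dual version makes \<Gamma>* E(z) an operator on
  \<open>DU\<close>.\<close>

lemma G_DU: "u \<in> DU \<Longrightarrow> G u \<in> DV"
proof -
  assume "u \<in> DU"
  then obtain a where a: "\<And>n. a n \<in> range (blinfun_apply D)" "a \<longlonglongrightarrow> u"
    unfolding defect_space_def by (rule closure_sequenceE) blast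
  have lim: "(\<lambda>n. G (a n)) \<longlonglongrightarrow> G u" by (intro tendsto_intros a)
  have mem: "G (a n) \<in> DV" for n
    using a(1)[of n] contraction.defect_op_in[OF dual] by (auto simp: G_defect_op)
  show ?thesis
    by (rule closed_sequentially[OF csub_closed[OF contraction.csub_DU[OF dual]] mem lim])
qed

lemmas csub_DV = contraction.csub_DU[OF dual]
  and DV_subset = contraction.DU_subset[OF dual]
  and defect_op_adj_bop_DV = contraction.defect_op_bop_DU[OF dual]
  and defect_op_adj_inj = contraction.defect_op_inj[OF dual]
  and defect_op_adj_hermitian = contraction.defect_op_hermitian[OF dual]
  and Gs_DV = contraction.G_DU[OF dual, unfolded Gs_Gs]
  and Gs_defect_op = contraction.G_defect_op[OF dual, unfolded Gs_Gs]
  and norm_defect_op_adj_sq = contraction.norm_defect_op_sq[OF dual]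
  and DV_dense_image = contraction.DU_dense_image[OF dual]

text \<open>The cross terms of the two components agree by the intertwining relation and cancel; the
  remaining squares match by the definition of the defect operators.\<close>

lemma rotation_isometry:
  assumes "x \<in> U" "y \<in> V"
  shows "(norm (G x + Ds y))\<^sup>2 + (norm (D x - Gs y))\<^sup>2 = (norm x)\<^sup>2 + (norm y)\<^sup>2"
proof -
  have "cinner (G x) (Ds y) = cinner (D x) (Gs y)"
    by (simp add: defect_op_adj_hermitian[symmetric] G_defect_op[symmetric] adj[OF G])
  then show ?thesis
    unfolding norm_add_sq norm_diff_sq norm_defect_op_sq[OF assms(1)] norm_defect_op_adj_sq[OF assms(2)]
    by simp
qed

end

section \<open>Operator-valued holomorphic functions\<close>

text \<open>The holomorphy clause of \<open>schur_class\<close>, separated because the auxiliary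
  factors and inverses are not contractive.\<close>

definition cholo :: "(complex \<Rightarrow> 'a::complex_inner \<Rightarrow>\<^sub>L 'b::complex_inner) \<Rightarrow> bool"
  where "cholo F \<longleftrightarrow> (\<forall>z\<in>ball 0 1. \<exists>F'. (F has_derivative F') (at z) \<and>
    (\<forall>h x. blinfun_apply (F' h) x = h *\<^sub>C blinfun_apply (F' 1) x))"

lemma schur_class_iff:
  "\<Theta> \<in> schur_class U V \<longleftrightarrow> \<Theta> \<in> extensional (ball 0 1) \<and>
    (\<forall>z\<in>ball 0 1. \<Theta> z \<in> bop U V \<and> norm (\<Theta> z) \<le> 1) \<and> cholo \<Theta>"
  unfolding schur_class_def cholo_def by blast

lemma choloE:
  assumes "cholo F" "z \<in> ball 0 1"
  obtains F' where "(F has_derivative F') (at z)" "\<And>h x. F' h x = h *\<^sub>C F' 1 x"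
  using assms unfolding cholo_def by blast

lemma cholo_tendsto: "cholo F \<Longrightarrow> (F \<longlongrightarrow> F 0) (at 0)"
  using has_derivative_continuous[of F _ 0 UNIV] by (auto elim!: choloE[of F 0] simp: continuous_at)

lemma cholo_cong:
  assumes F: "cholo F" and eq: "\<And>z. z \<in> ball 0 1 \<Longrightarrow> F z = G z"
  shows "cholo G"
  unfolding cholo_def
proof
  fix z :: complex assume z: "z \<in> ball 0 1"
  obtain F' where F': "(F has_derivative F') (at z)" "\<And>h x. F' h x = h *\<^sub>C F' 1 x"
    using F z by (rule choloE) blast
  have "(G has_derivative F') (at z)"
    using F'(1) open_ball z eq by (rule has_derivative_transform_within_open)
  then show "\<exists>F'. (G has_derivative F') (at z) \<and> (\<forall>h x. blinfun_apply (F' h) x = h *\<^sub>C blinfun_apply (F' 1) x)"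
    using F'(2) by blast
qed

lemma cholo_const: "cholo (\<lambda>_. T)"
  unfolding cholo_def by (intro ballI exI[of _ "\<lambda>_. 0"]) (simp add: scaleC_zero_right)

lemma cholo_add:
  assumes "cholo F" "cholo G"
  shows "cholo (\<lambda>z. F z + G z)"
  unfolding cholo_def
proof
  fix z :: complex assume z: "z \<in> ball 0 1"
  obtain F' where F': "(F has_derivative F') (at z)" "\<And>h x. F' h x = h *\<^sub>C F' 1 x"
    using assms(1) z by (rule choloE) blast
  obtain G' where G': "(G has_derivative G') (at z)" "\<And>h x. G' h x = h *\<^sub>C G' 1 x"
    using assms(2) z by (rule choloE) blast
  show "\<exists>H. ((\<lambda>z. F z + G z) has_derivative H) (at z) \<and>
      (\<forall>h x. blinfun_apply (H h) x = h *\<^sub>C blinfun_apply (H 1) x)" using F'(2) G'(2)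
    by (intro exI[of _ "\<lambda>h. F' h + G' h"] conjI has_derivative_add F'(1) G'(1))
      (metis blinfun.add_left scaleC_add_right)
qed

text \<open>The operators of this type are only real linear. Complex homogeneity of
  \<open>F z\<close> is what lets the factor \<open>h\<close> of \<open>G' h\<close> pass through
  \<open>F z\<close>.\<close>

lemma cholo_compose:
  assumes "cholo F" "cholo G" and lin: "\<And>z c x. z \<in> ball 0 1 \<Longrightarrow> F z (c *\<^sub>C x) = c *\<^sub>C F z x"
  shows "cholo (\<lambda>z. F z o\<^sub>L G z)"
  unfolding cholo_def
proof
  fix z :: complex assume z: "z \<in> ball 0 1"
  obtain F' where F': "(F has_derivative F') (at z)" "\<And>h x. F' h x = h *\<^sub>C F' 1 x"
    using assms(1) z by (rule choloE) blast
  obtain G' where G': "(G has_derivative G') (at z)" "\<And>h x. G' h x = h *\<^sub>C G' 1 x"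
    using assms(2) z by (rule choloE) blast
  show "\<exists>H. ((\<lambda>z. F z o\<^sub>L G z) has_derivative H) (at z) \<and>
      (\<forall>h x. blinfun_apply (H h) x = h *\<^sub>C blinfun_apply (H 1) x)"
  proof (intro exI[of _ "\<lambda>h. (F z o\<^sub>L G' h) + (F' h o\<^sub>L G z)"] conjI allI)
    show "((\<lambda>z. F z o\<^sub>L G z) has_derivative (\<lambda>h. (F z o\<^sub>L G' h) + (F' h o\<^sub>L G z))) (at z)"
      by (rule bounded_bilinear.FDERIV[OF bounded_bilinear_blinfun_compose F'(1) G'(1)])
    fix h x
    show "((F z o\<^sub>L G' h) + (F' h o\<^sub>L G z)) x = h *\<^sub>C ((F z o\<^sub>L G' 1) + (F' 1 o\<^sub>L G z)) x"
      by (simp add: blinfun.add_left G'(2)[of h] F'(2)[of h] lin[OF z] scaleC_add_right)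
  qed
qed

text \<open>Multiplication by a complex scalar has to be a composition, since the operator type
  carries real scalars only.\<close>

definition cmul :: "complex \<Rightarrow> 'a::complex_inner \<Rightarrow>\<^sub>L 'a"
  where "cmul c = Blinfun (scaleC c)"

lemma cmul_apply: "cmul c x = c *\<^sub>C x"
  by (simp add: cmul_def bounded_linear_Blinfun_apply scaleC.bounded_linear_right)

lemma norm_cmul_le: "norm (cmul c :: 'a::complex_inner \<Rightarrow>\<^sub>L 'a) \<le> cmod c"
  by (rule norm_blinfun_bound) (simp_all add: cmul_apply norm_scaleC)

lemma cmul_bop:
  assumes "csub V" "T \<in> bop U V"
  shows "cmul c o\<^sub>L T \<in> bop U V"
  by (rule bopI)
    (auto simp: cmul_apply bop_scaleC[OF assms(2)] scaleC_scaleC mult.commute bop_zero[OF assms(2)]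
      intro!: csub_scaleC assms(1) bop_range[OF assms(2)])

lemma bounded_linear_cmul: "bounded_linear (cmul :: complex \<Rightarrow> 'a::complex_inner \<Rightarrow>\<^sub>L 'a)"
  by (rule bounded_linear_intro[of _ 1])
    (auto intro!: blinfun_eqI simp: cmul_apply blinfun.add_left blinfun.scaleR_left scaleC_add_left
      scaleR_scaleC scaleC_scaleC scaleC_complex_def norm_cmul_le)

lemma cholo_cmul: "cholo cmul"
  unfolding cholo_def
  by (intro ballI exI[of _ cmul] conjI allI bounded_linear.has_derivative[OF bounded_linear_cmul]
      has_derivative_ident)
    (simp add: cmul_apply scaleC_one)

lemma cholo_cmul_compose: "cholo F \<Longrightarrow> cholo (\<lambda>z. cmul z o\<^sub>L F z)"
  by (rule cholo_compose[OF cholo_cmul]) (auto simp: cmul_apply scaleC_scaleC mult.commute)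

lemma cholo_compose_left:
  assumes "cholo F" "T \<in> bop U V"
  shows "cholo (\<lambda>z. T o\<^sub>L F z)"
  by (rule cholo_compose[OF cholo_const assms(1)]) (rule bop_scaleC[OF assms(2)])

lemma cholo_diff:
  assumes "cholo F" "cholo G"
  shows "cholo (\<lambda>z. F z - G z)"
proof -
  have "cholo (\<lambda>z. cmul (- 1) o\<^sub>L G z)"
    by (rule cholo_compose[OF cholo_const assms(2)]) (simp add: cmul_apply scaleC_scaleC)
  then have "cholo (\<lambda>z. F z + (cmul (- 1) o\<^sub>L G z))" by (rule cholo_add[OF assms(1)])
  moreover have "F z + (cmul (- 1) o\<^sub>L G z) = F z - G z" for z by (rule blinfun_eqI)
      (simp add: blinfun.add_left blinfun.diff_left cmul_apply scaleC_minus_left scaleC_one)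
  ultimately show ?thesis by simp
qed

section \<open>Norm holomorphy from weak holomorphy\<close>

lemma weak_derivative:
  assumes F': "(F has_derivative F') (at z)" "\<And>h x. blinfun_apply (F' h) x = h *\<^sub>C blinfun_apply (F' 1) x"
  shows "((\<lambda>z. cinner (F z x) y) has_field_derivative cinner (F' 1 x) y) (at z)"
proof -
  have "bounded_linear (\<lambda>T. cinner (blinfun_apply T x) y)"
    by (intro bounded_linear_compose[OF cinner.bounded_linear_left] blinfun.bounded_linear_left)
  then have "((\<lambda>z. cinner (F z x) y) has_derivative (\<lambda>h. cinner (F' h x) y)) (at z)"
    using F'(1) by (rule bounded_linear.has_derivative)
  moreover have "(\<lambda>h. cinner (F' h x) y) = (*) (cinner (F' 1 x) y)"
    by (rule ext, subst F'(2)) (simp add: cinner_scaleC_left mult.commute)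
  ultimately show ?thesis by (simp add: has_field_derivative_def)
qed

lemma cholo_weak:
  assumes "cholo F"
  shows "(\<lambda>z. cinner (F z x) y) holomorphic_on ball 0 1"
proof (rule holomorphic_onI)
  fix z :: complex assume "z \<in> ball 0 1"
  with assms obtain F' where F': "(F has_derivative F') (at z)" "\<And>h x. F' h x = h *\<^sub>C F' 1 x"
    by (rule choloE) blast
  from weak_derivative[OF this] show "(\<lambda>z. cinner (F z x) y) field_differentiable at z within ball 0 1"
    using field_differentiable_at_within field_differentiable_def by blast
qed

lemma norm_le_of_dense_forms:
  fixes T :: "'a::complex_hilbert \<Rightarrow>\<^sub>L 'b::complex_hilbert"
  assumes U: "csub U" and T: "T \<in> bop U V" and A: "U \<subseteq> closure A" and B: "V \<subseteq> closure B" and "K \<ge> 0"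
    and le: "\<And>x y. x \<in> A \<Longrightarrow> y \<in> B \<Longrightarrow> cmod (cinner (T x) y) \<le> K * norm x * norm y"
  shows "norm T \<le> K"
proof (rule bop_norm_le[OF U T A \<open>K \<ge> 0\<close>])
  fix x assume x: "x \<in> A"
  obtain b where b: "\<And>n. b n \<in> B" "b \<longlonglongrightarrow> T x"
    using subsetD[OF B bop_range[OF T]] by (rule closure_sequenceE) blast
  have l: "(\<lambda>n. cmod (cinner (T x) (b n))) \<longlonglongrightarrow> cmod (cinner (T x) (T x))"
    by (intro tendsto_norm cinner.tendsto tendsto_const b)
  have r: "(\<lambda>n. K * norm x * norm (b n)) \<longlonglongrightarrow> K * norm x * norm (T x)"
    by (intro tendsto_intros b)
  have "cmod (cinner (T x) (T x)) \<le> K * norm x * norm (T x)"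
    by (rule LIMSEQ_le[OF l r]) (auto intro!: le x b)
  then have "norm (T x) * norm (T x) \<le> K * norm x * norm (T x)" by (simp add: cmod_cinner_self)
  then show "norm (T x) \<le> K * norm x" using \<open>K \<ge> 0\<close> by (cases "T x = 0") auto
qed

text \<open>Cauchy's inequality on circles of radius s/3 bounds the second derivative by 2! M /
  (s/3)^2 = 18 M / s^2. The centres stay within s/2 of \<open>z\<close>, and s/2 + s/3 < s keeps the
  circles inside the disc.\<close>

lemma second_order_remainder:
  assumes hol: "g holomorphic_on ball z s" and bd: "\<And>w. w \<in> ball z s \<Longrightarrow> cmod (g w) \<le> M"
    and h: "cmod h < s / 2"
  shows "cmod (g (z + h) - g z - deriv g z * h) \<le> 18 * M / s\<^sup>2 * (cmod h)\<^sup>2"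
proof -
  have "s > 0" using h norm_ge_zero[of h] by linarith
  define S where "S = ball z (s / 2)"
  have S: "S \<subseteq> ball z s" using \<open>s > 0\<close> by (auto simp: S_def)
  have "cmod ((deriv ^^ 0) g (z + h) - (\<Sum>i\<le>1. (deriv ^^ i) g z * ((z + h) - z) ^ i / fact i))
      \<le> (18 * M / s\<^sup>2) * cmod ((z + h) - z) ^ Suc 1 / fact 1"
  proof (rule complex_Taylor[where S = S])
    show "convex S" by (simp add: S_def)
    show "((deriv ^^ i) g has_field_derivative (deriv ^^ Suc i) g x) (at x within S)" if "x \<in> S" for i x
      using has_field_derivative_higher_deriv[OF hol open_ball subsetD[OF S that], of i]
      by (simp add: has_field_derivative_at_within)
    show "cmod ((deriv ^^ Suc 1) g x) \<le> 18 * M / s\<^sup>2" if "x \<in> S" for x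
    proof -
      have sub: "cball x (s / 3) \<subseteq> ball z s"
      proof
        fix w assume "w \<in> cball x (s / 3)"
        then have "dist z w < s"
          using that \<open>s > 0\<close> dist_triangle[of z w x] by (simp add: S_def)
        then show "w \<in> ball z s" by simp
      qed
      have "cmod ((deriv ^^ 2) g x) \<le> fact 2 * M / (s / 3) ^ 2"
      proof (rule Cauchy_inequality)
        show "g holomorphic_on ball x (s / 3)"
          using hol sub ball_subset_cball by (meson holomorphic_on_subset order_trans)
        show "continuous_on (cball x (s / 3)) g"
          using hol sub by (meson holomorphic_on_imp_continuous_on holomorphic_on_subset)
        show "0 < s / 3" using \<open>s > 0\<close> by simp
        show "cmod (g w) \<le> M" if "cmod (x - w) = s / 3" for w
          by (rule bd) (rule subsetD[OF sub], simp add: dist_norm that)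
      qed
      then show ?thesis
        by (simp add: numeral_2_eq_2[symmetric] power_divide field_simps del: funpow.simps)
    qed
    show "z \<in> S" "z + h \<in> S" using \<open>s > 0\<close> h by (auto simp: S_def dist_norm)
  qed
  then show ?thesis by (simp add: diff_diff_eq power2_eq_square)
qed

text \<open>The second order remainder of a matrix element is bounded by a constant times |x| |y|,
  uniformly over the dense sets. Hence the difference quotients are Cauchy in operator norm, and
  their limit is the derivative.\<close>

lemma cholo_of_weak:
  fixes F :: "complex \<Rightarrow> 'a::complex_hilbert \<Rightarrow>\<^sub>L 'b::complex_hilbert"
  assumes U: "csub U" and V: "csub V" and F: "\<And>z. z \<in> ball 0 1 \<Longrightarrow> F z \<in> bop U V"
    and bd: "\<And>r. r < 1 \<Longrightarrow> \<exists>M. \<forall>z\<in>ball 0 r. norm (F z) \<le> M"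
    and A: "U \<subseteq> closure A" and B: "V \<subseteq> closure B"
    and hol: "\<And>x y. x \<in> A \<Longrightarrow> y \<in> B \<Longrightarrow> (\<lambda>z. cinner (F z x) y) holomorphic_on ball 0 1"
  shows "cholo F"
  unfolding cholo_def
proof
  fix z :: complex assume z: "z \<in> ball 0 1"
  \<comment> \<open>Half the distance to the circle: the disc of radius \<open>s\<close> about
    \<open>z\<close> then lies in a smaller centred disc, on which \<open>F\<close> is
    bounded.\<close>
  define s where "s = (1 - cmod z) / 2"
  have "s > 0" using z by (simp add: s_def)
  have "cmod z + s < 1" using z by (simp add: s_def field_simps)
  then obtain M where "\<forall>w\<in>ball 0 (cmod z + s). norm (F w) \<le> M" using bd by blast
  moreover have sub: "ball z s \<subseteq> ball 0 (cmod z + s)"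
  proof
    fix w assume "w \<in> ball z s"
    then show "w \<in> ball 0 (cmod z + s)"
      using norm_triangle_ineq[of z "w - z"] by (simp add: dist_norm norm_minus_commute)
  qed
  ultimately have M: "\<And>w. w \<in> ball z s \<Longrightarrow> norm (F w) \<le> M" by blast
  have sub1: "ball z s \<subseteq> ball 0 1"
    using sub \<open>cmod z + s < 1\<close> by (meson order_trans less_imp_le subset_ball)
  have "M \<ge> 0" using order_trans[OF norm_ge_zero M[of z]] \<open>s > 0\<close> by simp
  define C where "C = 18 * M / s\<^sup>2"
  have "C \<ge> 0" using \<open>M \<ge> 0\<close> by (simp add: C_def)
  define Q where "Q h = cmul (1 / h) o\<^sub>L (F (z + h) - F z)" for h
  have inb: "z + h \<in> ball z s" if "cmod h < s / 2" for h
    using that \<open>s > 0\<close> by (simp add: dist_norm)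
  have Qb: "Q h \<in> bop U V" if "cmod h < s / 2" for h
    unfolding Q_def by (intro cmul_bop V bop_diff F z subsetD[OF sub1 inb] that)
  have QQ: "norm (Q h - Q k) \<le> C * (cmod h + cmod k)"
    if h: "cmod h < s / 2" "h \<noteq> 0" and k: "cmod k < s / 2" "k \<noteq> 0" for h k
  proof (rule norm_le_of_dense_forms[OF U bop_diff[OF V Qb[OF h(1)] Qb[OF k(1)]] A B])
    show "0 \<le> C * (cmod h + cmod k)" using \<open>C \<ge> 0\<close> by simp
    fix x y assume xy: "x \<in> A" "y \<in> B"
    define g where "g w = cinner (F w x) y" for w
    have g: "g holomorphic_on ball z s"
      unfolding g_def using hol[OF xy] sub1 by (rule holomorphic_on_subset)
    have gb: "cmod (g w) \<le> M * norm x * norm y" if "w \<in> ball z s" for w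
    proof -
      have "cmod (g w) \<le> norm (F w x) * norm y" unfolding g_def by (rule cmod_cinner_le)
      also have "\<dots> \<le> (M * norm x) * norm y"
        by (intro mult_right_mono order_trans[OF norm_blinfun] M that) auto
      finally show ?thesis .
    qed
    have q: "cmod (cinner (Q h x) y - deriv g z) \<le> C * norm x * norm y * cmod h"
      if h: "cmod h < s / 2" "h \<noteq> 0" for h
    proof -
      have "cinner (Q h x) y = (g (z + h) - g z) / h"
        by (simp add: Q_def cmul_apply blinfun.diff_left cinner_scaleC_left cinner.diff_left g_def)
      then have "cinner (Q h x) y - deriv g z = (g (z + h) - g z - deriv g z * h) / h"
        using h(2) by (simp add: field_simps)
      then have "cmod (cinner (Q h x) y - deriv g z) = cmod (g (z + h) - g z - deriv g z * h) / cmod h"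
        by (simp add: norm_divide)
      also have "\<dots> \<le> (18 * (M * norm x * norm y) / s\<^sup>2 * (cmod h)\<^sup>2) / cmod h"
        by (intro divide_right_mono second_order_remainder g gb h(1)) auto
      also have "\<dots> = C * norm x * norm y * cmod h"
        using h(2) by (simp add: C_def power2_eq_square)
      finally show ?thesis .
    qed
    have "cmod (cinner ((Q h - Q k) x) y)
        = cmod ((cinner (Q h x) y - deriv g z) - (cinner (Q k x) y - deriv g z))"
      by (simp add: blinfun.diff_left cinner.diff_left)
    also have "\<dots> \<le> C * norm x * norm y * cmod h + C * norm x * norm y * cmod k"
      by (intro order_trans[OF norm_triangle_ineq4] add_mono q h k)
    finally show "cmod (cinner ((Q h - Q k) x) y) \<le> C * (cmod h + cmod k) * norm x * norm y"
      by (simp add: algebra_simps)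
  qed
  \<comment> \<open>Any null sequence of increments would do; the shift by 2 keeps the terms
    strictly below s/2. The limit found along it is extended to all increments by
    \<open>QL\<close>.\<close>
  define a where "a = (\<lambda>n. complex_of_real (s / (2 * real (n + 2))))"
  have a: "cmod (a n) < s / 2" "a n \<noteq> 0" for n
  proof -
    have "cmod (a n) = s / (2 * real (n + 2))"
      unfolding a_def norm_of_real using \<open>s > 0\<close> by simp
    also have "\<dots> < s / 2" using \<open>s > 0\<close> by (intro divide_strict_left_mono) auto
    finally show "cmod (a n) < s / 2" .
    show "a n \<noteq> 0" unfolding a_def of_real_eq_0_iff using \<open>s > 0\<close> by simp
  qed
  have "(\<lambda>n. s / (2 * real (n + 2))) \<longlonglongrightarrow> 0" by real_asymp
  then have "(\<lambda>n. complex_of_real (s / (2 * real (n + 2)))) \<longlonglongrightarrow> complex_of_real 0"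
    by (rule tendsto_of_real)
  then have a0: "(\<lambda>n. cmod (a n)) \<longlonglongrightarrow> 0"
    unfolding a_def of_real_0 by (rule tendsto_norm_zero)
  have "Cauchy (\<lambda>n. Q (a n))"
  proof (rule metric_CauchyI)
    fix e :: real assume "e > 0"
    have "(\<lambda>n. C * cmod (a n)) \<longlonglongrightarrow> 0"
      using tendsto_mult_right_zero[OF a0] by simp
    then obtain N where N: "\<And>n. n \<ge> N \<Longrightarrow> C * cmod (a n) < e / 2"
      using order_tendstoD(2)[of _ 0 sequentially "e / 2"] \<open>e > 0\<close>
      by (auto simp: eventually_sequentially)
    have "dist (Q (a m)) (Q (a n)) < e" if "m \<ge> N" "n \<ge> N" for m n
      using QQ[OF a a, of m n] N[OF that(1)] N[OF that(2)] by (simp add: dist_norm algebra_simps)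
    then show "\<exists>M. \<forall>m\<ge>M. \<forall>n\<ge>M. dist (Q (a m)) (Q (a n)) < e" by blast
  qed
  then obtain L where L: "(\<lambda>n. Q (a n)) \<longlonglongrightarrow> L"
    by (auto simp: Cauchy_convergent_iff convergent_def)
  have Lb: "L \<in> bop U V" using V L Qb[OF a(1)] by (rule bop_lim)
  have QL: "norm (Q h - L) \<le> C * cmod h" if h: "cmod h < s / 2" "h \<noteq> 0" for h
  proof -
    have l: "(\<lambda>n. norm (Q h - Q (a n))) \<longlonglongrightarrow> norm (Q h - L)"
      by (intro tendsto_intros L)
    have r: "(\<lambda>n. C * (cmod h + cmod (a n))) \<longlonglongrightarrow> C * (cmod h + 0)"
      by (intro tendsto_intros a0)
    show ?thesis using LIMSEQ_le[OF l r] QQ[OF h a] by simp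
  qed
  have "(F has_derivative (\<lambda>h. cmul h o\<^sub>L L)) (at z)" unfolding has_derivative_at
  proof
    show "bounded_linear (\<lambda>h. cmul h o\<^sub>L L)"
      by (intro bounded_linear_compose[OF bounded_bilinear.bounded_linear_left[OF bounded_bilinear_blinfun_compose]] bounded_linear_cmul)
    show "(\<lambda>h. norm (F (z + h) - F z - (cmul h o\<^sub>L L)) / norm h) \<midarrow>0\<rightarrow> 0"
    proof (rule tendsto_sandwich[of "\<lambda>_. 0" _ _ "\<lambda>h. C * cmod h"])
      show "\<forall>\<^sub>F h in at 0. norm (F (z + h) - F z - (cmul h o\<^sub>L L)) / norm h \<le> C * cmod h"
        unfolding eventually_at
      proof (intro exI[of _ "s / 2"] conjI ballI impI)
        fix h :: complex assume "h \<noteq> 0 \<and> dist h 0 < s / 2"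
        then have h: "cmod h < s / 2" "h \<noteq> 0" by auto
        have "F (z + h) - F z - (cmul h o\<^sub>L L) = cmul h o\<^sub>L (Q h - L)" using h(2)
          by (intro blinfun_eqI) (simp add: Q_def cmul_apply blinfun.diff_left scaleC_diff_right scaleC_scaleC scaleC_one)
        then have "norm (F (z + h) - F z - (cmul h o\<^sub>L L)) \<le> cmod h * (C * cmod h)"
          by (simp add: order_trans[OF norm_blinfun_compose] mult_mono norm_cmul_le QL[OF h])
        then show "norm (F (z + h) - F z - (cmul h o\<^sub>L L)) / norm h \<le> C * cmod h"
          using h(2) by (simp add: divide_le_eq mult.commute)
      qed (use \<open>s > 0\<close> in auto)
      show "((\<lambda>h. C * cmod h) \<longlongrightarrow> 0) (at 0)"
        by (rule tendsto_eq_intros refl | simp)+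
    qed auto
  qed
  moreover have "(cmul h o\<^sub>L L) x = h *\<^sub>C (cmul 1 o\<^sub>L L) x" for h x
    by (simp add: cmul_apply scaleC_one)
  ultimately show "\<exists>F'. (F has_derivative F') (at z) \<and> (\<forall>h x. blinfun_apply (F' h) x = h *\<^sub>C blinfun_apply (F' 1) x)"
    by blast
qed

text \<open>Each membership condition of \<open>bop\<close> is a linear relation between matrix
  elements of \<open>F z\<close>. Such a relation persists under differentiation, by uniqueness of
  the derivative.\<close>

lemma derivative_in_bop:
  fixes F :: "complex \<Rightarrow> 'a::complex_hilbert \<Rightarrow>\<^sub>L 'b::complex_hilbert"
  assumes V: "csub V" and F: "\<And>z. z \<in> ball 0 1 \<Longrightarrow> F z \<in> bop U V"
    and F': "(F has_derivative F') (at 0)" "\<And>h x. F' h x = h *\<^sub>C F' 1 x"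
  shows "F' 1 \<in> bop U V"
proof -
  have eq: "cinner (F' 1 x) y = c * cinner (F' 1 x') y'"
    if "\<And>z. z \<in> ball 0 1 \<Longrightarrow> cinner (F z x) y = c * cinner (F z x') y'" for x y x' y' c
  proof (rule DERIV_unique[OF weak_derivative[OF F']])
    show "((\<lambda>z. cinner (F z x) y) has_field_derivative c * cinner (F' 1 x') y') (at 0)"
      by (rule has_field_derivative_transform_within_open[OF DERIV_cmult[OF weak_derivative[OF F']]
            open_ball[of 0 1]]) (auto simp: that)
  qed
  show ?thesis
  proof (rule bopI)
    show "F' 1 (c *\<^sub>C x) = c *\<^sub>C F' 1 x" for c x
    proof (rule cinner_eqI)
      fix w
      have "cinner (F' 1 (c *\<^sub>C x)) w = c * cinner (F' 1 x) w"
        by (rule eq) (simp add: bop_scaleC[OF F] cinner_scaleC_left)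
      then show "cinner (F' 1 (c *\<^sub>C x)) w = cinner (c *\<^sub>C F' 1 x) w" by (simp add: cinner_scaleC_left)
    qed
    show "F' 1 x \<in> V" for x
    proof (rule csub_mem_iff[OF V])
      fix w assume "\<And>u. u \<in> V \<Longrightarrow> cinner w u = 0"
      then have "cinner (F z x) w = 0" if "z \<in> ball 0 1" for z
        using bop_range[OF F[OF that]] cinner_eq_zero_commute by blast
      then have "cinner (F' 1 x) w = 0" using eq[of x w 0 x w] by simp
      then show "cinner w (F' 1 x) = 0" using cinner_eq_zero_commute by blast
    qed
    show "F' 1 x = 0" if "\<And>u. u \<in> U \<Longrightarrow> cinner x u = 0" for x
    proof (rule cinner_eqI)
      fix w
      have "cinner (F' 1 x) w = 0 * cinner (F' 1 x) w" by (rule eq) (simp add: bop_zero[OF F that])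
      then show "cinner (F' 1 x) w = cinner 0 w" by simp
    qed
  qed
qed

text \<open>The resolvent identity L(w) - L(z) = - L(w) (K(w) - K(z)) L(z) yields first continuity
  of \<open>L\<close>, by the local bound, and then the derivatives of its matrix elements.
  \<open>cholo_of_weak\<close> returns to the operator norm.\<close>

lemma cholo_inverse:
  fixes K L :: "complex \<Rightarrow> 'a::complex_hilbert \<Rightarrow>\<^sub>L 'a"
  assumes R: "csub R" and K: "cholo K"
    and L: "\<And>z. z \<in> ball 0 1 \<Longrightarrow> L z \<in> bop R R"
    and inv: "\<And>z x. z \<in> ball 0 1 \<Longrightarrow> x \<in> R \<Longrightarrow> L z (K z x) = x" "\<And>z x. z \<in> ball 0 1 \<Longrightarrow> x \<in> R \<Longrightarrow> K z (L z x) = x"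
    and bd: "\<And>r. r < 1 \<Longrightarrow> \<exists>M. \<forall>z\<in>ball 0 r. norm (L z) \<le> M"
  shows "cholo L"
proof (rule cholo_of_weak[OF R R L bd closure_subset closure_subset holomorphic_onI])
  fix x y :: 'a and z :: complex assume z: "z \<in> ball 0 1"
  obtain K' where K': "(K has_derivative K') (at z)" "\<And>h x. K' h x = h *\<^sub>C K' 1 x"
    using K z by (rule choloE) blast
  define r where "r = (1 + cmod z) / 2"
  have r: "r < 1" "cmod z < r" using z by (auto simp: r_def)
  obtain M where M: "\<And>w. w \<in> ball 0 r \<Longrightarrow> norm (L w) \<le> M" using bd[OF r(1)] by blast
  have diff: "L w - L z = - (L w o\<^sub>L (K w - K z) o\<^sub>L L z)" if w: "w \<in> ball 0 1" for w
  proof (rule blinfun_eqI)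
    fix x
    have "L w (K z (L z x)) = L w (K z (L z (proj R x)))" by (simp add: bop_proj[OF R L[OF z]])
    also have "\<dots> = L w x" by (simp add: inv(2)[OF z] proj_in[OF R] bop_proj[OF R L[OF w]])
    finally show "(L w - L z) x = (- (L w o\<^sub>L (K w - K z) o\<^sub>L L z)) x"
      by (simp add: blinfun.diff_left blinfun.diff_right blinfun.minus_left inv(1)[OF w] bop_range[OF L[OF z]])
  qed
  have ev: "\<forall>\<^sub>F w in at z. w \<in> ball 0 r" using r by (intro eventually_at_in_open') auto
  have "(K \<longlongrightarrow> K z) (at z)"
    using has_derivative_continuous[OF K'(1)] by (simp add: continuous_at)
  then have K0: "((\<lambda>w. M * norm (K w - K z) * M) \<longlongrightarrow> 0) (at z)"
    by (auto intro!: tendsto_eq_intros simp: LIM_zero_iff)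
  have Lz: "(L \<longlongrightarrow> L z) (at z)"
  proof (rule LIM_zero_cancel, rule Lim_null_comparison[OF _ K0], rule eventually_mono[OF ev])
    fix w :: complex assume w: "w \<in> ball 0 r"
    then have "norm (L w - L z) = norm (L w o\<^sub>L (K w - K z) o\<^sub>L L z)" using r by (simp add: diff)
    also have "\<dots> \<le> M * norm (K w - K z) * M"
      using M[OF w] M[of z] r order_trans[OF norm_ge_zero M[OF w]]
      by (intro order_trans[OF norm_blinfun_compose] mult_mono) auto
    finally show "norm (L w - L z) \<le> M * norm (K w - K z) * M" .
  qed
  define u where "u = L z x"
  define Q where "Q w = (1 / (w - z)) *\<^sub>C (K w u - K z u)" for w
  have Q: "(Q \<longlongrightarrow> K' 1 u) (at z)"
  proof (rule LIM_zero_cancel, rule Lim_null_comparison)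
    show "\<forall>\<^sub>F w in at z. norm (Q w - K' 1 u) \<le> norm (K w - K z - K' (w - z)) / norm (w - z) * norm u"
      unfolding eventually_at_filter
    proof (rule always_eventually, intro allI impI)
      fix w assume "w \<noteq> z"
      then have "Q w - K' 1 u = (1 / (w - z)) *\<^sub>C (K w - K z - K' (w - z)) u"
        by (simp add: Q_def blinfun.diff_left K'(2)[of "w - z"] scaleC_diff_right scaleC_scaleC scaleC_one)
      then show "norm (Q w - K' 1 u) \<le> norm (K w - K z - K' (w - z)) / norm (w - z) * norm u"
        using norm_blinfun[of "K w - K z - K' (w - z)" u] by (simp add: norm_scaleC norm_divide divide_right_mono)
    qed
    show "((\<lambda>w. norm (K w - K z - K' (w - z)) / norm (w - z) * norm u) \<longlongrightarrow> 0) (at z)"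
      using K'(1) unfolding has_derivative_iff_norm by (intro tendsto_mult_left_zero) blast
  qed
  have "((\<lambda>w. - cinner (L w (Q w)) y) \<longlongrightarrow> - cinner (L z (K' 1 u)) y) (at z)"
    by (intro tendsto_minus cinner.tendsto tendsto_const blinfun.tendsto Lz Q)
  moreover have "\<forall>\<^sub>F w in at z. - cinner (L w (Q w)) y = (cinner (L w x) y - cinner (L z x) y) / (w - z)"
  proof (rule eventually_mono[OF ev])
    fix w :: complex assume "w \<in> ball 0 r"
    then have w: "w \<in> ball 0 1" using r by simp
    have "cinner (L w x) y - cinner (L z x) y = cinner ((L w - L z) x) y"
      by (simp add: blinfun.diff_left cinner.diff_left)
    also have "\<dots> = - cinner (L w (K w u - K z u)) y"
      unfolding diff[OF w] by (simp add: u_def blinfun.minus_left blinfun.diff_left cinner.minus_left)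
    finally show "- cinner (L w (Q w)) y = (cinner (L w x) y - cinner (L z x) y) / (w - z)"
      by (simp add: Q_def bop_scaleC[OF L[OF w]] cinner_scaleC_left)
  qed
  ultimately have "((\<lambda>w. (cinner (L w x) y - cinner (L z x) y) / (w - z)) \<longlongrightarrow> - cinner (L z (K' 1 u)) y) (at z)"
    by (rule Lim_transform_eventually)
  then have "((\<lambda>z. cinner (L z x) y) has_field_derivative - cinner (L z (K' 1 u)) y) (at z)"
    by (simp add: has_field_derivative_iff)
  then show "(\<lambda>z. cinner (L z x) y) field_differentiable at z within ball 0 1"
    using field_differentiable_at_within field_differentiable_def by blast
qed (use L in auto)

section \<open>Scalar estimates and inversion of accretive operators\<close>

text \<open>The Schwarz lemma wants values strictly inside the unit disc, while here the bound is
  not strict and \<open>C\<close> may be 0. Dividing by C + e and letting e tend to 0 covers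
  both.\<close>

lemma schwarz_bound:
  assumes hol: "f holomorphic_on ball 0 1" "f 0 = 0" and le: "\<And>z. cmod z < 1 \<Longrightarrow> cmod (f z) \<le> C"
    and z: "cmod z < 1"
  shows "cmod (f z) \<le> C * cmod z"
proof (rule field_le_epsilon)
  fix e :: real assume "e > 0"
  have "C \<ge> 0" using order_trans[OF norm_ge_zero le[OF z]] .
  define g where "g w = f w / (C + e)" for w
  have "cmod (g z) \<le> cmod z"
  proof (rule Schwarz_Lemma(1)[OF _ _ _ z])
    show "g holomorphic_on ball 0 1"
      unfolding g_def using \<open>C \<ge> 0\<close> \<open>e > 0\<close>
      by (intro holomorphic_intros hol) (metis add_nonneg_pos less_irrefl of_real_add of_real_eq_0_iff)
    show "cmod (g w) < 1" if "cmod w < 1" for w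
      using le[OF that] \<open>C \<ge> 0\<close> \<open>e > 0\<close>
      by (simp add: g_def norm_divide del: of_real_add flip: of_real_add)
  qed (simp add: g_def hol)
  then have "cmod (f z) \<le> (C + e) * cmod z" using \<open>C \<ge> 0\<close> \<open>e > 0\<close>
    by (simp add: g_def norm_divide divide_le_eq mult.commute del: of_real_add flip: of_real_add)
  also have "\<dots> \<le> C * cmod z + e"
    using z \<open>e > 0\<close> by (simp add: distrib_right mult_le_cancel_left1)
  finally show "cmod (f z) \<le> C * cmod z + e" .
qed

text \<open>The Cayley transform (f - d) / (f + d) maps into the disc and vanishes at 0, so the
  Schwarz lemma gives |f - d| \<le> |z| |f + d|. The triangle inequality yields the first bound.
  Squaring, dropping |f|^2 and using 1 + |z|^2 \<le> 2 yields the second; its constant is cruder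
  than Harnack's, but a positive lower bound is all that is asked of it.\<close>

lemma caratheodory_strict:
  assumes hol: "f holomorphic_on ball 0 1" and re: "\<And>z. cmod z < 1 \<Longrightarrow> Re (f z) > 0"
    and f0: "f 0 = complex_of_real d" and z: "cmod z < 1"
  shows "(1 - cmod z) * cmod (f z) \<le> (1 + cmod z) * d"
    and "(1 - (cmod z)\<^sup>2) / 4 * d \<le> Re (f z)"
proof -
  have "d > 0" using re[of 0] f0 by simp
  define g where "g w = (f w - d) / (f w + d)" for w
  have less: "cmod (f w - d) < cmod (f w + d)" if "cmod w < 1" for w
  proof -
    have "(cmod (f w - d))\<^sup>2 < (cmod (f w + d))\<^sup>2"
      using re[OF that] \<open>d > 0\<close> by (simp add: cmod_power2) (simp add: power2_eq_square algebra_simps)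
    then show ?thesis by (rule power_less_imp_less_base) simp
  qed
  have "cmod (g z) \<le> cmod z"
  proof (rule Schwarz_Lemma(1)[OF _ _ _ z])
    show "g holomorphic_on ball 0 1"
      unfolding g_def using less by (intro holomorphic_intros hol) fastforce
    show "cmod (g w) < 1" if "cmod w < 1" for w
      using less[OF that] norm_ge_zero[of "f w - d"] by (simp add: g_def norm_divide divide_less_eq)
  qed (simp add: g_def f0)
  then have le: "cmod (f z - d) \<le> cmod z * cmod (f z + d)"
    using less[OF z] norm_ge_zero[of "f z - d"] by (simp add: g_def norm_divide divide_le_eq split: if_splits)
  have "cmod (f z) - d \<le> cmod (f z - d)"
    using norm_triangle_ineq2[of "f z" "complex_of_real d"] \<open>d > 0\<close> by simp
  also note le
  also have "cmod z * cmod (f z + d) \<le> cmod z * (cmod (f z) + d)"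
    using norm_triangle_ineq[of "f z" "complex_of_real d"] \<open>d > 0\<close> by (intro mult_left_mono) auto
  finally show "(1 - cmod z) * cmod (f z) \<le> (1 + cmod z) * d" by (simp add: algebra_simps)
  define r where "r = (cmod z)\<^sup>2"
  have r: "0 \<le> r" "r < 1" using z by (auto simp: r_def power_less_one_iff)
  have "(cmod (f z - d))\<^sup>2 \<le> r * (cmod (f z + d))\<^sup>2"
    using power_mono[OF le, of 2] by (simp add: power_mult_distrib r_def)
  moreover have "(cmod (f z - d))\<^sup>2 = (cmod (f z))\<^sup>2 + d\<^sup>2 - 2 * d * Re (f z)"
    "(cmod (f z + d))\<^sup>2 = (cmod (f z))\<^sup>2 + d\<^sup>2 + 2 * d * Re (f z)"
    unfolding cmod_power2 by (simp_all add: power2_eq_square algebra_simps)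
  ultimately have "((cmod (f z))\<^sup>2 + d\<^sup>2) * (1 - r) \<le> 2 * d * Re (f z) * (1 + r)"
    by (simp add: algebra_simps)
  moreover have "d\<^sup>2 * (1 - r) \<le> ((cmod (f z))\<^sup>2 + d\<^sup>2) * (1 - r)"
    using r by (intro mult_right_mono) auto
  moreover have "2 * d * Re (f z) * (1 + r) \<le> 2 * d * Re (f z) * 2"
    using r \<open>d > 0\<close> re[OF z] by (intro mult_left_mono) auto
  ultimately have "d * (d * (1 - r)) \<le> d * (4 * Re (f z))"
    by (simp add: power2_eq_square algebra_simps)
  then show "(1 - (cmod z)\<^sup>2) / 4 * d \<le> Re (f z)"
    using \<open>d > 0\<close> by (simp add: r_def mult.commute)
qed

text \<open>In the application \<open>d\<close> is the squared norm of \<open>D x\<close>, which may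
  be 0, and the real part may touch 0. Adding e > 0 to \<open>f\<close> and letting e decrease to 0
  reduces this to the strict case.\<close>

lemma caratheodory:
  assumes hol: "f holomorphic_on ball 0 1" and re: "\<And>z. cmod z < 1 \<Longrightarrow> Re (f z) \<ge> 0"
    and f0: "f 0 = complex_of_real d" and z: "cmod z < 1"
  shows "(1 - cmod z) * cmod (f z) \<le> (1 + cmod z) * d"
    and "(1 - (cmod z)\<^sup>2) / 4 * d \<le> Re (f z)"
proof -
  have *: "(1 - cmod z) * cmod (f z + e) \<le> (1 + cmod z) * (d + e)"
    "(1 - (cmod z)\<^sup>2) / 4 * (d + e) \<le> Re (f z + complex_of_real e)" if "e > 0" for e :: real
    by (rule caratheodory_strict[of "\<lambda>z. f z + complex_of_real e" "d + e"];
        use re f0 z that in \<open>force intro!: holomorphic_intros hol add_nonneg_pos\<close>)+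
  have lim: "((\<lambda>e. e) \<longlongrightarrow> (0::real)) (at_right 0)" by (rule tendsto_ident_at)
  have ev: "\<forall>\<^sub>F e in at_right (0::real). e > 0" by (simp add: eventually_at_right_less)
  have l1: "((\<lambda>e. (1 - cmod z) * cmod (f z + complex_of_real e)) \<longlongrightarrow> (1 - cmod z) * cmod (f z + complex_of_real 0)) (at_right 0)"
    and l2: "((\<lambda>e. (1 + cmod z) * (d + e)) \<longlongrightarrow> (1 + cmod z) * (d + 0)) (at_right 0)"
    and l3: "((\<lambda>e. (1 - (cmod z)\<^sup>2) / 4 * (d + e)) \<longlongrightarrow> (1 - (cmod z)\<^sup>2) / 4 * (d + 0)) (at_right 0)"
    and l4: "((\<lambda>e. Re (f z + complex_of_real e)) \<longlongrightarrow> Re (f z + complex_of_real 0)) (at_right 0)"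
    by (intro tendsto_intros lim | simp)+
  show "(1 - cmod z) * cmod (f z) \<le> (1 + cmod z) * d"
    using tendsto_le[OF trivial_limit_at_right_real l2 l1 eventually_mono[OF ev *(1)]] by simp
  show "(1 - (cmod z)\<^sup>2) / 4 * d \<le> Re (f z)"
    using tendsto_le[OF trivial_limit_at_right_real l4 l3 eventually_mono[OF ev *(2)]] by simp
qed

text \<open>Solving w + A u = u is a fixed point problem for a contraction of \<open>R\<close>. The
  map \<open>A\<close> is a plain function because the feedback map built from \<open>a_fun\<close>
  is one.\<close>

lemma bij_betw_minus_contraction:
  fixes R :: "'a::complex_hilbert set"
  assumes R: "csub R" and A: "\<And>u. u \<in> R \<Longrightarrow> A u \<in> R" and "q < 1" "0 \<le> q"
    and lip: "\<And>u v. u \<in> R \<Longrightarrow> v \<in> R \<Longrightarrow> norm (A u - A v) \<le> q * norm (u - v)"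
  shows "bij_betw (\<lambda>u. u - A u) R R"
proof -
  have ex: "\<exists>!u\<in>R. w + A u = u" if "w \<in> R" for w
  proof (rule Banach_fix[OF _ _ assms(4,3)])
    show "complete R" using csub_closed[OF R] by (simp add: complete_eq_closed)
    show "R \<noteq> {}" using csub_zero[OF R] by blast
    show "(\<lambda>u. w + A u) ` R \<subseteq> R" using A csub_add[OF R that] by blast
    show "dist (w + A u) (w + A v) \<le> q * dist u v" if "u \<in> R" "v \<in> R" for u v
      using lip[OF that] by (simp add: dist_norm)
  qed
  show ?thesis
  proof (rule bij_betwI')
    show "(u - A u = v - A v) = (u = v)" if "u \<in> R" "v \<in> R" for u v
      using ex[OF csub_diff[OF R that(1) A[OF that(1)]]] that by (auto simp: algebra_simps)
    show "u - A u \<in> R" if "u \<in> R" for u using that A csub_diff[OF R] by blast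
    show "\<exists>u\<in>R. w = u - A u" if "w \<in> R" for w
      using ex[OF that] by (metis add_diff_cancel_right')
  qed
qed

text \<open>The Lax-Milgram argument: for small t > 0 the map I - t K contracts \<open>R\<close>, so
  t K is bijective there, and strict accretivity bounds its inverse.\<close>

lemma accretive_inverse_exists:
  fixes K :: "'a::complex_hilbert \<Rightarrow>\<^sub>L 'a"
  assumes R: "csub R" and K: "K \<in> bop R R" and "c > 0"
    and acc: "\<And>u. u \<in> R \<Longrightarrow> c * (norm u)\<^sup>2 \<le> Re (cinner (K u) u)"
  shows "\<exists>L\<in>bop R R. (\<forall>x\<in>R. blinfun_apply L (K x) = x \<and> K (blinfun_apply L x) = x) \<and> norm L \<le> 1 / c"
proof -
  \<comment> \<open>The squared contraction factor is at most 1 + t^2 |K|^2 - 2 t c; with t = c / m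
    it is at most 1 - c^2 / m. Adding 1 to the square of the norm avoids division by 0.\<close>
  define m where "m = (norm K)\<^sup>2 + 1"
  have "m \<ge> 1" by (simp add: m_def)
  define t where "t = c / m"
  have "t > 0" using \<open>m \<ge> 1\<close> \<open>c > 0\<close> by (simp add: t_def)
  have "bij_betw (\<lambda>u. u - (u - t *\<^sub>R K u)) R R"
  proof (rule bij_betw_minus_contraction[where q = "sqrt (max 0 (1 - c\<^sup>2 / m))"])
    show "u - t *\<^sub>R K u \<in> R" if "u \<in> R" for u
      by (intro csub_diff csub_scaleR R that bop_range[OF K])
    show "sqrt (max 0 (1 - c\<^sup>2 / m)) < 1"
      using \<open>c > 0\<close> \<open>m \<ge> 1\<close> by simp
    fix u v assume "u \<in> R" "v \<in> R"
    define w where "w = u - v"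
    have w: "w \<in> R" by (simp add: w_def csub_diff R \<open>u \<in> R\<close> \<open>v \<in> R\<close>)
    have "(norm (w - t *\<^sub>R K w))\<^sup>2 = (norm w)\<^sup>2 + t\<^sup>2 * (norm (K w))\<^sup>2 - 2 * t * Re (cinner (K w) w)"
      by (simp add: norm_diff_sq power_mult_distrib cinner.scaleR_right cinner_commute[of w "K w"])
    also have "\<dots> \<le> (norm w)\<^sup>2 + t\<^sup>2 * ((norm K)\<^sup>2 * (norm w)\<^sup>2) - 2 * t * (c * (norm w)\<^sup>2)"
      using \<open>t > 0\<close> acc[OF w] power_mono[OF norm_blinfun[of K w], of 2]
      by (intro diff_mono add_mono mult_left_mono) (auto simp: power_mult_distrib)
    also have "\<dots> = (1 + t\<^sup>2 * (norm K)\<^sup>2 - 2 * t * c) * (norm w)\<^sup>2"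
      by (simp add: algebra_simps)
    also have "\<dots> \<le> (1 - c\<^sup>2 / m) * (norm w)\<^sup>2"
    proof (rule mult_right_mono)
      have "t\<^sup>2 * (norm K)\<^sup>2 \<le> t\<^sup>2 * m" by (intro mult_left_mono) (auto simp: m_def)
      also have "\<dots> = c\<^sup>2 / m" using \<open>m \<ge> 1\<close> by (simp add: t_def power2_eq_square)
      finally show "1 + t\<^sup>2 * (norm K)\<^sup>2 - 2 * t * c \<le> 1 - c\<^sup>2 / m"
        by (simp add: t_def power2_eq_square)
    qed simp
    \<comment> \<open>When \<open>R\<close> is trivial, \<open>c\<close> is unrestricted and 1 - c^2
      / m may be negative; the maximum keeps the square root meaningful.\<close>
    also have "\<dots> \<le> max 0 (1 - c\<^sup>2 / m) * (norm w)\<^sup>2"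
      by (intro mult_right_mono) auto
    finally have "norm (w - t *\<^sub>R K w) \<le> sqrt (max 0 (1 - c\<^sup>2 / m) * (norm w)\<^sup>2)"
      by (rule real_le_rsqrt)
    then show "norm ((u - t *\<^sub>R K u) - (v - t *\<^sub>R K v)) \<le> sqrt (max 0 (1 - c\<^sup>2 / m)) * norm (u - v)"
      by (simp add: real_sqrt_mult w_def blinfun.diff_right algebra_simps)
  qed (use R in auto)
  then have bij: "bij_betw (\<lambda>u. t *\<^sub>R K u) R R" by simp
  define g where "g = the_inv_into R (\<lambda>u. t *\<^sub>R K u)"
  define L where "L x = g (t *\<^sub>R proj R x)" for x
  have g: "g w \<in> R" "t *\<^sub>R K (g w) = w" if "w \<in> R" for w
    using bij that unfolding g_def
    by (auto simp: bij_betw_def intro: the_inv_into_into f_the_inv_into_f)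
  have LR: "L x \<in> R" and KL: "K (L x) = proj R x" for x
    using g[of "t *\<^sub>R proj R x"] \<open>t > 0\<close> by (auto simp: L_def csub_scaleR proj_in R)
  have below: "c * norm u \<le> norm (K u)" if u: "u \<in> R" for u
  proof -
    have "c * (norm u)\<^sup>2 \<le> norm (K u) * norm u"
      using acc[OF u] complex_Re_le_cmod[of "cinner (K u) u"] cmod_cinner_le[of "K u" u] by linarith
    then show ?thesis by (cases "u = 0") (auto simp: power2_eq_square)
  qed
  have uniq: "L x = u" if "u \<in> R" "K u = proj R x" for x u
    using below[OF csub_diff[OF R LR that(1)], of x] \<open>c > 0\<close> KL[of x] that(2)
    by (simp add: blinfun.diff_right mult_le_0_iff)
  have nL: "norm (L x) \<le> 1 / c * norm x" for x
    using below[OF LR, of x] norm_proj_le[OF R, of x] \<open>c > 0\<close> by (simp add: KL field_simps)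
  have Lsc: "L (a *\<^sub>C x) = a *\<^sub>C L x" for a x
    by (rule uniq) (auto simp: csub_scaleC R LR bop_scaleC[OF K] KL bop_scaleC[OF proj_bop[OF R]])
  have "\<exists>T. blinfun_apply T = L"
    by (rule ex_blinfun[where K = "1 / c", OF _ Lsc nL], rule uniq)
      (auto simp: csub_add R LR blinfun.add_right KL)
  then obtain T where T: "blinfun_apply T = L" by blast
  have "T \<in> bop R R"
  proof (rule bopI)
    show "T x = 0" if "\<And>u. u \<in> R \<Longrightarrow> cinner x u = 0" for x unfolding T
      by (rule uniq) (simp_all add: csub_zero R blinfun.zero_right bop_zero[OF proj_bop[OF R] that])
  qed (simp_all add: T Lsc LR)
  moreover have "T (K x) = x \<and> K (T x) = x" if "x \<in> R" for x
    unfolding T KL by (simp add: uniq that proj_id R bop_range[OF K])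
  moreover have "norm T \<le> 1 / c"
    using nL \<open>c > 0\<close> by (intro norm_blinfun_bound) (simp_all add: T)
  ultimately show ?thesis by (intro bexI[of _ T] conjI ballI) auto
qed

text \<open>The operator version of the Schwarz lemma, obtained from the scalar one for each matrix
  element. At 0 the quotient takes the value of the derivative of \<open>W\<close>, and its norm is
  bounded there by continuity.\<close>

lemma schur_class_divide:
  fixes R :: "'a::complex_hilbert set" and S :: "'b::complex_hilbert set"
  assumes R: "csub R" and S: "csub S" and W: "cholo W"
    "\<And>z. z \<in> ball 0 1 \<Longrightarrow> W z \<in> bop R S" "\<And>z. z \<in> ball 0 1 \<Longrightarrow> norm (W z) \<le> 1" "W 0 = 0"
  shows "\<exists>E\<in>schur_class R S. \<forall>z\<in>ball 0 1. W z = cmul z o\<^sub>L E z"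
proof -
  obtain W' where W': "(W has_derivative W') (at 0)" "\<And>h x. W' h x = h *\<^sub>C W' 1 x"
    by (rule choloE[OF W(1), of 0]) (simp, blast)
  define E where "E z = (if z = 0 then W' 1 else cmul (1 / z) o\<^sub>L W z)" for z
  have Eb: "E z \<in> bop R S" if "z \<in> ball 0 1" for z
    using that derivative_in_bop[OF S W(2) W'] by (simp add: E_def cmul_bop[OF S W(2)])
  have Wb: "cmod (cinner (W z x) y) \<le> norm x * norm y * cmod z" if "cmod z < 1" for x y z
  proof (rule schwarz_bound[OF cholo_weak[OF W(1)] _ _ that])
    show "cmod (cinner (W w x) y) \<le> norm x * norm y" if "cmod w < 1" for w
    proof -
      have "cmod (cinner (W w x) y) \<le> norm (W w x) * norm y" by (rule cmod_cinner_le)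
      also have "\<dots> \<le> (1 * norm x) * norm y"
        using that by (intro mult_right_mono order_trans[OF norm_blinfun] W(3)) auto
      finally show ?thesis by simp
    qed
  qed (simp add: W(4))
  have E1: "norm (E z) \<le> 1" if z: "z \<in> ball 0 1" "z \<noteq> 0" for z
  proof (rule norm_le_of_dense_forms[OF R Eb[OF z(1)] closure_subset closure_subset])
    show "cmod (cinner (E z x) y) \<le> 1 * norm x * norm y" for x y using Wb[of z x y] z
      by (simp add: E_def cmul_apply cinner_scaleC_left norm_mult norm_divide divide_le_eq)
  qed simp
  have Eh: "cholo E"
  proof (rule cholo_of_weak[OF R S Eb _ closure_subset closure_subset])
    show "\<exists>M. \<forall>z\<in>ball 0 r. norm (E z) \<le> M" if "r < 1" for r
    proof (intro exI[of _ "max 1 (norm (E 0))"] ballI)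
      show "norm (E z) \<le> max 1 (norm (E 0))" if "z \<in> ball 0 r" for z
        using E1[of z] that \<open>r < 1\<close> by (cases "z = 0") (auto simp: le_max_iff_disj)
    qed
    show "(\<lambda>z. cinner (E z x) y) holomorphic_on ball 0 1" for x y
    proof (rule pole_theorem_open_0[OF cholo_weak[OF W(1)] open_ball])
      show "cinner (W z x) y = (z - 0) * cinner (E z x) y" if "z \<in> ball 0 1 - {0}" for z
        using that by (simp add: E_def cmul_apply cinner_scaleC_left)
      show "cinner (W 0 x) y = 0" by (simp add: W(4))
      have "deriv (\<lambda>z. cinner (W z x) y) 0 = cinner (W' 1 x) y"
        by (intro DERIV_imp_deriv weak_derivative W')
      then show "cinner (E 0 x) y = deriv (\<lambda>z. cinner (W z x) y) 0" by (simp add: E_def)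
    qed
  qed
  have "norm (E 0) \<le> 1"
  proof (rule tendsto_upperbound)
    show "((\<lambda>z. norm (E z)) \<longlongrightarrow> norm (E 0)) (at 0)" by (intro tendsto_norm cholo_tendsto Eh)
    show "\<forall>\<^sub>F z in at 0. norm (E z) \<le> 1"
      unfolding eventually_at by (intro exI[of _ 1]) (auto intro: E1)
  qed simp
  then have E1': "norm (E z) \<le> 1" if "z \<in> ball 0 1" for z
    using E1[OF that] by (cases "z = 0") auto
  have "restrict E (ball 0 1) \<in> schur_class R S"
    unfolding schur_class_iff using Eb E1' cholo_cong[OF Eh, of "restrict E (ball 0 1)"] by auto
  moreover have "W z = cmul z o\<^sub>L restrict E (ball 0 1) z" if "z \<in> ball 0 1" for z
    using that by (intro blinfun_eqI) (auto simp: E_def cmul_apply W(4) scaleC_scaleC scaleC_one)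
  ultimately show ?thesis by blast
qed

section \<open>One step of the Schur algorithm\<close>

text \<open>Here \<open>T\<close> may be defined on a space larger than \<open>B\<close> and have a
  codomain larger than \<open>W\<close>. The case in mind is \<Gamma>*, defined on all of
  \<open>V\<close>, acting between the defect spaces.\<close>

lemma bop_compose_restrict:
  assumes "K \<in> bop A B" "T \<in> bop U V" "\<And>u. u \<in> B \<Longrightarrow> blinfun_apply T u \<in> W"
  shows "T o\<^sub>L K \<in> bop A W"
  using assms(3)[OF bop_range[OF assms(1)]]
  by (intro bopI) (simp_all add: bop_scaleC[OF assms(1)] bop_scaleC[OF assms(2)] bop_zero[OF assms(1)])

text \<open>The minimum over s is attained at s = b / a and equals 2 C a b; enlarging
  \<open>a\<close> and \<open>b\<close> by e > 0 allows for zeros.\<close>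

lemma two_mult_le:
  fixes a b C X :: real
  assumes "a \<ge> 0" "b \<ge> 0" "C \<ge> 0" and le: "\<And>s. s > 0 \<Longrightarrow> X \<le> C * (s * a\<^sup>2 + b\<^sup>2 / s)"
  shows "X \<le> 2 * C * a * b"
proof -
  have *: "X \<le> 2 * C * (a + e) * (b + e)" if "e > 0" for e
  proof -
    define s where "s = (b + e) / (a + e)"
    have ab: "a + e > 0" "b + e > 0" using assms that by auto
    have "X \<le> C * (s * a\<^sup>2 + b\<^sup>2 / s)" using ab by (intro le) (simp add: s_def)
    also have "\<dots> \<le> C * (s * (a + e)\<^sup>2 + (b + e)\<^sup>2 / s)" using ab assms that
      by (intro mult_left_mono add_mono divide_right_mono power_mono) (auto simp: s_def)
    also have "\<dots> = 2 * C * (a + e) * (b + e)" using ab by (simp add: s_def power2_eq_square)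
    finally show ?thesis .
  qed
  have "((\<lambda>e. 2 * C * (a + e) * (b + e)) \<longlongrightarrow> 2 * C * (a + 0) * (b + 0)) (at_right 0)"
    by (intro tendsto_intros)
  moreover have "\<forall>\<^sub>F e in at_right 0. X \<le> 2 * C * (a + e) * (b + e)"
    using eventually_at_right_less[of 0] by (rule eventually_mono) (rule *)
  ultimately have "X \<le> 2 * C * (a + 0) * (b + 0)" by (rule tendsto_lowerbound) simp
  then show ?thesis by simp
qed

text \<open>\<open>A\<close> is not Hermitian, so the Cauchy-Schwarz inequality for its form is not
  at hand. Polarization and the parallelogram law give the bound C (|D x|^2 + |D y|^2); rescaling
  \<open>x\<close> and \<open>y\<close> by inverse factors and optimizing turns the sum into a
  product.\<close>

lemma polarization_bound:
  fixes A :: "'a::complex_hilbert \<Rightarrow>\<^sub>L 'a" and D :: "'a \<Rightarrow>\<^sub>L 'b::complex_hilbert"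
  assumes U: "csub U" and A: "A \<in> bop U U" and D: "D \<in> bop U V" and "C \<ge> 0"
    and le: "\<And>x. x \<in> U \<Longrightarrow> cmod (cinner (A x) x) \<le> C * (norm (D x))\<^sup>2"
    and x: "x \<in> U" and y: "y \<in> U"
  shows "cmod (cinner (A x) y) \<le> 2 * C * norm (D x) * norm (D y)"
proof (rule two_mult_le)
  have *: "cmod (cinner (A x) y) \<le> C * ((norm (D x))\<^sup>2 + (norm (D y))\<^sup>2)" if x: "x \<in> U" and y: "y \<in> U" for x y
  proof -
    define q where "q u = cinner (A u) u" for u
    have "4 * cinner (A x) y = (q (x + y) - q (x - y)) + \<i> * (q (x + \<i> *\<^sub>C y) - q (x - \<i> *\<^sub>C y))"
      by (simp add: q_def blinfun.add_right blinfun.diff_right bop_scaleC[OF A] cinner_scaleC_left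
          cinner_scaleC_right cinner.add_left cinner.add_right cinner.diff_left cinner.diff_right algebra_simps)
    then have "4 * cmod (cinner (A x) y) = cmod ((q (x + y) - q (x - y)) + \<i> * (q (x + \<i> *\<^sub>C y) - q (x - \<i> *\<^sub>C y)))"
      by (metis norm_mult norm_numeral)
    also have "\<dots> \<le> (cmod (q (x + y)) + cmod (q (x - y))) + (cmod (q (x + \<i> *\<^sub>C y)) + cmod (q (x - \<i> *\<^sub>C y)))"
      by (intro order_trans[OF norm_triangle_ineq] add_mono)
        (auto simp: norm_mult intro: norm_triangle_ineq4)
    also have "\<dots> \<le> (C * (norm (D (x + y)))\<^sup>2 + C * (norm (D (x - y)))\<^sup>2)
        + (C * (norm (D (x + \<i> *\<^sub>C y)))\<^sup>2 + C * (norm (D (x - \<i> *\<^sub>C y)))\<^sup>2)"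
      unfolding q_def by (intro add_mono le csub_add csub_diff csub_scaleC U x y)
    also have "\<dots> = 4 * (C * ((norm (D x))\<^sup>2 + (norm (D y))\<^sup>2))"
      by (simp add: blinfun.add_right blinfun.diff_right norm_add_sq norm_diff_sq bop_scaleC[OF D] norm_scaleC
          algebra_simps)
    finally show ?thesis by simp
  qed
  fix s :: real assume "s > 0"
  have "cinner (A (sqrt s *\<^sub>R x)) ((1 / sqrt s) *\<^sub>R y) = cinner (A x) y"
    using \<open>s > 0\<close> by (simp add: blinfun.scaleR_right cinner.scaleR_left cinner.scaleR_right)
  moreover have "(norm (D (sqrt s *\<^sub>R x)))\<^sup>2 = s * (norm (D x))\<^sup>2"
    using \<open>s > 0\<close> by (simp add: blinfun.scaleR_right power_mult_distrib)
  moreover have "(norm (D ((1 / sqrt s) *\<^sub>R y)))\<^sup>2 = (norm (D y))\<^sup>2 / s"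
    using \<open>s > 0\<close> by (simp add: blinfun.scaleR_right power_mult_distrib power_divide)
  ultimately show "cmod (cinner (A x) y) \<le> C * (s * (norm (D x))\<^sup>2 + (norm (D y))\<^sup>2 / s)"
    using *[OF csub_scaleR[OF U x] csub_scaleR[OF U y], of "sqrt s" "1 / sqrt s"] by simp
qed (use \<open>C \<ge> 0\<close> in auto)

lemma dense_le:
  fixes f g :: "'a::first_countable_topology \<Rightarrow> real"
  assumes A: "R \<subseteq> closure A" and "continuous_on UNIV f" "continuous_on UNIV g"
    and le: "\<And>a. a \<in> A \<Longrightarrow> f a \<le> g a" and u: "u \<in> R"
  shows "f u \<le> g u"
proof -
  obtain a where a: "\<And>n. a n \<in> A" "a \<longlonglongrightarrow> u"
    using subsetD[OF A u] by (rule closure_sequenceE) blast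
  have "(\<lambda>n. f (a n)) \<longlonglongrightarrow> f u" "(\<lambda>n. g (a n)) \<longlonglongrightarrow> g u"
    using assms(2,3) a(2) by (auto intro: continuous_on_tendsto_compose[where s = UNIV])
  then show ?thesis by (rule LIMSEQ_le) (auto intro: le a)
qed

text \<open>The Schur step written without the inverse: \<open>u\<close> is \<open>(I + z \<Gamma>\<^sup>* E(z))\<^sup>-\<^sup>1 D x\<close>.\<close>

definition step_rel ::
    "'a::complex_inner set \<Rightarrow> 'b::complex_inner set \<Rightarrow> ('a \<Rightarrow>\<^sub>L 'b) \<Rightarrow> (complex \<Rightarrow> 'a \<Rightarrow>\<^sub>L 'b)
      \<Rightarrow> (complex \<Rightarrow> 'a \<Rightarrow>\<^sub>L 'b) \<Rightarrow> bool"
  where "step_rel U V G \<Theta> E \<longleftrightarrow> (\<forall>z\<in>ball 0 1. \<forall>x\<in>U. \<exists>u\<in>defect_space U G.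
    u = defect_op U G x - z *\<^sub>C adj G (E z u) \<and>
    \<Theta> z x = G x + z *\<^sub>C defect_op V (adj G) (E z u))"

context contraction
begin

lemma norm_defect_op_le: "x \<in> U \<Longrightarrow> norm (D x) \<le> norm x"
  using norm_defect_op_sq[of x] by - (rule power2_le_imp_le, simp_all)

text \<open>\<open>D\<close> is divided off on the right first, A = N D, which leaves a bound of the
  adjoint of \<open>N\<close> by \<open>D\<close>. Dividing that adjoint by \<open>D\<close> and
  taking adjoints again splits off the left factor.\<close>

lemma sandwich_exists:
  assumes A: "A \<in> bop U U" and "M \<ge> 0"
    and le: "\<And>x y. x \<in> U \<Longrightarrow> y \<in> U \<Longrightarrow> cmod (cinner (A x) y) \<le> M * norm (D x) * norm (D y)"
  shows "\<exists>K\<in>bop DU DU. norm K \<le> M \<and> (\<forall>x. D (blinfun_apply K (D x)) = A x)"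
proof -
  have "norm (A x) \<le> M * norm (D x)" if x: "x \<in> U" for x
  proof -
    have "norm (A x) * norm (A x) = cmod (cinner (A x) (A x))" by (simp add: cmod_cinner_self)
    also have "\<dots> \<le> M * norm (D x) * norm (D (A x))" by (intro le x bop_range[OF A])
    also have "\<dots> \<le> M * norm (D x) * norm (A x)"
      using \<open>M \<ge> 0\<close> by (intro mult_left_mono norm_defect_op_le bop_range[OF A]) auto
    finally show ?thesis using \<open>M \<ge> 0\<close> by (cases "A x = 0") auto
  qed
  from factor_exists[OF defect_op_bop A U U this csub_DU _ \<open>M \<ge> 0\<close>]
  obtain N where N: "N \<in> bop DU U" "\<And>x. N (D x) = A x" by (auto simp: defect_space_def)
  have N': "adj N \<in> bop U DU" by (rule adj_bop[OF N(1) csub_DU U])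
  have "norm (adj N y) \<le> M * norm (D y)" if y: "y \<in> U" for y
  proof -
    have "cmod (cinner (adj N y) (adj N y)) \<le> M * norm (adj N y) * norm (D y)"
    proof (rule dense_le[OF DU_dense_image _ _ _ bop_range[OF N'],
          of "\<lambda>u. cmod (cinner u (adj N y))" "\<lambda>u. M * norm u * norm (D y)"])
      show "continuous_on UNIV (\<lambda>u. cmod (cinner u (adj N y)))"
        by (intro continuous_intros cinner.continuous_on)
      show "continuous_on UNIV (\<lambda>u. M * norm u * norm (D y))" by (intro continuous_intros)
      show "cmod (cinner u (adj N y)) \<le> M * norm u * norm (D y)" if "u \<in> blinfun_apply D ` U" for u
        using that le y by (auto simp: adj[OF N(1), symmetric] N(2))
    qed
    then have "norm (adj N y) * norm (adj N y) \<le> M * norm (adj N y) * norm (D y)"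
      by (simp add: cmod_cinner_self)
    then show ?thesis using \<open>M \<ge> 0\<close> by (cases "adj N y = 0") auto
  qed
  from factor_exists[OF defect_op_bop N' U csub_DU this csub_DU _ \<open>M \<ge> 0\<close>]
  obtain N2 where N2: "N2 \<in> bop DU DU" "\<And>x. N2 (D x) = adj N x" "norm N2 \<le> M"
    by (auto simp: defect_space_def)
  have "D (adj N2 (D x)) = A x" for x
  proof (rule cinner_eqI)
    show "cinner (D (adj N2 (D x))) w = cinner (A x) w" for w
      by (simp add: defect_op_hermitian adj'[OF N2(1)] N2(2) adj[OF N(1), symmetric] N(2))
  qed
  then show ?thesis
    using adj_bop[OF N2(1) csub_DU csub_DU] norm_adj_le[OF N2(1)] N2(3) by (intro bexI[of _ "adj N2"]) auto
qed

text \<open>The operator I + z \<Gamma>* E(z) inverted in the Schur step, with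
  \<open>proj DU\<close> as the identity of the defect space.\<close>

definition mob :: "complex \<Rightarrow> ('a \<Rightarrow>\<^sub>L 'b) \<Rightarrow> 'a \<Rightarrow>\<^sub>L 'a"
  where "mob z E = proj DU + (cmul z o\<^sub>L (Gs o\<^sub>L E))"

lemma mob_bop: "E \<in> bop DU DV \<Longrightarrow> mob z E \<in> bop DU DU"
  unfolding mob_def
  by (intro bop_add cmul_bop csub_DU proj_bop bop_compose_restrict[OF _ Gs]) (auto intro: Gs_DV)

lemma mob_apply: "u \<in> DU \<Longrightarrow> mob z E u = u + z *\<^sub>C Gs (E u)"
  by (simp add: mob_def blinfun.add_left cmul_apply proj_id csub_DU)

lemma norm_Gs_le: "norm (Gs y) \<le> norm y"
  by (rule contraction.norm_G_le[OF dual])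

text \<open>The perturbation z \<Gamma>* E has norm at most |z|, so the operator is accretive with
  constant 1 - |z|.\<close>

lemma mob_inverse_exists:
  assumes E: "E \<in> bop DU DV" "norm E \<le> 1" and z: "cmod z < 1"
  shows "\<exists>L\<in>bop DU DU. (\<forall>x\<in>DU. blinfun_apply L (mob z E x) = x \<and> mob z E (blinfun_apply L x) = x) \<and>
    norm L \<le> 1 / (1 - cmod z)"
proof (rule accretive_inverse_exists[OF csub_DU mob_bop[OF E(1)]])
  show "(1 - cmod z) * (norm u)\<^sup>2 \<le> Re (cinner (mob z E u) u)" if u: "u \<in> DU" for u
  proof -
    have "cmod (cinner (Gs (E u)) u) \<le> norm (Gs (E u)) * norm u" by (rule cmod_cinner_le)
    also have "\<dots> \<le> (1 * norm u) * norm u"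
      by (intro mult_right_mono order_trans[OF norm_Gs_le] order_trans[OF norm_blinfun] E) auto
    finally have "cmod z * cmod (cinner (Gs (E u)) u) \<le> cmod z * (norm u)\<^sup>2"
      by (intro mult_left_mono) (auto simp: power2_eq_square)
    then have "- (cmod z * (norm u)\<^sup>2) \<le> Re (z * cinner (Gs (E u)) u)"
      using abs_Re_le_cmod[of "z * cinner (Gs (E u)) u"] by (simp add: norm_mult)
    then show ?thesis
      by (simp add: mob_apply[OF u] cinner.add_left cinner_scaleC_left cinner_self algebra_simps)
  qed
qed (use z in auto)

lemma mob_bij:
  assumes "E \<in> bop DU DV" "norm E \<le> 1" "cmod z < 1"
  shows "bij_betw (\<lambda>u. u + z *\<^sub>C Gs (E u)) DU DU"
proof -
  obtain L where L: "L \<in> bop DU DU" "\<And>x. x \<in> DU \<Longrightarrow> L (mob z E x) = x" "\<And>x. x \<in> DU \<Longrightarrow> mob z E (L x) = x"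
    using mob_inverse_exists[OF assms] by blast
  have "bij_betw (mob z E) DU DU" by (rule bij_betw_byWitness[where f' = L])
      (auto simp: L bop_range[OF L(1)] bop_range[OF mob_bop[OF assms(1)]])
  then show ?thesis by (simp add: mob_apply cong: bij_betw_cong)
qed

lemma step_rel_iff:
  assumes E: "E \<in> schur_class DU DV"
  shows "step_rel U V G \<Theta> E \<longleftrightarrow> (\<forall>z\<in>ball 0 1. \<forall>x\<in>U. \<Theta> z x = G x + z *\<^sub>C Ds (E z
    (the_inv_into DU (\<lambda>u. u + z *\<^sub>C Gs (E z u)) (D x))))" unfolding step_rel_def
proof (intro ball_cong refl)
  fix z :: complex and x assume z: "z \<in> ball 0 1" and "x \<in> U"
  have bij: "bij_betw (\<lambda>u. u + z *\<^sub>C Gs (E z u)) DU DU"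
    using E z by (intro mob_bij) (auto simp: schur_class_iff)
  let ?u = "the_inv_into DU (\<lambda>u. u + z *\<^sub>C Gs (E z u)) (D x)"
  have inj: "inj_on (\<lambda>u. u + z *\<^sub>C Gs (E z u)) DU" using bij by (simp add: bij_betw_def)
  have u: "?u \<in> DU" "?u + z *\<^sub>C Gs (E z ?u) = D x" using bij defect_op_in[of x]
    by (auto simp: bij_betw_def intro!: the_inv_into_into f_the_inv_into_f[of "\<lambda>u. u + z *\<^sub>C Gs (E z u)"])
  have uniq: "u = ?u" if "u \<in> DU" "u = D x - z *\<^sub>C Gs (E z u)" for u
  proof (rule inj_onD[OF inj _ that(1) u(1)])
    have "u + z *\<^sub>C Gs (E z u) = D x" using that(2) by (simp only: eq_diff_eq)
    then show "u + z *\<^sub>C Gs (E z u) = ?u + z *\<^sub>C Gs (E z ?u)" by (simp only: u(2))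
  qed
  show "(\<exists>u\<in>DU. u = D x - z *\<^sub>C Gs (E z u) \<and> \<Theta> z x = G x + z *\<^sub>C Ds (E z u))
      \<longleftrightarrow> \<Theta> z x = G x + z *\<^sub>C Ds (E z ?u)"
    (is "?L \<longleftrightarrow> ?R")
  proof
    assume ?L
    then obtain v where v: "v \<in> DU" "v = D x - z *\<^sub>C Gs (E z v)" "\<Theta> z x = G x + z *\<^sub>C Ds (E z v)"
      by blast
    show ?R using v(3) unfolding uniq[OF v(1,2)] .
  next
    assume ?R
    moreover have "?u = D x - z *\<^sub>C Gs (E z ?u)" using u(2) by (simp only: eq_diff_eq)
    ultimately show ?L using u(1) by blast
  qed
qed

text \<open>Contractivity comes from the isometry of the rotation: |\<Theta>(z) x|^2 + |u|^2 = |x|^2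
  + |z E(z) u|^2, and the last term is at most |u|^2. Holomorphy follows from that of the inverse
  \<open>L\<close>, which is chosen separately at each point.\<close>

lemma step_forward:
  assumes E: "E \<in> schur_class DU DV"
  shows "\<exists>\<Theta>\<in>schur_class U V. \<Theta> 0 = G \<and> step_rel U V G \<Theta> E"
proof -
  have Eb: "E z \<in> bop DU DV" "norm (E z) \<le> 1" if "z \<in> ball 0 1" for z
    using E that by (auto simp: schur_class_iff)
  have Eh: "cholo E" using E by (simp add: schur_class_iff)
  have "\<forall>z\<in>ball 0 1. \<exists>L. L \<in> bop DU DU \<and>
      (\<forall>x\<in>DU. blinfun_apply L (mob z (E z) x) = x \<and> mob z (E z) (blinfun_apply L x) = x) \<and>
      norm L \<le> 1 / (1 - cmod z)" using mob_inverse_exists[OF Eb] by (simp add: Bex_def)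
  from bchoice[OF this] obtain L where "\<forall>z\<in>ball 0 1. L z \<in> bop DU DU \<and>
      (\<forall>x\<in>DU. L z (mob z (E z) x) = x \<and> mob z (E z) (L z x) = x) \<and> norm (L z) \<le> 1 / (1 - cmod z)" ..
  then have L: "\<And>z. z \<in> ball 0 1 \<Longrightarrow> L z \<in> bop DU DU"
    "\<And>z x. z \<in> ball 0 1 \<Longrightarrow> x \<in> DU \<Longrightarrow> L z (mob z (E z) x) = x"
    "\<And>z x. z \<in> ball 0 1 \<Longrightarrow> x \<in> DU \<Longrightarrow> mob z (E z) (L z x) = x"
    "\<And>z. z \<in> ball 0 1 \<Longrightarrow> norm (L z) \<le> 1 / (1 - cmod z)" by blast+
  have Lh: "cholo L"
  proof (rule cholo_inverse[OF csub_DU _ L(1,2,3)])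
    show "cholo (\<lambda>z. mob z (E z))" unfolding mob_def
      by (intro cholo_add cholo_const cholo_cmul_compose cholo_compose_left[OF Eh Gs])
    show "\<exists>M. \<forall>z\<in>ball 0 r. norm (L z) \<le> M" if "r < 1" for r
    proof (intro exI[of _ "1 / (1 - r)"] ballI)
      fix z :: complex assume "z \<in> ball 0 r"
      then have "norm (L z) \<le> 1 / (1 - cmod z)" "1 / (1 - cmod z) \<le> 1 / (1 - r)"
        using \<open>r < 1\<close> by (auto intro!: L(4) divide_left_mono)
      then show "norm (L z) \<le> 1 / (1 - r)" by linarith
    qed
  qed
  define \<Theta>0 where "\<Theta>0 z = G + (cmul z o\<^sub>L (Ds o\<^sub>L (E z o\<^sub>L (L z o\<^sub>L D))))" for z
  define \<Theta> where "\<Theta> = restrict \<Theta>0 (ball 0 1)"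
  have app: "\<Theta> z x = G x + z *\<^sub>C Ds (E z (L z (D x)))" if "z \<in> ball 0 1" for z x
    using that by (simp add: \<Theta>_def \<Theta>0_def blinfun.add_left cmul_apply)
  have u: "L z (D x) = D x - z *\<^sub>C Gs (E z (L z (D x)))" if z: "z \<in> ball 0 1" for z x
    using L(3)[OF z defect_op_in, of x] mob_apply[OF bop_range[OF L(1)[OF z]], of z "E z" "D x"]
    by (simp add: eq_diff_eq)
  have b: "\<Theta> z \<in> bop U V" if z: "z \<in> ball 0 1" for z
  proof -
    have "E z o\<^sub>L (L z o\<^sub>L D) \<in> bop U DV"
      by (intro bop_compose[OF Eb(1)[OF z]] bop_compose[OF L(1)[OF z]] defect_op_bop_DU)
    then have "Ds o\<^sub>L (E z o\<^sub>L (L z o\<^sub>L D)) \<in> bop U V"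
      by (rule bop_compose_restrict[OF _ defect_op_adj_bop]) (rule bop_range[OF defect_op_adj_bop])
    then show ?thesis
      using z by (simp add: \<Theta>_def \<Theta>0_def bop_add[OF V G] cmul_bop[OF V])
  qed
  have n: "norm (\<Theta> z) \<le> 1" if z: "z \<in> ball 0 1" for z
  proof (rule bop_norm_le[OF U b[OF z] closure_subset])
    fix x assume x: "x \<in> U"
    let ?u = "L z (D x)" and ?y = "E z (L z (D x))"
    have y: "z *\<^sub>C ?y \<in> V" using DV_subset bop_range[OF Eb(1)[OF z]] by (intro csub_scaleC V) blast
    have "(norm (\<Theta> z x))\<^sup>2 + (norm ?u)\<^sup>2 = (norm x)\<^sup>2 + (norm (z *\<^sub>C ?y))\<^sup>2"
      using rotation_isometry[OF x y] u[OF z, of x] app[OF z, of x]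
      by (simp add: bop_scaleC[OF defect_op_adj_bop] bop_scaleC[OF Gs])
    moreover have "(norm (z *\<^sub>C ?y))\<^sup>2 \<le> (norm ?u)\<^sup>2"
    proof (rule power_mono)
      have "norm (z *\<^sub>C ?y) \<le> 1 * (1 * norm ?u)" unfolding norm_scaleC using z Eb(2)[OF z]
        by (intro mult_mono order_trans[OF norm_blinfun] mult_right_mono) auto
      then show "norm (z *\<^sub>C ?y) \<le> norm ?u" by simp
    qed simp
    ultimately have "(norm (\<Theta> z x))\<^sup>2 \<le> (norm x)\<^sup>2" by linarith
    then show "norm (\<Theta> z x) \<le> 1 * norm x" using power2_le_imp_le[OF _ norm_ge_zero] by simp
  qed simp
  have "cholo \<Theta>0" unfolding \<Theta>0_def
  proof (intro cholo_add cholo_const cholo_cmul_compose cholo_compose_left[OF _ defect_op_adj_bop])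
    have "cholo (\<lambda>z. L z o\<^sub>L D)"
      by (rule cholo_compose[OF Lh cholo_const]) (rule bop_scaleC[OF L(1)])
    then show "cholo (\<lambda>z. E z o\<^sub>L (L z o\<^sub>L D))"
      by (rule cholo_compose[OF Eh]) (rule bop_scaleC[OF Eb(1)])
  qed
  then have "cholo \<Theta>" by (rule cholo_cong) (simp add: \<Theta>_def)
  then have "\<Theta> \<in> schur_class U V"
    using b n by (simp add: schur_class_iff) (simp add: \<Theta>_def)
  moreover have "\<Theta> 0 = G" by (rule blinfun_eqI) (simp add: app scaleC_zero_left)
  moreover have "step_rel U V G \<Theta> E"
    unfolding step_rel_def using u app bop_range[OF L(1)] by blast
  ultimately show ?thesis by blast
qed

section \<open>Solving the step for the next function\<close>

lemma caratheodory_form: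
  assumes \<Theta>: "\<Theta> \<in> schur_class U V" and "\<Theta> 0 = G" and z: "cmod z < 1" and x: "x \<in> U"
  shows "(1 - cmod z) * cmod (cinner (x - Gs (\<Theta> z x)) x) \<le> (1 + cmod z) * (norm (D x))\<^sup>2"
    and "(1 - (cmod z)\<^sup>2) / 4 * (norm (D x))\<^sup>2 \<le> Re (cinner (x - Gs (\<Theta> z x)) x)"
proof -
  define f where "f w = complex_of_real ((norm x)\<^sup>2) - cinner (\<Theta> w x) (G x)" for w
  have f: "f w = cinner (x - Gs (\<Theta> w x)) x" for w
    by (simp add: f_def cinner.diff_left cinner_self adj'[OF G])
  have hol: "f holomorphic_on ball 0 1"
    unfolding f_def using \<Theta> by (intro holomorphic_intros cholo_weak) (simp add: schur_class_iff)
  have f0: "f 0 = complex_of_real ((norm (D x))\<^sup>2)"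
    by (simp add: f_def assms(2) cinner_self norm_defect_op_sq[OF x])
  have re: "Re (f w) \<ge> 0" if "cmod w < 1" for w
  proof -
    have "Re (cinner (\<Theta> w x) (G x)) \<le> norm (\<Theta> w x) * norm (G x)"
      using complex_Re_le_cmod cmod_cinner_le order_trans by blast
    also have "\<dots> \<le> (1 * norm x) * norm x" using \<Theta> that
      by (intro mult_mono norm_G_le order_trans[OF norm_blinfun] mult_right_mono) (auto simp: schur_class_iff)
    finally show ?thesis by (simp add: f_def power2_eq_square)
  qed
  show "(1 - cmod z) * cmod (cinner (x - Gs (\<Theta> z x)) x) \<le> (1 + cmod z) * (norm (D x))\<^sup>2"
    "(1 - (cmod z)\<^sup>2) / 4 * (norm (D x))\<^sup>2 \<le> Re (cinner (x - Gs (\<Theta> z x)) x)"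
    using caratheodory[OF hol re f0 z] by (simp_all add: f)
qed

text \<open>\<open>K\<close> does not appear in the statement because
  \<open>K u = u - Gs (N u)\<close> on the defect space. Thus the first inequality compares
  \<open>N\<close> with \<open>K\<close>, and the second is the strict accretivity of
  \<open>K\<close>.\<close>

lemma pointwise_factors:
  assumes \<Theta>: "\<Theta> \<in> schur_class U V" and \<Theta>0: "\<Theta> 0 = G" and z: "cmod z < 1"
  shows "\<exists>N\<in>bop DU DV. norm N \<le> 2 * ((1 + cmod z) / (1 - cmod z)) \<and>
    (\<forall>x\<in>U. \<Theta> z x = G x + Ds (blinfun_apply N (D x))) \<and>
    (\<forall>u\<in>DU. norm (blinfun_apply N u) \<le> norm (u - Gs (blinfun_apply N u)) \<and>
      (1 - (cmod z)\<^sup>2) / 4 * (norm u)\<^sup>2 \<le> Re (cinner (u - Gs (blinfun_apply N u)) u))"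
proof -
  have \<Theta>b: "\<Theta> z \<in> bop U V" using \<Theta> z by (auto simp: schur_class_iff)
  define C where "C = (1 + cmod z) / (1 - cmod z)"
  have "C \<ge> 0" using z by (simp add: C_def)
  \<comment> \<open>Caratheodory's inequality gives the constant \<open>C\<close> for the quadratic
    form of this operator; polarization doubles it.\<close>
  define A where "A = proj U - (Gs o\<^sub>L \<Theta> z)"
  have A: "A \<in> bop U U"
    unfolding A_def by (intro bop_diff U proj_bop bop_compose[OF Gs \<Theta>b])
  have Ax: "A x = x - Gs (\<Theta> z x)" if "x \<in> U" for x
    using that by (simp add: A_def blinfun.diff_left proj_id U)
  have "cmod (cinner (A x) x) \<le> C * (norm (D x))\<^sup>2" if x: "x \<in> U" for x
    using caratheodory_form(1)[OF \<Theta> \<Theta>0 z x] z by (simp add: Ax[OF x] C_def field_simps)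
  then have "cmod (cinner (A x) y) \<le> (2 * C) * norm (D x) * norm (D y)" if "x \<in> U" "y \<in> U" for x y
    using that by (rule polarization_bound[OF U A defect_op_bop \<open>C \<ge> 0\<close>])
  from sandwich_exists[OF A _ this] obtain K where K: "K \<in> bop DU DU" "norm K \<le> 2 * C" "\<And>x. D (K (D x)) = A x"
    using \<open>C \<ge> 0\<close> by auto
  \<comment> \<open>The adjoint rotation inverts the rotation and so maps (\<Theta>(z) x, u) back to
    (x, z E(z) u). With \<open>K D x\<close> in the place of the internal state u, its second
    component is \<open>H x\<close>, which makes \<open>H\<close> the candidate for z E(z) u before
    \<open>E\<close> exists.\<close>
  define H where "H = (Ds o\<^sub>L \<Theta> z) - (G o\<^sub>L (K o\<^sub>L D))"
  have "K o\<^sub>L D \<in> bop U DU" by (rule bop_compose[OF K(1) defect_op_bop_DU])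
  then have H: "H \<in> bop U DV" unfolding H_def
    by (intro bop_diff csub_DV bop_compose[OF defect_op_adj_bop_DV \<Theta>b] bop_compose_restrict[OF _ G] G_DU)
  have Hx: "H x = Ds (\<Theta> z x) - G (K (D x))" for x by (simp add: H_def blinfun.diff_left)
  have HK: "norm (H x) \<le> norm (K (D x))" if x: "x \<in> U" for x
  proof -
    have k: "K (D x) \<in> U" using bop_range[OF K(1)] DU_subset by blast
    \<comment> \<open>The first component of the adjoint rotation is \<open>x\<close>, by the
      construction of \<open>K\<close>. As \<Theta>(z) is a contraction, the isometry leaves
      \<open>H x\<close> no larger than \<open>K D x\<close>.\<close>
    have "(norm (Gs (\<Theta> z x) + D (K (D x))))\<^sup>2 + (norm (H x))\<^sup>2 = (norm (\<Theta> z x))\<^sup>2 + (norm (K (D x)))\<^sup>2"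
      using contraction.rotation_isometry[OF dual bop_range[OF \<Theta>b] k, of x] by (simp add: Gs_Gs Hx)
    moreover have "Gs (\<Theta> z x) + D (K (D x)) = x" by (simp add: K(3) Ax[OF x])
    moreover have "(norm (\<Theta> z x))\<^sup>2 \<le> (norm x)\<^sup>2"
    proof (rule power_mono)
      have "norm (\<Theta> z) \<le> 1" using \<Theta> z by (auto simp: schur_class_iff)
      then show "norm (\<Theta> z x) \<le> norm x"
        using order_trans[OF norm_blinfun mult_right_mono[of "norm (\<Theta> z)" 1 "norm x"]] by simp
    qed simp
    ultimately have "(norm (H x))\<^sup>2 \<le> (norm (K (D x)))\<^sup>2"
      by (metis add_le_cancel_left add_right_mono)
    then show ?thesis using norm_ge_zero by (rule power2_le_imp_le)
  qed
  have "norm (H x) \<le> (2 * C) * norm (D x)" if x: "x \<in> U" for x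
    using HK[OF x] order_trans[OF norm_blinfun[of K "D x"] mult_right_mono[OF K(2)]] by simp
  from factor_exists[OF defect_op_bop H U csub_DV this csub_DU] obtain N where
    N: "N \<in> bop DU DV" "\<And>x. N (D x) = H x" "norm N \<le> 2 * C"
    using \<open>C \<ge> 0\<close> by (auto simp: defect_space_def)
  have \<Theta>N: "Ds (N (D x)) = \<Theta> z x - G x" if x: "x \<in> U" for x
  proof -
    have "Ds (N (D x)) = Ds (Ds (\<Theta> z x)) - G (D (K (D x)))"
      by (simp add: N(2) Hx blinfun.diff_right G_defect_op)
    also have "\<dots> = \<Theta> z x - G x"
      by (simp add: defect_op_adj_sq[OF bop_range[OF \<Theta>b]] K(3) Ax[OF x] blinfun.diff_right)
    finally show ?thesis .
  qed
  \<comment> \<open>\<open>D\<close> annihilates the difference of the two sides, which lies in the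
    defect space, where \<open>D\<close> is injective.\<close>
  have KN: "K (D x) = D x - Gs (N (D x))" if x: "x \<in> U" for x
  proof -
    define w where "w = K (D x) - (D x - Gs (N (D x)))"
    have "D w = 0"
      by (simp add: w_def blinfun.diff_right K(3) Ax[OF x] defect_op_sq[OF x] Gs_defect_op[symmetric] \<Theta>N[OF x])
    moreover have "w \<in> DU"
      unfolding w_def by (intro csub_diff csub_DU defect_op_in Gs_DV bop_range[OF K(1)] bop_range[OF N(1)])
    ultimately have "w = 0" by (rule defect_op_inj[rotated])
    then show ?thesis by (simp add: w_def)
  qed
  have c1: "continuous_on UNIV (\<lambda>u. norm (N u))" "continuous_on UNIV (\<lambda>u. norm (u - Gs (N u)))"
    "continuous_on UNIV (\<lambda>u. (1 - (cmod z)\<^sup>2) / 4 * (norm u)\<^sup>2)"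
    "continuous_on UNIV (\<lambda>u. Re (cinner (u - Gs (N u)) u))"
    by (intro continuous_intros cinner.continuous_on)+
  have "norm (N u) \<le> norm (u - Gs (N u))" if "u \<in> DU" for u
  proof (rule dense_le[OF DU_dense_image c1(1,2) _ that])
    fix a assume "a \<in> blinfun_apply D ` U"
    then obtain x where x: "x \<in> U" "a = D x" by blast
    show "norm (N a) \<le> norm (a - Gs (N a))"
      using HK[OF x(1)] KN[OF x(1)] by (simp add: x(2) N(2))
  qed
  moreover have "(1 - (cmod z)\<^sup>2) / 4 * (norm u)\<^sup>2 \<le> Re (cinner (u - Gs (N u)) u)" if "u \<in> DU" for u
  proof (rule dense_le[OF DU_dense_image c1(3,4) _ that])
    fix a assume "a \<in> blinfun_apply D ` U"
    then obtain x where x: "x \<in> U" "a = D x" by blast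
    have "cinner (a - Gs (N a)) a = cinner (x - Gs (\<Theta> z x)) x"
      by (simp add: x KN[OF x(1), symmetric] defect_op_hermitian[symmetric] K(3) Ax)
    then show "(1 - (cmod z)\<^sup>2) / 4 * (norm a)\<^sup>2 \<le> Re (cinner (a - Gs (N a)) a)"
      using caratheodory_form(2)[OF \<Theta> \<Theta>0 z x(1)] by (simp add: x(2))
  qed
  ultimately show ?thesis using N(1,3) \<Theta>N by (intro bexI[of _ N]) (auto simp: C_def)
qed

text \<open>\<open>N\<close> below is \<open>z E K\<close>; it is the factor \<open>N\<close>, unlike \<open>K\<close>, whose matrix elements on the dense
  ranges of \<open>D\<close> and \<open>D\<^sub>*\<close> are visibly holomorphic.\<close>

lemma step_backward:
  assumes \<Theta>: "\<Theta> \<in> schur_class U V" and \<Theta>0: "\<Theta> 0 = G"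
  shows "\<exists>E\<in>schur_class DU DV. step_rel U V G \<Theta> E"
proof -
  define c where "c z = (1 - (cmod z)\<^sup>2) / 4" for z
  have c: "c z > 0" if "cmod z < 1" for z
    using that by (simp add: c_def power_less_one_iff abs_square_less_1)
  define Q where "Q z T \<longleftrightarrow> T \<in> bop DU DV \<and> norm T \<le> 2 * ((1 + cmod z) / (1 - cmod z)) \<and>
    (\<forall>x\<in>U. \<Theta> z x = G x + Ds (T (D x))) \<and>
    (\<forall>u\<in>DU. norm (T u) \<le> norm (u - Gs (T u)) \<and> c z * (norm u)\<^sup>2 \<le> Re (cinner (u - Gs (T u)) u))"
    for z T
  have "\<forall>z\<in>ball 0 1. \<exists>T. Q z T"
    using pointwise_factors[OF \<Theta> \<Theta>0] unfolding c_def Q_def Bex_def by simp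
  from bchoice[OF this] obtain N where "\<forall>z\<in>ball 0 1. Q z (N z)" ..
  then have N: "\<And>z. cmod z < 1 \<Longrightarrow> N z \<in> bop DU DV"
    "\<And>z. cmod z < 1 \<Longrightarrow> norm (N z) \<le> 2 * ((1 + cmod z) / (1 - cmod z))"
    "\<And>z x. cmod z < 1 \<Longrightarrow> x \<in> U \<Longrightarrow> \<Theta> z x = G x + Ds (N z (D x))"
    "\<And>z u. cmod z < 1 \<Longrightarrow> u \<in> DU \<Longrightarrow> norm (N z u) \<le> norm (u - Gs (N z u))"
    "\<And>z u. cmod z < 1 \<Longrightarrow> u \<in> DU \<Longrightarrow> c z * (norm u)\<^sup>2 \<le> Re (cinner (u - Gs (N z u)) u)"
    by (simp_all add: Q_def)
  have Nh: "cholo N"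
  proof (rule cholo_of_weak[OF csub_DU csub_DV _ _ DU_dense_image DV_dense_image])
    show "N z \<in> bop DU DV" if "z \<in> ball 0 1" for z using that N(1) by simp
    show "\<exists>M. \<forall>z\<in>ball 0 r. norm (N z) \<le> M" if "r < 1" for r
    proof (intro exI[of _ "2 * ((1 + r) / (1 - r))"] ballI)
      fix z :: complex assume z: "z \<in> ball 0 r"
      have "r > 0" using z le_less_trans[OF norm_ge_zero, of z r] by simp
      then have "(1 + cmod z) / (1 - cmod z) \<le> (1 + r) / (1 - r)"
        using z that by (intro frac_le) auto
      moreover have "norm (N z) \<le> 2 * ((1 + cmod z) / (1 - cmod z))"
        by (rule N(2)) (use z that in auto)
      ultimately show "norm (N z) \<le> 2 * ((1 + r) / (1 - r))" by linarith
    qed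
    fix x' y' assume "x' \<in> blinfun_apply D ` U" "y' \<in> blinfun_apply Ds ` V"
    then obtain x y where xy: "x \<in> U" "x' = D x" "y' = Ds y" by blast
    \<comment> \<open>On the dense images, <N(z) D x, Ds y> = <(\<Theta>(z) - \<Gamma>) x,
      y>.\<close>
    have "(\<lambda>z. cinner (\<Theta> z x) y - cinner (G x) y) holomorphic_on ball 0 1"
      using \<Theta> by (intro holomorphic_intros cholo_weak) (simp add: schur_class_iff)
    then show "(\<lambda>z. cinner (N z x') y') holomorphic_on ball 0 1"
    proof (rule holomorphic_transform)
      show "cinner (\<Theta> z x) y - cinner (G x) y = cinner (N z x') y'" if "z \<in> ball 0 1" for z
        using that by (simp add: N(3) xy cinner.add_left defect_op_adj_hermitian[symmetric])
    qed
  qed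
  define K where "K z = proj DU - (Gs o\<^sub>L N z)" for z
  have Kb: "K z \<in> bop DU DU" if "cmod z < 1" for z unfolding K_def
    by (intro bop_diff csub_DU proj_bop bop_compose_restrict[OF N(1)[OF that] Gs] Gs_DV)
  have Ku: "K z u = u - Gs (N z u)" if "u \<in> DU" for z u
    using that by (simp add: K_def blinfun.diff_left proj_id csub_DU)
  have Kh: "cholo K" unfolding K_def by (intro cholo_diff cholo_const cholo_compose_left[OF Nh Gs])
  have "\<forall>z\<in>ball 0 1. \<exists>L. L \<in> bop DU DU \<and>
      (\<forall>x\<in>DU. blinfun_apply L (K z x) = x \<and> K z (blinfun_apply L x) = x) \<and> norm L \<le> 1 / c z"
  proof
    fix z :: complex assume "z \<in> ball 0 1"
    then have z: "cmod z < 1" by simp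
    show "\<exists>L. L \<in> bop DU DU \<and>
        (\<forall>x\<in>DU. blinfun_apply L (K z x) = x \<and> K z (blinfun_apply L x) = x) \<and> norm L \<le> 1 / c z"
      using accretive_inverse_exists[OF csub_DU Kb[OF z] c[OF z]] N(5)[OF z] by (simp add: Ku Bex_def)
  qed
  from bchoice[OF this] obtain L where "\<forall>z\<in>ball 0 1. L z \<in> bop DU DU \<and>
      (\<forall>x\<in>DU. L z (K z x) = x \<and> K z (L z x) = x) \<and> norm (L z) \<le> 1 / c z" ..
  then have L: "\<And>z. cmod z < 1 \<Longrightarrow> L z \<in> bop DU DU"
    "\<And>z x. cmod z < 1 \<Longrightarrow> x \<in> DU \<Longrightarrow> L z (K z x) = x"
    "\<And>z x. cmod z < 1 \<Longrightarrow> x \<in> DU \<Longrightarrow> K z (L z x) = x"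
    "\<And>z. cmod z < 1 \<Longrightarrow> norm (L z) \<le> 1 / c z" by simp_all
  have Lh: "cholo L"
  proof (rule cholo_inverse[OF csub_DU Kh])
    show "\<exists>M. \<forall>z\<in>ball 0 r. norm (L z) \<le> M" if "r < 1" for r
    proof (intro exI[of _ "1 / ((1 - r\<^sup>2) / 4)"] ballI)
      fix z :: complex assume z: "z \<in> ball 0 r"
      then have "r > 0" using le_less_trans[OF norm_ge_zero, of z r] by simp
      have "(cmod z)\<^sup>2 \<le> r\<^sup>2" using z by (intro power_mono) auto
      then have "1 / c z \<le> 1 / ((1 - r\<^sup>2) / 4)"
        using \<open>r > 0\<close> \<open>r < 1\<close> c[of z] z unfolding c_def
        by (intro divide_left_mono divide_right_mono mult_pos_pos) (auto simp: power_less_one_iff)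
      then show "norm (L z) \<le> 1 / ((1 - r\<^sup>2) / 4)"
        using L(4)[of z] z \<open>r < 1\<close> by simp
    qed
  qed (use L in auto)
  define W where "W z = N z o\<^sub>L L z" for z
  have Wb: "W z \<in> bop DU DV" if "cmod z < 1" for z
    unfolding W_def by (rule bop_compose[OF N(1) L(1)]) (use that in auto)
  \<comment> \<open>The norm of N L u is at most that of K L u, and K L u = u.\<close>
  have W1: "norm (W z) \<le> 1" if z: "cmod z < 1" for z
  proof (rule bop_norm_le[OF csub_DU Wb[OF z] closure_subset])
    show "norm (W z u) \<le> 1 * norm u" if u: "u \<in> DU" for u
      using N(4)[OF z bop_range[OF L(1)[OF z]], of u] Ku[OF bop_range[OF L(1)[OF z]], of z u] L(3)[OF z u]
      by (simp add: W_def)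
  qed simp
  \<comment> \<open>From \<Theta>(0) = \<Gamma> one has Ds N(0) D = 0; injectivity of
    \<open>Ds\<close> and density of the range of \<open>D\<close> remove both factors. This zero is
    what permits the division of \<open>W\<close> by z.\<close>
  have "N 0 = 0"
  proof (rule bop_ext[OF csub_DU _ bop_0[OF csub_DV] DU_dense_image])
    show "N 0 \<in> bop DU DV" by (rule N(1)) simp
    fix a assume "a \<in> blinfun_apply D ` U"
    then obtain x where x: "x \<in> U" "a = D x" by blast
    have "Ds (N 0 a) = 0" using N(3)[of 0 x] x \<Theta>0 by simp
    then show "N 0 a = blinfun_apply 0 a"
      using defect_op_adj_inj[OF bop_range[OF N(1)], of 0 a] by simp
  qed
  then have "W 0 = 0" by (simp add: W_def)
  have Wh: "cholo W"
    unfolding W_def by (rule cholo_compose[OF Nh Lh]) (simp add: bop_scaleC[OF N(1)])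
  have "\<exists>E\<in>schur_class DU DV. \<forall>z\<in>ball 0 1. W z = cmul z o\<^sub>L E z"
    by (rule schur_class_divide[OF csub_DU csub_DV Wh _ _ \<open>W 0 = 0\<close>]) (auto intro: Wb W1)
  then obtain E where E: "E \<in> schur_class DU DV" "\<And>z. z \<in> ball 0 1 \<Longrightarrow> W z = cmul z o\<^sub>L E z"
    by blast
  have "step_rel U V G \<Theta> E" unfolding step_rel_def
  proof (intro ballI)
    fix z :: complex and x assume z: "z \<in> ball 0 1" and x: "x \<in> U"
    have z1: "cmod z < 1" using z by simp
    define u where "u = K z (D x)"
    have "u \<in> DU" unfolding u_def by (rule bop_range[OF Kb[OF z1]])
    have zE: "z *\<^sub>C E z u = N z (D x)"
      using arg_cong[OF E(2)[OF z], of "\<lambda>T. T u"] L(2)[OF z1 defect_op_in, of x]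
      by (simp add: W_def cmul_apply u_def)
    have "u = D x - z *\<^sub>C Gs (E z u)"
      unfolding bop_scaleC[OF Gs, symmetric] zE by (simp add: u_def Ku defect_op_in)
    moreover have "\<Theta> z x = G x + z *\<^sub>C Ds (E z u)"
      unfolding bop_scaleC[OF defect_op_adj_bop, symmetric] zE by (rule N(3)[OF z1 x])
    ultimately show "\<exists>u\<in>DU. u = D x - z *\<^sub>C Gs (E z u) \<and> \<Theta> z x = G x + z *\<^sub>C Ds (E z u)"
      using \<open>u \<in> DU\<close> by blast
  qed
  then show ?thesis using E(1) by blast
qed

text \<open>For z not 0, equal values of \<Theta>(z) x and injectivity of \<open>Ds\<close> give
  E(z) u = F(z) v. The equations of the internal states then give u = v, so \<open>E z\<close> and
  \<open>F z\<close> agree at all states. At 0 they agree by continuity.\<close>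

lemma step_rel_inj:
  assumes E: "E \<in> schur_class DU DV" "F \<in> schur_class DU DV"
    and rel: "step_rel U V G \<Theta> E" "step_rel U V G \<Theta> F"
  shows "E = F"
proof -
  have b: "E z \<in> bop DU DV" "norm (E z) \<le> 1" "F z \<in> bop DU DV" if "z \<in> ball 0 1" for z
    using E that by (auto simp: schur_class_iff)
  have eq: "E z = F z" if z: "z \<in> ball 0 1" "z \<noteq> 0" for z
  proof -
    define S where "S = {u \<in> DU. E z u = F z u}"
    obtain L where L: "L \<in> bop DU DU" "\<And>x. x \<in> DU \<Longrightarrow> L (mob z (E z) x) = x"
      using mob_inverse_exists[OF b(1,2)[OF z(1)], of z] z(1) by auto
    have LS: "L (D x) \<in> S" if x: "x \<in> U" for x
    proof -
      obtain u where u: "u \<in> DU" "u = D x - z *\<^sub>C Gs (E z u)" "\<Theta> z x = G x + z *\<^sub>C Ds (E z u)"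
        using rel(1) z(1) x unfolding step_rel_def by blast
      obtain v where v: "v \<in> DU" "v = D x - z *\<^sub>C Gs (F z v)" "\<Theta> z x = G x + z *\<^sub>C Ds (F z v)"
        using rel(2) z(1) x unfolding step_rel_def by blast
      have "z *\<^sub>C Ds (E z u) = z *\<^sub>C Ds (F z v)" using u(3) v(3) by simp
      then have "(1 / z) *\<^sub>C z *\<^sub>C Ds (E z u) = (1 / z) *\<^sub>C z *\<^sub>C Ds (F z v)" by simp
      then have "Ds (E z u - F z v) = 0"
        using z(2) by (simp add: scaleC_scaleC scaleC_one blinfun.diff_right)
      then have EF: "E z u = F z v"
        using defect_op_adj_inj[of "E z u - F z v"] csub_diff[OF csub_DV] bop_range[OF b(1)[OF z(1)]]
          bop_range[OF b(3)[OF z(1)]] by simp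
      have "u = D x - z *\<^sub>C Gs (E z u)" by (rule u(2))
      also have "\<dots> = D x - z *\<^sub>C Gs (F z v)" by (simp only: EF)
      also have "\<dots> = v" by (rule v(2)[symmetric])
      finally have "u = v" .
      have "mob z (E z) u = D x" using u(2) by (simp only: mob_apply[OF u(1)] eq_diff_eq)
      then have "L (D x) = u" using L(2)[OF u(1)] by (simp only:)
      then show ?thesis using EF \<open>u = v\<close> u(1) by (simp add: S_def)
    qed
    \<comment> \<open>The bounded inverse \<open>L\<close> carries the dense image of
      \<open>D\<close> to a dense set of states: approximate (I + z \<Gamma>* E(z)) w by vectors D x
      and apply \<open>L\<close>.\<close>
    have "DU \<subseteq> closure S"
    proof
      fix w assume w: "w \<in> DU"
      obtain a where a: "\<And>n. a n \<in> blinfun_apply D ` U" "a \<longlonglongrightarrow> mob z (E z) w"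
        using subsetD[OF DU_dense_image bop_range[OF mob_bop[OF b(1)[OF z(1)]]]]
        by (rule closure_sequenceE) blast
      have "(\<lambda>n. L (a n)) \<longlonglongrightarrow> L (mob z (E z) w)" by (intro tendsto_intros a)
      then have lim: "(\<lambda>n. L (a n)) \<longlonglongrightarrow> w" by (simp add: L(2)[OF w])
      have "L (a n) \<in> S" for n using a(1)[of n] LS by auto
      then show "w \<in> closure S" using lim by (rule closure_sequenceI)
    qed
    then show ?thesis
      by (intro bop_ext[OF csub_DU b(1)[OF z(1)] b(3)[OF z(1)], of S]) (auto simp: S_def)
  qed
  have lim: "(E \<longlongrightarrow> E 0) (at 0)" "(F \<longlongrightarrow> F 0) (at 0)"
    using E by (auto intro: cholo_tendsto simp: schur_class_iff)
  have "\<forall>\<^sub>F z in at 0. E z = F z"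
    unfolding eventually_at by (intro exI[of _ 1]) (auto intro: eq)
  then have "(F \<longlongrightarrow> E 0) (at 0)"
    using lim(1) by (rule Lim_transform_eventually[rotated])
  then have "E 0 = F 0" using lim(2) tendsto_unique[of "at (0::complex)" F] by auto
  then have "E z = F z" if "z \<in> ball 0 1" for z using eq[OF that] by (cases "z = 0") auto
  then show ?thesis
    using E by (intro extensionalityI[of E "ball 0 1" F]) (auto simp: schur_class_iff)
qed

lemma schur_next_eqI:
  assumes "\<Theta> 0 = G" and E: "E \<in> schur_class DU DV" "step_rel U V G \<Theta> E"
  shows "schur_next U V \<Theta> = E"
  unfolding schur_next_def assms(1) Let_def
proof (rule the_equality)
  show "E' = E" if "E' \<in> schur_class DU DV \<and> (\<forall>z\<in>ball 0 1. \<forall>x\<in>U. \<Theta> z x = G x + z *\<^sub>C Ds (E' z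
    (the_inv_into DU (\<lambda>u. u + z *\<^sub>C Gs (E' z u)) (D x))))" for E'
  proof (rule step_rel_inj[OF _ E(1) _ E(2)])
    show E': "E' \<in> schur_class DU DV" using that ..
    show "step_rel U V G \<Theta> E'" unfolding step_rel_iff[OF E'] using that ..
  qed
qed (intro conjI E(1) E(2)[unfolded step_rel_iff[OF E(1)]])

end

section \<open>Chains of Schur functions\<close>

lemma
  fixes \<Gamma> :: "nat \<Rightarrow> 'a::complex_hilbert \<Rightarrow>\<^sub>L 'b::complex_hilbert"
  assumes "choice_sequence_upto m \<Gamma>"
  shows choice_contraction: "k \<le> m \<Longrightarrow> contraction (dspace \<Gamma> k) (dspace_adj \<Gamma> k) (\<Gamma> k)"
    and csub_dspace: "k \<le> Suc m \<Longrightarrow> csub (dspace \<Gamma> k)"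
    and csub_dspace_adj: "k \<le> Suc m \<Longrightarrow> csub (dspace_adj \<Gamma> k)"
proof -
  have con: "contraction (dspace \<Gamma> k) (dspace_adj \<Gamma> k) (\<Gamma> k)"
    if "k \<le> m" "csub (dspace \<Gamma> k)" "csub (dspace_adj \<Gamma> k)" for k
    using assms that by unfold_locales (auto simp: choice_sequence_upto_def)
  \<comment> \<open>The two claims depend on each other: a parameter is a contraction between closed
    subspaces only once its two spaces are known to be such, and this makes its defect spaces closed
    subspaces in turn.\<close>
  have sub: "csub (dspace \<Gamma> k) \<and> csub (dspace_adj \<Gamma> k)" if "k \<le> Suc m" for k
    using that
  proof (induction k)
    case (Suc k)
    then have "contraction (dspace \<Gamma> k) (dspace_adj \<Gamma> k) (\<Gamma> k)" by (intro con) auto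
    then show ?case using contraction.csub_DU contraction.csub_DV by auto
  qed (simp add: csub_UNIV)
  show "contraction (dspace \<Gamma> k) (dspace_adj \<Gamma> k) (\<Gamma> k)" if "k \<le> m"
    using con[OF that] sub[of k] that by simp
  show "csub (dspace \<Gamma> k)" "csub (dspace_adj \<Gamma> k)" if "k \<le> Suc m"
    using sub[OF that] by auto
qed

text \<open>The parameters 0, ..., m are prescribed, but a chain has one more function: the last, of
  index m + 1, is free and plays the role of the parameter function of the correspondence.\<close>

definition schur_chain ::
    "nat \<Rightarrow> (nat \<Rightarrow> 'a::complex_inner \<Rightarrow>\<^sub>L 'b::complex_inner) \<Rightarrow> (nat \<Rightarrow> complex \<Rightarrow> 'a \<Rightarrow>\<^sub>L 'b) \<Rightarrow> bool"
  where "schur_chain m \<Gamma> \<Theta> \<longleftrightarrow>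
    (\<forall>k\<le>Suc m. \<Theta> k \<in> schur_class (dspace \<Gamma> k) (dspace_adj \<Gamma> k)) \<and>
    (\<forall>k\<le>m. \<Theta> k 0 = \<Gamma> k \<and> step_rel (dspace \<Gamma> k) (dspace_adj \<Gamma> k) (\<Gamma> k) (\<Theta> k) (\<Theta> (Suc k)))"

lemma schur_chain_exists:
  fixes \<Gamma> :: "nat \<Rightarrow> 'a::complex_hilbert \<Rightarrow>\<^sub>L 'b::complex_hilbert"
  assumes "choice_sequence_upto m \<Gamma>" "E \<in> schur_class (dspace \<Gamma> (Suc m)) (dspace_adj \<Gamma> (Suc m))"
  shows "\<exists>\<Theta>. schur_chain m \<Gamma> \<Theta> \<and> \<Theta> (Suc m) = E"
  using assms
proof (induction m arbitrary: E rule: less_induct)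
  case (less m)
  interpret contraction "dspace \<Gamma> m" "dspace_adj \<Gamma> m" "\<Gamma> m"
    using less.prems by (intro choice_contraction) auto
  obtain F where F: "F \<in> schur_class (dspace \<Gamma> m) (dspace_adj \<Gamma> m)" "F 0 = \<Gamma> m"
    "step_rel (dspace \<Gamma> m) (dspace_adj \<Gamma> m) (\<Gamma> m) F E"
    using step_forward[of E] less.prems by auto
  \<comment> \<open>The chain is built from its end downwards. The guarded conjunct covers m = 0,
    where no earlier steps remain.\<close>
  have "\<exists>\<Theta>. \<Theta> m = F \<and> (\<forall>i. m = Suc i \<longrightarrow> schur_chain i \<Gamma> \<Theta>)"
  proof (cases m)
    case (Suc i)
    have "choice_sequence_upto i \<Gamma>" using less.prems Suc by (simp add: choice_sequence_upto_def)
    then show ?thesis using less.IH[of i F] F(1) Suc by auto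
  qed auto
  then obtain \<Theta> where \<Theta>: "\<Theta> m = F" "\<And>i. m = Suc i \<Longrightarrow> schur_chain i \<Gamma> \<Theta>" by blast
  define \<Psi> where "\<Psi> = fun_upd \<Theta> (Suc m) E"
  have "schur_chain m \<Gamma> \<Psi>"
    using F \<Theta> less.prems(2) unfolding schur_chain_def \<Psi>_def
    by (cases m) (auto simp: le_Suc_eq simp del: dspace.simps)
  moreover have "\<Psi> (Suc m) = E" by (simp add: \<Psi>_def)
  ultimately show ?case by blast
qed

text \<open>Uniqueness of each step identifies the chain with the output of the Schur algorithm; in
  particular the first function determines all later ones.\<close>

lemma schur_chain_iterate:
  fixes \<Gamma> :: "nat \<Rightarrow> 'a::complex_hilbert \<Rightarrow>\<^sub>L 'b::complex_hilbert"
  assumes ch: "choice_sequence_upto m \<Gamma>" "schur_chain m \<Gamma> \<Theta>" and "k \<le> Suc m"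
  shows "(schur_step ^^ k) (UNIV, UNIV, \<Theta> 0) = (dspace \<Gamma> k, dspace_adj \<Gamma> k, \<Theta> k)"
  using assms(3)
proof (induction k)
  case (Suc k)
  interpret contraction "dspace \<Gamma> k" "dspace_adj \<Gamma> k" "\<Gamma> k"
    using ch Suc.prems by (intro choice_contraction) auto
  have "schur_next (dspace \<Gamma> k) (dspace_adj \<Gamma> k) (\<Theta> k) = \<Theta> (Suc k)"
    using ch(2) Suc.prems by (intro schur_next_eqI) (auto simp: schur_chain_def)
  then show ?case using Suc ch(2) by (simp add: schur_chain_def)
qed simp

lemma schur_chain_of_params:
  fixes \<Gamma> :: "nat \<Rightarrow> 'a::complex_hilbert \<Rightarrow>\<^sub>L 'b::complex_hilbert"
  assumes ch: "choice_sequence_upto m \<Gamma>" and \<Theta>: "\<Theta> \<in> schur_class UNIV UNIV"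
    and par: "\<And>k. k \<le> m \<Longrightarrow> schur_param UNIV UNIV \<Theta> k = \<Gamma> k"
  shows "\<exists>\<Psi>. schur_chain m \<Gamma> \<Psi> \<and> \<Psi> 0 = \<Theta>"
proof -
  define \<Psi> where "\<Psi> k = snd (snd ((schur_step ^^ k) (UNIV, UNIV, \<Theta>)))" for k
  have \<Psi>0: "\<Psi> k 0 = \<Gamma> k" if "k \<le> m" for k
    using par[OF that] by (simp add: schur_param_def \<Psi>_def split_beta)
  \<comment> \<open>The second conjunct is what solvability of the next step requires, since
    \<open>schur_next\<close> is a definite description about which nothing is known
    beforehand.\<close>
  define A where "A k \<longleftrightarrow> (schur_step ^^ k) (UNIV, UNIV, \<Theta>) = (dspace \<Gamma> k, dspace_adj \<Gamma> k, \<Psi> k) \<and>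
    \<Psi> k \<in> schur_class (dspace \<Gamma> k) (dspace_adj \<Gamma> k)" for k
  have step: "A (Suc k)" "step_rel (dspace \<Gamma> k) (dspace_adj \<Gamma> k) (\<Gamma> k) (\<Psi> k) (\<Psi> (Suc k))"
    if k: "k \<le> m" and Ak: "A k" for k
  proof -
    interpret contraction "dspace \<Gamma> k" "dspace_adj \<Gamma> k" "\<Gamma> k"
      using ch k by (rule choice_contraction)
    obtain E where E: "E \<in> schur_class DU DV" "step_rel (dspace \<Gamma> k) (dspace_adj \<Gamma> k) (\<Gamma> k) (\<Psi> k) E"
      using step_backward[of "\<Psi> k"] Ak \<Psi>0[OF k] by (auto simp: A_def)
    have "schur_next (dspace \<Gamma> k) (dspace_adj \<Gamma> k) (\<Psi> k) = E"
      using \<Psi>0[OF k] E by (rule schur_next_eqI)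
    then have st: "(schur_step ^^ Suc k) (UNIV, UNIV, \<Theta>) = (dspace \<Gamma> (Suc k), dspace_adj \<Gamma> (Suc k), E)"
      using Ak \<Psi>0[OF k] by (simp add: A_def)
    then have "\<Psi> (Suc k) = E" by (simp only: \<Psi>_def snd_conv)
    then show "A (Suc k)" "step_rel (dspace \<Gamma> k) (dspace_adj \<Gamma> k) (\<Gamma> k) (\<Psi> k) (\<Psi> (Suc k))"
      using st E by (simp_all add: A_def)
  qed
  have A: "A k" if "k \<le> Suc m" for k
    using that by (induction k) (use \<Theta> in \<open>simp_all add: A_def[of 0] \<Psi>_def[of 0] step(1)\<close>)
  have "schur_chain m \<Gamma> \<Psi>" using A step(2) \<Psi>0 by (simp add: schur_chain_def A_def)
  then show ?thesis by (intro exI[of _ \<Psi>]) (simp add: \<Psi>_def)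
qed

section \<open>The truncated block operator\<close>

locale choice_seq =
  fixes \<Gamma> :: "nat \<Rightarrow> 'a::complex_hilbert \<Rightarrow>\<^sub>L 'b::complex_hilbert" and n :: nat
  assumes choice: "choice_sequence_upto (2 * n) \<Gamma>"
begin

abbreviation dom where "dom \<equiv> dspace \<Gamma>"
abbreviation cod where "cod \<equiv> dspace_adj \<Gamma>"
abbreviation Sh where "Sh \<equiv> Shat n \<Gamma>"
abbreviation Kh where "Kh \<equiv> Khat n \<Gamma>"

lemma contraction_at: "k \<le> 2 * n \<Longrightarrow> contraction (dom k) (cod k) (\<Gamma> k)"
  using choice by (rule choice_contraction)

lemma csub_dspaces: "k \<le> 2 * n + 1 \<Longrightarrow> csub (dom k)" "k \<le> 2 * n + 1 \<Longrightarrow> csub (cod k)"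
  using csub_dspace[OF choice] csub_dspace_adj[OF choice] by auto

lemma rotation_eq: "rotation \<Gamma> k p =
    (\<Gamma> k (fst p) + dop_adj \<Gamma> k (snd p), dop \<Gamma> k (fst p) - adj (\<Gamma> k) (snd p))"
  by (cases p) simp

lemma rotation_add: "rotation \<Gamma> k (p + p') = rotation \<Gamma> k p + rotation \<Gamma> k p'"
  by (simp add: rotation_eq dop_def blinfun.add_right)

lemma rotation_scaleC:
  assumes "k \<le> 2 * n"
  shows "rotation \<Gamma> k (c *\<^sub>C p) = c *\<^sub>C rotation \<Gamma> k p"
proof -
  interpret contraction "dom k" "cod k" "\<Gamma> k" using assms by (rule contraction_at)
  show ?thesis by (simp add: rotation_eq dop_def scaleC_prod_def bop_scaleC[OF G] bop_scaleC[OF Gs]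
        bop_scaleC[OF defect_op_bop] bop_scaleC[OF defect_op_adj_bop] scaleC_add_right scaleC_diff_right)
qed

lemma rotation_tendsto: "(p \<longlongrightarrow> p') F \<Longrightarrow> ((\<lambda>i. rotation \<Gamma> k (p i)) \<longlongrightarrow> rotation \<Gamma> k p') F"
  unfolding rotation_eq dop_def by (intro tendsto_intros)

lemma
  assumes "k \<le> 2 * n" "fst p \<in> dom k" "snd p \<in> cod (Suc k)"
  shows fst_rotation: "fst (rotation \<Gamma> k p) \<in> cod k"
    and snd_rotation: "snd (rotation \<Gamma> k p) \<in> dom (Suc k)"
    and norm_rotation: "(norm (rotation \<Gamma> k p))\<^sup>2 = (norm p)\<^sup>2"
proof -
  interpret contraction "dom k" "cod k" "\<Gamma> k" using assms(1) by (rule contraction_at)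
  show "fst (rotation \<Gamma> k p) \<in> cod k"
    by (simp add: rotation_eq dop_def csub_add[OF V] bop_range[OF G] bop_range[OF defect_op_adj_bop])
  show "snd (rotation \<Gamma> k p) \<in> dom (Suc k)"
    using assms(3) by (simp add: rotation_eq dop_def csub_diff[OF csub_DU] defect_op_in Gs_DV)
  have "snd p \<in> cod k" using assms(3) DV_subset by auto
  then show "(norm (rotation \<Gamma> k p))\<^sup>2 = (norm p)\<^sup>2"
    using rotation_isometry[OF assms(2)] by (cases p) (simp add: rotation_eq dop_def norm_Pair)
qed

lemma Khat_iff: "f \<in> Kh \<longleftrightarrow>
    (\<forall>j\<le>n. fst (f (Suc j)) \<in> dom (2 * j) \<and> snd (f (Suc j)) \<in> cod (Suc (2 * j))) \<and>
    (\<forall>k. k \<notin> {1..n + 1} \<longrightarrow> f k = 0)"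
proof -
  have *: "f (Suc j) \<in> Hhat \<Gamma> (Suc j) \<longleftrightarrow>
      fst (f (Suc j)) \<in> dom (2 * j) \<and> snd (f (Suc j)) \<in> cod (Suc (2 * j))" for j
    by (simp add: Hhat_def mem_Times_iff)
  have "(\<forall>k\<in>{1..n + 1}. f k \<in> Hhat \<Gamma> k) \<longleftrightarrow> (\<forall>j\<le>n. f (Suc j) \<in> Hhat \<Gamma> (Suc j))"
  proof safe
    fix k assume "\<forall>j\<le>n. f (Suc j) \<in> Hhat \<Gamma> (Suc j)" "k \<in> {1..n + 1}"
    then show "f k \<in> Hhat \<Gamma> k" by (cases k) auto
  qed auto
  then show ?thesis unfolding Khat_def * [symmetric] by auto
qed

lemma Khat_mem:
  assumes "f \<in> Kh"
  shows "j \<le> n \<Longrightarrow> fst (f (Suc j)) \<in> dom (2 * j)"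
    and "j \<le> n \<Longrightarrow> snd (f (Suc j)) \<in> cod (Suc (2 * j))"
    and "k \<notin> {1..n + 1} \<Longrightarrow> f k = 0"
  using assms by (auto simp: Khat_iff simp del: dspace.simps)

lemma Khat_add: "f \<in> Kh \<Longrightarrow> g \<in> Kh \<Longrightarrow> (\<lambda>k. f k + g k) \<in> Kh"
  by (auto simp: Khat_iff simp del: dspace.simps intro!: csub_add csub_dspaces)

lemma Khat_scaleC: "f \<in> Kh \<Longrightarrow> (\<lambda>k. c *\<^sub>C f k) \<in> Kh"
  by (auto simp: Khat_iff scaleC_prod_def scaleC_zero_right zero_prod_def simp del: dspace.simps
      intro!: csub_scaleC csub_dspaces)

lemma Khat_zero: "(\<lambda>_. 0) \<in> Kh"
  by (auto simp: Khat_iff simp del: dspace.simps intro!: csub_zero csub_dspaces)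

text \<open>For \<open>j \<le> n\<close> and \<open>i < n\<close>, \<open>rrot f j\<close> and \<open>lrot f i\<close> are the outputs of the rotations of index \<open>2 j\<close> and
  \<open>2 i + 1\<close>; blocks are indexed from \<open>0\<close> here, so that no truncated subtraction occurs.\<close>

definition rrot :: "(nat \<Rightarrow> 'a \<times> 'b) \<Rightarrow> nat \<Rightarrow> 'b \<times> 'a"
  where "rrot f j = rotation \<Gamma> (2 * j) (f (Suc j))"

definition lrot :: "(nat \<Rightarrow> 'a \<times> 'b) \<Rightarrow> nat \<Rightarrow> 'b \<times> 'a"
  where "lrot f i = rotation \<Gamma> (Suc (2 * i)) (snd (rrot f i), fst (rrot f (Suc i)))"

lemma Shat_Suc:
  assumes "j \<le> n"
  shows "Sh f (Suc j) =
    (if j = 0 then 0 else snd (lrot f (j - 1)), if j = n then 0 else fst (lrot f j))"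
proof -
  have rrot: "right_factor n \<Gamma> f (Suc i) = rrot f i" if "i \<le> n" for i
    using that by (simp add: right_factor_def rrot_def)
  have "snd (rotation \<Gamma> (2 * Suc j - 3) (snd (right_factor n \<Gamma> f (Suc j - 1)), fst (right_factor n \<Gamma> f (Suc j))))
      = snd (lrot f (j - 1))" if "j \<noteq> 0"
  proof -
    from \<open>j \<noteq> 0\<close> obtain i where j: "j = Suc i" by (cases j) auto
    have "2 * Suc j - 3 = Suc (2 * i)" "Suc j - 1 = Suc i" by (simp_all add: j)
    then show ?thesis using assms rrot[of i] rrot[of j] by (simp add: lrot_def j del: rotation.simps)
  qed
  moreover have "fst (rotation \<Gamma> (2 * Suc j - 1) (snd (right_factor n \<Gamma> f (Suc j)), fst (right_factor n \<Gamma> f (Suc j + 1))))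
      = fst (lrot f j)" if "j \<noteq> n"
    using that assms rrot[of j] rrot[of "Suc j"] by (simp add: lrot_def del: rotation.simps)
  ultimately show ?thesis using assms unfolding Shat_def left_factor_def
    by (cases "j = 0"; cases "j = n"; simp del: rotation.simps)
qed

lemma Shat_outside: "k \<notin> {1..n + 1} \<Longrightarrow> Sh f k = 0"
  by (auto simp: Shat_def left_factor_def)

lemma nat_cases_Khat: "(\<And>j. j \<le> n \<Longrightarrow> P (Suc j)) \<Longrightarrow> (k \<notin> {1..n + 1} \<Longrightarrow> P k) \<Longrightarrow> P k"
  by (cases k) auto

lemma rrot_mem:
  assumes "f \<in> Kh" "j \<le> n"
  shows "fst (rrot f j) \<in> cod (2 * j)" "snd (rrot f j) \<in> dom (Suc (2 * j))"
    "(norm (rrot f j))\<^sup>2 = (norm (f (Suc j)))\<^sup>2" unfolding rrot_def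
  using fst_rotation[OF _ Khat_mem(1,2)[OF assms]] snd_rotation[OF _ Khat_mem(1,2)[OF assms]]
    norm_rotation[OF _ Khat_mem(1,2)[OF assms]] assms(2) by auto

lemma lrot_mem:
  assumes f: "f \<in> Kh" and i: "i < n"
  shows "fst (lrot f i) \<in> cod (Suc (2 * i))" "snd (lrot f i) \<in> dom (2 * Suc i)"
    "(norm (lrot f i))\<^sup>2 = (norm (snd (rrot f i)))\<^sup>2 + (norm (fst (rrot f (Suc i))))\<^sup>2"
proof -
  have m: "Suc (2 * i) \<le> 2 * n" "snd (rrot f i) \<in> dom (Suc (2 * i))"
    "fst (rrot f (Suc i)) \<in> cod (Suc (Suc (2 * i)))"
    using rrot_mem[OF f, of i] rrot_mem[OF f, of "Suc i"] i by auto
  show "fst (lrot f i) \<in> cod (Suc (2 * i))"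
    unfolding lrot_def using m by (intro fst_rotation) auto
  show "snd (lrot f i) \<in> dom (2 * Suc i)"
    using snd_rotation[of "Suc (2 * i)" "(snd (rrot f i), fst (rrot f (Suc i)))"] m
    by (simp add: lrot_def del: dspace.simps rotation.simps)
  show "(norm (lrot f i))\<^sup>2 = (norm (snd (rrot f i)))\<^sup>2 + (norm (fst (rrot f (Suc i))))\<^sup>2"
    using norm_rotation[of "Suc (2 * i)" "(snd (rrot f i), fst (rrot f (Suc i)))"] m
    by (simp add: lrot_def norm_Pair del: dspace.simps rotation.simps)
qed

lemma Shat_Khat:
  assumes f: "f \<in> Kh"
  shows "Sh f \<in> Kh"
proof -
  have "fst (Sh f (Suc j)) \<in> dom (2 * j)" if j: "j \<le> n" for j
  proof (cases j)
    case 0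
    then show ?thesis by (simp add: Shat_Suc)
  next
    case (Suc i)
    then show ?thesis using lrot_mem(2)[OF f, of i] j by (simp add: Shat_Suc del: dspace.simps)
  qed
  moreover have "snd (Sh f (Suc j)) \<in> cod (Suc (2 * j))" if j: "j \<le> n" for j
    using lrot_mem(1)[OF f, of j] csub_zero[OF csub_dspaces(2)[of "Suc (2 * n)"]] j
    by (cases "j = n") (simp_all add: Shat_Suc del: dspace.simps)
  ultimately show ?thesis using Shat_outside unfolding Khat_iff by blast
qed

lemma rrot_add: "rrot (\<lambda>k. f k + g k) j = rrot f j + rrot g j"
  by (simp only: rrot_def rotation_add)

lemma lrot_add: "lrot (\<lambda>k. f k + g k) i = lrot f i + lrot g i"
  by (simp only: lrot_def rrot_add fst_add snd_add add_Pair[symmetric] rotation_add)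

lemma fst_scaleC: "fst (c *\<^sub>C p) = c *\<^sub>C fst p" and snd_scaleC: "snd (c *\<^sub>C p) = c *\<^sub>C snd p"
  by (simp_all add: scaleC_prod_def)

lemma scaleC_Pair: "c *\<^sub>C (x, y) = (c *\<^sub>C x, c *\<^sub>C y)"
  by (simp add: scaleC_prod_def)

lemma rrot_scaleC: "j \<le> n \<Longrightarrow> rrot (\<lambda>k. c *\<^sub>C f k) j = c *\<^sub>C rrot f j"
  unfolding rrot_def by (rule rotation_scaleC) simp

lemma lrot_scaleC: "i < n \<Longrightarrow> lrot (\<lambda>k. c *\<^sub>C f k) i = c *\<^sub>C lrot f i"
  by (simp add: lrot_def rrot_scaleC fst_scaleC snd_scaleC scaleC_Pair[symmetric] rotation_scaleC del: rotation.simps)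

lemma Shat_add: "Sh (\<lambda>k. f k + g k) k = Sh f k + Sh g k"
  by (rule nat_cases_Khat[of _ k]) (simp_all add: Shat_outside Shat_Suc lrot_add)

lemma Shat_scaleC: "Sh (\<lambda>k. c *\<^sub>C f k) k = c *\<^sub>C Sh f k"
  by (rule nat_cases_Khat[of _ k])
    (auto simp: Shat_outside Shat_Suc lrot_scaleC scaleC_zero_right scaleC_Pair fst_scaleC snd_scaleC)

text \<open>Families are plain functions, so limits in the direct sum are taken block by block; with
  finitely many blocks this is the same convergence.\<close>

lemma Shat_tendsto:
  assumes "\<And>k. (\<lambda>i. F i k) \<longlonglongrightarrow> f k"
  shows "(\<lambda>i. Sh (F i) k) \<longlonglongrightarrow> Sh f k"
proof (rule nat_cases_Khat[of _ k])
  have rrot: "(\<lambda>i. rrot (F i) j) \<longlonglongrightarrow> rrot f j" for j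
    unfolding rrot_def by (intro rotation_tendsto assms)
  have lrot: "(\<lambda>i. lrot (F i) j) \<longlonglongrightarrow> lrot f j" for j
    unfolding lrot_def by (intro rotation_tendsto tendsto_intros rrot)
  show "(\<lambda>i. Sh (F i) (Suc j)) \<longlonglongrightarrow> Sh f (Suc j)" if "j \<le> n" for j
    unfolding Shat_Suc[OF that] by (auto intro!: tendsto_intros lrot)
qed (simp add: Shat_outside)

section \<open>Energy balance of the block operator\<close>

definition sqnorm :: "(nat \<Rightarrow> 'a \<times> 'b) \<Rightarrow> real"
  where "sqnorm f = (\<Sum>j\<le>n. (norm (f (Suc j)))\<^sup>2)"

lemma norm_prod_sq: "(norm p)\<^sup>2 = (norm (fst p))\<^sup>2 + (norm (snd p))\<^sup>2"
  by (cases p) (simp add: norm_Pair)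

text \<open>All rotations preserve norms, so the only loss is in the two components of the right
  factor's output that meet the zero blocks. The exact balance, beyond mere contractivity, is needed
  for the bound on a_n.\<close>

lemma sqnorm_Shat:
  assumes f: "f \<in> Kh"
  shows "sqnorm (Sh f) + (norm (fst (rrot f 0)))\<^sup>2 + (norm (snd (rrot f n)))\<^sup>2 = sqnorm f"
proof -
  define A where "A j = (if j = 0 then 0 else (norm (snd (lrot f (j - 1))))\<^sup>2)" for j
  define B where "B j = (if j = n then 0 else (norm (fst (lrot f j)))\<^sup>2)" for j
  have "(norm (Sh f (Suc j)))\<^sup>2 = A j + B j" if "j \<le> n" for j
    using that by (simp add: norm_prod_sq Shat_Suc A_def B_def)
  then have "sqnorm (Sh f) = (\<Sum>j\<le>n. A j) + (\<Sum>j\<le>n. B j)"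
    by (simp add: sqnorm_def sum.distrib)
  also have "(\<Sum>j\<le>n. A j) = (\<Sum>i<n. (norm (snd (lrot f i)))\<^sup>2)"
    by (simp add: sum.atMost_shift A_def)
  also have "(\<Sum>j\<le>n. B j) = (\<Sum>i<n. (norm (fst (lrot f i)))\<^sup>2)"
    by (simp add: lessThan_Suc_atMost[symmetric] B_def)
  also have "(\<Sum>i<n. (norm (snd (lrot f i)))\<^sup>2) + (\<Sum>i<n. (norm (fst (lrot f i)))\<^sup>2) =
      (\<Sum>i<n. (norm (snd (rrot f i)))\<^sup>2) + (\<Sum>i<n. (norm (fst (rrot f (Suc i))))\<^sup>2)"
    unfolding sum.distrib[symmetric]
    using lrot_mem(3)[OF f] by (intro sum.cong refl) (simp add: norm_prod_sq[of "lrot f _"] add.commute)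
  finally have S: "sqnorm (Sh f) = \<dots>" .
  have "sqnorm f = (\<Sum>j\<le>n. (norm (fst (rrot f j)))\<^sup>2) + (\<Sum>j\<le>n. (norm (snd (rrot f j)))\<^sup>2)"
    unfolding sqnorm_def sum.distrib[symmetric]
    by (intro sum.cong refl) (simp add: rrot_mem(3)[OF f, symmetric] norm_prod_sq[of "rrot f _"])
  also have "(\<Sum>j\<le>n. (norm (fst (rrot f j)))\<^sup>2) = (norm (fst (rrot f 0)))\<^sup>2 + (\<Sum>i<n. (norm (fst (rrot f (Suc i))))\<^sup>2)"
    by (rule sum.atMost_shift)
  also have "(\<Sum>j\<le>n. (norm (snd (rrot f j)))\<^sup>2) = (\<Sum>i<n. (norm (snd (rrot f i)))\<^sup>2) + (norm (snd (rrot f n)))\<^sup>2"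
    by (simp only: lessThan_Suc_atMost[symmetric] sum.lessThan_Suc)
  finally show ?thesis using S by linarith
qed

lemma sqnorm_Shat_le:
  assumes "f \<in> Kh"
  shows "sqnorm (Sh f) \<le> sqnorm f"
  using sqnorm_Shat[OF assms] zero_le_power2[of "norm (fst (rrot f 0))"] zero_le_power2[of "norm (snd (rrot f n))"]
  by linarith

lemma sqnorm_nonneg: "sqnorm f \<ge> 0"
  by (simp add: sqnorm_def sum_nonneg)

lemma norm_le_sqnorm: "j \<le> n \<Longrightarrow> (norm (f (Suc j)))\<^sup>2 \<le> sqnorm f"
  unfolding sqnorm_def by (rule member_le_sum[of j "{..n}" "\<lambda>j. (norm (f (Suc j)))\<^sup>2"]) auto

lemma norm_scaleC_prod: "norm (c *\<^sub>C p) = cmod c * norm p" for p :: "'a \<times> 'b"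
proof (rule power2_eq_imp_eq)
  show "(norm (c *\<^sub>C p))\<^sup>2 = (cmod c * norm p)\<^sup>2"
    unfolding power_mult_distrib norm_prod_sq[of p] norm_prod_sq[of "c *\<^sub>C p"]
    by (simp add: scaleC_prod_def norm_scaleC power_mult_distrib algebra_simps)
qed auto

lemma sqnorm_scaleC: "sqnorm (\<lambda>k. c *\<^sub>C f k) = (cmod c)\<^sup>2 * sqnorm f"
  by (simp add: sqnorm_def norm_scaleC_prod power_mult_distrib sum_distrib_left)

section \<open>Inversion of the pencil\<close>

lemma pencil_Khat: "f \<in> Kh \<Longrightarrow> pencil n \<Gamma> z f \<in> Kh"
  using Khat_add[of f "\<lambda>k. (- z) *\<^sub>C Sh f k"] Khat_scaleC[OF Shat_Khat, of f "- z"]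
  by (simp add: pencil_def scaleC_minus_left)

lemma pencil_add: "pencil n \<Gamma> z (\<lambda>k. f k + g k) = (\<lambda>k. pencil n \<Gamma> z f k + pencil n \<Gamma> z g k)"
  by (simp add: pencil_def Shat_add scaleC_add_right fun_eq_iff)

lemma pencil_kernel:
  assumes z: "cmod z < 1" and f: "f \<in> Kh" and eq: "\<And>k. f k = z *\<^sub>C Sh f k"
  shows "f = (\<lambda>_. 0)"
proof
  have "f = (\<lambda>k. z *\<^sub>C Sh f k)" by (rule ext) (rule eq)
  then have "sqnorm f = sqnorm (\<lambda>k. z *\<^sub>C Sh f k)" by (rule arg_cong)
  also have "\<dots> = (cmod z)\<^sup>2 * sqnorm (Sh f)" by (rule sqnorm_scaleC)
  also have "\<dots> \<le> (cmod z)\<^sup>2 * sqnorm f"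
    using sqnorm_Shat_le[OF f] by (intro mult_left_mono) auto
  finally have "(1 - (cmod z)\<^sup>2) * sqnorm f \<le> 0" by (simp add: algebra_simps)
  moreover have "(cmod z)\<^sup>2 < 1" using z by (simp add: power_less_one_iff)
  ultimately have "sqnorm f \<le> 0" by (simp add: mult_le_0_iff)
  then have fz: "f (Suc j) = 0" if "j \<le> n" for j
  proof -
    have "(norm (f (Suc j)))\<^sup>2 \<le> 0" using norm_le_sqnorm[OF that, of f] \<open>sqnorm f \<le> 0\<close> by linarith
    then show ?thesis by simp
  qed
  then show "f k = 0" for k
    using nat_cases_Khat[of "\<lambda>k. f k = 0" k] fz Khat_mem(3)[OF f] by blast
qed

text \<open>The Neumann series, summed in each block. Its terms decay like |z|^j since the block
  operator does not increase \<open>sqnorm\<close>, and closedness of the summands keeps the sum in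
  the space.\<close>

lemma pencil_surj:
  assumes z: "cmod z < 1" and h: "h \<in> Kh"
  shows "\<exists>f\<in>Kh. pencil n \<Gamma> z f = h"
proof -
  define T where "T f = (\<lambda>k. z *\<^sub>C Sh f k)" for f
  define s where "s j = (T ^^ j) h" for j
  have sK: "s j \<in> Kh" for j
    by (induction j) (auto simp: s_def h T_def intro: Khat_scaleC Shat_Khat)
  have sN: "sqnorm (s j) \<le> ((cmod z)\<^sup>2) ^ j * sqnorm h" for j
  proof (induction j)
    case (Suc j)
    have "sqnorm (s (Suc j)) = (cmod z)\<^sup>2 * sqnorm (Sh (s j))"
      by (simp add: s_def T_def sqnorm_scaleC)
    also have "\<dots> \<le> (cmod z)\<^sup>2 * sqnorm (s j)"
      using sqnorm_Shat_le[OF sK[of j]] by (intro mult_left_mono) auto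
    also have "\<dots> \<le> (cmod z)\<^sup>2 * (((cmod z)\<^sup>2) ^ j * sqnorm h)"
      by (intro mult_left_mono Suc) auto
    finally show ?case by simp
  qed (simp add: s_def)
  have sn: "norm (s j k) \<le> (cmod z) ^ j * sqrt (sqnorm h)" for j k
  proof (rule nat_cases_Khat[of _ k])
    show "norm (s j (Suc i)) \<le> (cmod z) ^ j * sqrt (sqnorm h)" if "i \<le> n" for i
    proof (rule power2_le_imp_le)
      have "(norm (s j (Suc i)))\<^sup>2 \<le> ((cmod z)\<^sup>2) ^ j * sqnorm h"
        using norm_le_sqnorm[OF that] sN order_trans by blast
      also have "\<dots> = ((cmod z) ^ j * sqrt (sqnorm h))\<^sup>2"
        by (simp add: power_mult_distrib sqnorm_nonneg power_mult[symmetric] mult.commute)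
      finally show "(norm (s j (Suc i)))\<^sup>2 \<le> ((cmod z) ^ j * sqrt (sqnorm h))\<^sup>2" .
    qed (simp add: sqnorm_nonneg)
  qed (simp add: Khat_mem(3)[OF sK] sqnorm_nonneg)
  have "summable (\<lambda>j. (cmod z) ^ j * sqrt (sqnorm h))"
    using z by (intro summable_mult2 summable_geometric) simp
  then have sum: "summable (\<lambda>j. s j k)" for k
    by (rule summable_comparison_test'[where N = 0]) (rule sn)
  define f where "f k = (\<Sum>j. s j k)" for k
  define F where "F i = (\<lambda>k. \<Sum>j<i. s j k)" for i
  have lim: "(\<lambda>i. F i k) \<longlonglongrightarrow> f k" for k
    unfolding F_def f_def by (rule summable_LIMSEQ[OF sum])
  have FK: "F i \<in> Kh" for i by (induction i) (auto simp: F_def Khat_zero intro: Khat_add sK)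
  have "f \<in> Kh" unfolding Khat_iff
  proof (intro conjI allI impI)
    fix j assume j: "j \<le> n"
    show "fst (f (Suc j)) \<in> dom (2 * j)"
      by (rule closed_sequentially[OF csub_closed[OF csub_dspaces(1)] Khat_mem(1)[OF FK j] tendsto_fst[OF lim]])
        (use j in simp)
    show "snd (f (Suc j)) \<in> cod (Suc (2 * j))"
      by (rule closed_sequentially[OF csub_closed[OF csub_dspaces(2)] Khat_mem(2)[OF FK j] tendsto_snd[OF lim]])
        (use j in simp)
  next
    show "f k = 0" if "k \<notin> {1..n + 1}" for k
      using Khat_mem(3)[OF sK that] by (simp add: f_def)
  qed
  have step: "F (Suc i) k = h k + z *\<^sub>C Sh (F i) k" for i k
  proof (induction i)
    case 0
    have "Sh (\<lambda>_. 0) k = 0" using Shat_scaleC[of 0 "\<lambda>_. 0" k]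
      by (simp add: scaleC_prod_def scaleC_zero_left zero_prod_def)
    then show ?case by (simp add: F_def s_def) (simp add: scaleC_zero_right)
  next
    case (Suc i)
    have "F (Suc (Suc i)) k = F (Suc i) k + z *\<^sub>C Sh (s i) k" by (simp add: F_def s_def T_def)
    also have "\<dots> = h k + z *\<^sub>C (Sh (F i) k + Sh (s i) k)"
      by (simp add: Suc scaleC_add_right)
    also have "Sh (F i) k + Sh (s i) k = Sh (F (Suc i)) k" by (simp add: F_def Shat_add[symmetric])
    finally show ?case .
  qed
  have "f k = h k + z *\<^sub>C Sh f k" for k
  proof (rule LIMSEQ_unique)
    show "(\<lambda>i. F (Suc i) k) \<longlonglongrightarrow> f k" using lim by (rule LIMSEQ_Suc)
    have l: "(\<lambda>i. Sh (F i) k) \<longlonglongrightarrow> Sh f k" by (rule Shat_tendsto[OF lim])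
    show "(\<lambda>i. F (Suc i) k) \<longlonglongrightarrow> h k + z *\<^sub>C Sh f k"
      unfolding step scaleC_prod_def by (intro tendsto_intros scaleC.tendsto l)
  qed
  then have "pencil n \<Gamma> z f = h" by (simp add: pencil_def fun_eq_iff eq_diff_eq[symmetric])
  then show ?thesis using \<open>f \<in> Kh\<close> by blast
qed

lemma pencil_bij:
  assumes z: "cmod z < 1"
  shows "bij_betw (pencil n \<Gamma> z) (Kh) (Kh)"
  unfolding bij_betw_def
proof
  show "inj_on (pencil n \<Gamma> z) (Kh)"
  proof (rule inj_onI)
    fix f g assume fg: "f \<in> Kh" "g \<in> Kh" and eq: "pencil n \<Gamma> z f = pencil n \<Gamma> z g"
    define d where "d = (\<lambda>k. f k + (- 1) *\<^sub>C g k)"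
    have dK: "d \<in> Kh" unfolding d_def by (intro Khat_add Khat_scaleC fg)
    have m1: "(- 1) *\<^sub>C p = - p" for p :: "'a \<times> 'b"
      by (simp add: scaleC_minus_left scaleC_one)
    have "d k = z *\<^sub>C Sh d k" for k
      using fun_cong[OF eq, of k] unfolding d_def pencil_def Shat_add Shat_scaleC
      by (simp add: m1 scaleC_diff_right algebra_simps)
    then have "d = (\<lambda>_. 0)" by (rule pencil_kernel[OF z dK])
    then show "f = g" by (simp add: d_def m1 fun_eq_iff)
  qed
  show "pencil n \<Gamma> z ` Kh = Kh" using pencil_surj[OF z] pencil_Khat by blast
qed

lemma Rhat_eqI: "cmod z < 1 \<Longrightarrow> f \<in> Kh \<Longrightarrow> pencil n \<Gamma> z f = h \<Longrightarrow> Rhat n \<Gamma> z h = f"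
  unfolding Rhat_def using pencil_bij[of z] by (intro the_inv_into_f_eq) (auto simp: bij_betw_def)

lemma
  assumes "cmod z < 1" "h \<in> Kh"
  shows Rhat_Khat: "Rhat n \<Gamma> z h \<in> Kh" and pencil_Rhat: "pencil n \<Gamma> z (Rhat n \<Gamma> z h) = h"
proof -
  have inj: "inj_on (pencil n \<Gamma> z) (Kh)" and h: "h \<in> pencil n \<Gamma> z ` Kh"
    using pencil_bij[OF assms(1)] assms(2) by (auto simp: bij_betw_def)
  show "Rhat n \<Gamma> z h \<in> Kh"
    unfolding Rhat_def by (rule the_inv_into_into[OF inj h order_refl])
  show "pencil n \<Gamma> z (Rhat n \<Gamma> z h) = h"
    unfolding Rhat_def by (rule f_the_inv_into_f[OF inj h])
qed

lemma Rhat_add: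
  assumes "cmod z < 1" "g \<in> Kh" "h \<in> Kh"
  shows "Rhat n \<Gamma> z (\<lambda>k. g k + h k) = (\<lambda>k. Rhat n \<Gamma> z g k + Rhat n \<Gamma> z h k)"
  using assms by (intro Rhat_eqI Khat_add) (simp_all add: Rhat_Khat pencil_add pencil_Rhat)

lemma emb_first_Khat: "emb_first x \<in> Kh"
  unfolding Khat_iff
proof (intro conjI allI impI)
  fix j assume "j \<le> n"
  then show "fst (emb_first x (Suc j)) \<in> dom (2 * j)"
    "snd (emb_first x (Suc j)) \<in> cod (Suc (2 * j))"
    using csub_zero[OF csub_dspaces(1)[of "2 * j"]] csub_zero[OF csub_dspaces(2)[of "Suc (2 * j)"]]
    by (cases j; simp add: emb_first_def del: dspace.simps(2))+
qed (auto simp: emb_first_def)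

lemma emb_last_Khat: "v \<in> cod (2 * n + 1) \<Longrightarrow> emb_last n v \<in> Kh"
  unfolding Khat_iff
proof (intro conjI allI impI)
  fix j assume "v \<in> cod (2 * n + 1)" "j \<le> n"
  then show "fst (emb_last n v (Suc j)) \<in> dom (2 * j)"
    "snd (emb_last n v (Suc j)) \<in> cod (Suc (2 * j))"
    using csub_zero[OF csub_dspaces(1)[of "2 * j"]] csub_zero[OF csub_dspaces(2)[of "Suc (2 * j)"]]
    by (cases "j = n"; simp add: emb_last_def del: dspace.simps)+
qed (auto simp: emb_last_def)

text \<open>The two rows compute the very outputs of the right factor that the zero blocks discard;
  this ties the transfer functions to the energy balance.\<close>

lemma row_last_eq: "row_last n \<Gamma> (f (Suc n)) = snd (rrot f n)"
  and row_first_eq: "row_first \<Gamma> (f (Suc 0)) = fst (rrot f 0)"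
  by (cases "f (Suc n)"; cases "f (Suc 0)"; simp add: rrot_def)+

section \<open>The feedback operator and the closed formula\<close>

context
  fixes z assumes z: "cmod z < 1"
begin

abbreviation A where "A \<equiv> a_fun n \<Gamma> z"
abbreviation R where "R \<equiv> Rhat n \<Gamma> z"

lemma a_fun_eq: "A v = z *\<^sub>C snd (rrot (R (emb_last n v)) n)"
  by (simp add: a_fun_def row_last_eq)

lemma a_fun_add:
  assumes "v \<in> cod (2 * n + 1)" "w \<in> cod (2 * n + 1)"
  shows "A (v + w) = A v + A w"
proof -
  have "(emb_last n (v + w) :: nat \<Rightarrow> 'a \<times> 'b) = (\<lambda>k. emb_last n v k + emb_last n w k)"
    by (rule ext) (simp add: emb_last_def)
  then have "R (emb_last n (v + w)) = R (\<lambda>k. emb_last n v k + emb_last n w k)"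
    by (rule arg_cong)
  also have "\<dots> = (\<lambda>k. R (emb_last n v) k + R (emb_last n w) k)"
    by (intro Rhat_add z emb_last_Khat assms)
  finally show ?thesis by (simp add: a_fun_eq rrot_add scaleC_add_right)
qed

lemma a_fun_mem: "v \<in> cod (2 * n + 1) \<Longrightarrow> A v \<in> dom (2 * n + 1)"
  using rrot_mem(2)[OF Rhat_Khat[OF z emb_last_Khat], of v n]
  by (simp add: a_fun_def row_last_eq csub_scaleC[OF csub_dspaces(1)] del: dspace.simps)

text \<open>The resolvent vector satisfies f = z S f + (0, ..., 0, v), where v enters the slot in
  which S f is 0; so |f|^2 = |z|^2 |S f|^2 + |v|^2. Together with the energy balance |S f|^2 +
  |row|^2 \<le> |f|^2 this gives |z|^2 |row|^2 \<le> |v|^2 - (1 - |z|^2) |f|^2.\<close>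

lemma norm_a_fun_le:
  assumes v: "v \<in> cod (2 * n + 1)"
  shows "norm (A v) \<le> cmod z * norm v"
proof (rule power2_le_imp_le)
  define f where "f = R (emb_last n v)"
  have f: "f \<in> Kh" unfolding f_def by (intro Rhat_Khat z emb_last_Khat v)
  have "pencil n \<Gamma> z f = emb_last n v" unfolding f_def by (intro pencil_Rhat z emb_last_Khat v)
  then have fk: "f k = z *\<^sub>C Sh f k + emb_last n v k" for k
    by (metis (no_types) pencil_def diff_add_cancel add.commute)
  have "(norm (f (Suc j)))\<^sup>2 = (cmod z)\<^sup>2 * (norm (Sh f (Suc j)))\<^sup>2 + (if j = n then (norm v)\<^sup>2 else 0)"
    if j: "j \<le> n" for j
  proof (cases "j = n")
    case True
    have "snd (Sh f (Suc j)) = 0" using True by (simp add: Shat_Suc)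
    then show ?thesis using True fk[of "Suc j"]
      by (simp add: norm_prod_sq emb_last_def scaleC_prod_def norm_scaleC power_mult_distrib scaleC_zero_right)
  next
    case False
    then show ?thesis
      using fk[of "Suc j"] by (simp add: emb_last_def norm_scaleC_prod power_mult_distrib)
  qed
  then have "sqnorm f = (\<Sum>j\<le>n. (cmod z)\<^sup>2 * (norm (Sh f (Suc j)))\<^sup>2 + (if j = n then (norm v)\<^sup>2 else 0))"
    by (simp add: sqnorm_def)
  also have "\<dots> = (cmod z)\<^sup>2 * sqnorm (Sh f) + (norm v)\<^sup>2"
    by (simp add: sum.distrib sum_distrib_left sqnorm_def)
  finally have N: "sqnorm f = (cmod z)\<^sup>2 * sqnorm (Sh f) + (norm v)\<^sup>2" .
  have "snd (f (Suc n)) = snd (z *\<^sub>C Sh f (Suc n) + emb_last n v (Suc n))"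
    using fk by (rule arg_cong)
  also have "\<dots> = v" by (simp add: Shat_Suc emb_last_def scaleC_prod_def scaleC_zero_right)
  finally have "snd (f (Suc n)) = v" .
  \<comment> \<open>This lower bound for f improves the estimate from |v|^2 to |z|^2 |v|^2, which
    makes the feedback strictly contractive.\<close>
  then have vN: "(norm v)\<^sup>2 \<le> sqnorm f"
    using norm_le_sqnorm[of n f] zero_le_power2[of "norm (fst (f (Suc n)))"]
      norm_prod_sq[of "f (Suc n)", unfolded \<open>snd (f (Suc n)) = v\<close>] by linarith
  have "(norm (snd (rrot f n)))\<^sup>2 \<le> sqnorm f - sqnorm (Sh f)"
    using sqnorm_Shat[OF f] zero_le_power2[of "norm (fst (rrot f 0))"] by linarith
  then have "(cmod z)\<^sup>2 * (norm (snd (rrot f n)))\<^sup>2 \<le> (cmod z)\<^sup>2 * (sqnorm f - sqnorm (Sh f))"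
    by (rule mult_left_mono) simp
  also have "\<dots> = (norm v)\<^sup>2 - (1 - (cmod z)\<^sup>2) * sqnorm f"
    using N by (simp add: algebra_simps)
  also have "\<dots> \<le> (norm v)\<^sup>2 - (1 - (cmod z)\<^sup>2) * (norm v)\<^sup>2"
    using z vN by (intro diff_left_mono mult_left_mono) (auto simp: power_le_one)
  finally have "(cmod z)\<^sup>2 * (norm (snd (rrot f n)))\<^sup>2 \<le> (cmod z)\<^sup>2 * (norm v)\<^sup>2"
    by (simp add: algebra_simps)
  then show "(norm (A v))\<^sup>2 \<le> (cmod z * norm v)\<^sup>2"
    by (simp add: a_fun_def row_last_eq f_def norm_scaleC power_mult_distrib)
qed simp

lemma feedback_bij:
  assumes E: "E \<in> bop (dom (2 * n + 1)) (cod (2 * n + 1))" "norm E \<le> 1"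
  shows "bij_betw (\<lambda>u. u - A (E u)) (dom (2 * n + 1)) (dom (2 * n + 1))"
proof (rule bij_betw_minus_contraction[OF csub_dspaces(1) _ z])
  show "A (E u) \<in> dom (2 * n + 1)" for u by (rule a_fun_mem[OF bop_range[OF E(1)]])
  show "norm (A (E u) - A (E v)) \<le> cmod z * norm (u - v)" for u v
  proof -
    have "A (E u) - A (E v) = A (E (u - v))"
      using a_fun_add[OF bop_range[OF E(1), of "u - v"] bop_range[OF E(1), of v]]
      by (simp add: blinfun.add_right[symmetric])
    also have "norm \<dots> \<le> cmod z * norm (E (u - v))"
      by (rule norm_a_fun_le[OF bop_range[OF E(1)]])
    also have "\<dots> \<le> cmod z * (1 * norm (u - v))"
      by (intro mult_left_mono order_trans[OF norm_blinfun] mult_right_mono E) auto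
    finally show ?thesis by simp
  qed
qed auto

lemma chain_formula:
  assumes chain: "schur_chain (2 * n) \<Gamma> \<Theta>"
  shows "\<Theta> 0 z x = theta_fun n \<Gamma> z x + c_fun n \<Gamma> z (\<Theta> (2 * n + 1) z
    (the_inv_into (dom (2 * n + 1)) (\<lambda>u. u - A (\<Theta> (2 * n + 1) z u)) (b_fun n \<Gamma> z x)))"
proof -
  have \<Theta>b: "\<Theta> k z \<in> bop (dom k) (cod k)" "norm (\<Theta> k z) \<le> 1" if "k \<le> 2 * n + 1" for k
    using chain that z by (auto simp: schur_chain_def schur_class_iff)
  define P where "P k a u \<longleftrightarrow> u \<in> dom (Suc k) \<and>
    rotation \<Gamma> k (a, z *\<^sub>C \<Theta> (Suc k) z u) = (\<Theta> k z a, u)" for k a u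
  have Pex: "\<exists>u. P k a u" if k: "k \<le> 2 * n" and a: "a \<in> dom k" for k a
  proof -
    interpret contraction "dom k" "cod k" "\<Gamma> k" using k by (rule contraction_at)
    obtain u where "u \<in> DU" "u = D a - z *\<^sub>C Gs (\<Theta> (Suc k) z u)" "\<Theta> k z a = \<Gamma> k a + z *\<^sub>C Ds (\<Theta> (Suc k) z u)"
      using chain k a z unfolding schur_chain_def step_rel_def by (metis mem_ball_0)
    then show ?thesis
      by (intro exI[of _ u]) (simp add: P_def dop_def bop_scaleC[OF Gs] bop_scaleC[OF defect_op_adj_bop])
  qed
  \<comment> \<open>A successor state is known to exist only for arguments in \<open>dom k\<close>,
    so the choice is made blindly here and membership is established along the recursion in
    \<open>Xmem\<close>.\<close>
  define X where "X = rec_nat x (\<lambda>k a. SOME u. P k a u)"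
  have X0: "X 0 = x" and XS: "X (Suc k) = (SOME u. P k (X k) u)" for k by (simp_all add: X_def)
  have Xmem: "X k \<in> dom k" if "k \<le> 2 * n + 1" for k using that
  proof (induction k)
    case (Suc k)
    then have "P k (X k) (X (Suc k))" unfolding XS by (intro someI_ex[OF Pex]) auto
    then show ?case by (simp add: P_def)
  qed simp
  define Y where "Y k = \<Theta> k z (X k)" for k
  have rot: "rotation \<Gamma> k (X k, z *\<^sub>C Y (Suc k)) = (Y k, X (Suc k))" if "k \<le> 2 * n" for k
  proof -
    have "P k (X k) (X (Suc k))" unfolding XS using that by (intro someI_ex[OF Pex] Xmem) auto
    then show ?thesis by (simp add: P_def Y_def)
  qed
  have Ymem: "Y k \<in> cod k" if "k \<le> 2 * n + 1" for k
    unfolding Y_def by (rule bop_range[OF \<Theta>b(1)[OF that]])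
  have rotc: "rotation \<Gamma> k (c *\<^sub>C X k, (c * z) *\<^sub>C Y (Suc k)) = (c *\<^sub>C Y k, c *\<^sub>C X (Suc k))" if "k \<le> 2 * n" for k c
    using rotation_scaleC[OF that, of c "(X k, z *\<^sub>C Y (Suc k))"] rot[OF that]
    by (simp add: scaleC_prod_def scaleC_scaleC del: rotation.simps)
  \<comment> \<open>every Schur step scales one input of its rotation by \<open>z\<close>, whereas the pencil scales both outputs
    of the rotations of odd index; the powers of \<open>z\<close> make up for the difference\<close>
  define f where "f k = (if k \<in> {1..n + 1} then (z ^ (k - 1) *\<^sub>C X (2 * k - 2), z ^ k *\<^sub>C Y (2 * k - 1)) else 0)" for k
  have fS: "f (Suc j) = (z ^ j *\<^sub>C X (2 * j), (z ^ j * z) *\<^sub>C Y (Suc (2 * j)))" if "j \<le> n" for j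
    using that by (simp add: f_def mult.commute)
  have fK: "f \<in> Kh" unfolding Khat_iff
    by (auto simp: fS f_def[of 0] simp del: dspace.simps intro!: csub_scaleC csub_dspaces Xmem Ymem)
      (auto simp: f_def)
  have rf: "rrot f j = (z ^ j *\<^sub>C Y (2 * j), z ^ j *\<^sub>C X (Suc (2 * j)))" if "j \<le> n" for j
    using that by (simp add: rrot_def fS rotc del: rotation.simps)
  have qf: "lrot f i = (z ^ i *\<^sub>C Y (Suc (2 * i)), z ^ i *\<^sub>C X (2 * Suc i))" if "i < n" for i
    using rotc[of "Suc (2 * i)" "z ^ i"] that by (simp add: lrot_def rf mult.commute del: rotation.simps)
  have S: "Sh f (Suc j) = (if j = 0 then 0 else z ^ (j - 1) *\<^sub>C X (2 * j),
      if j = n then 0 else z ^ j *\<^sub>C Y (Suc (2 * j)))" if "j \<le> n" for j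
    using that by (cases j) (simp_all add: Shat_Suc qf)
  \<comment> \<open>The last slot of S f is 0, so the whole entry of \<open>f\<close> there is left
    over by the pencil; it is treated as an external input next to \<open>x\<close>.\<close>
  define v where "v = z ^ Suc n *\<^sub>C Y (2 * n + 1)"
  have v: "v \<in> cod (2 * n + 1)" unfolding v_def by (intro csub_scaleC csub_dspaces Ymem) auto
  have "pencil n \<Gamma> z f k = emb_first x k + emb_last n v k" for k
  proof (rule nat_cases_Khat[of _ k])
    fix j assume j: "j \<le> n"
    show "pencil n \<Gamma> z f (Suc j) = emb_first x (Suc j) + emb_last n v (Suc j)"
    proof (rule prod_eqI)
      show "fst (pencil n \<Gamma> z f (Suc j)) = fst (emb_first x (Suc j) + emb_last n v (Suc j))"
        using j by (cases j) (simp_all add: pencil_def scaleC_prod_def fS S emb_first_def emb_last_def X0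
            scaleC_one scaleC_zero_right scaleC_scaleC)
      show "snd (pencil n \<Gamma> z f (Suc j)) = snd (emb_first x (Suc j) + emb_last n v (Suc j))"
        using j by (cases "j = n") (simp_all add: pencil_def scaleC_prod_def fS S emb_first_def emb_last_def
            scaleC_zero_right scaleC_scaleC v_def mult.commute)
    qed
  next
    assume "k \<notin> {1..n + 1}"
    then show "pencil n \<Gamma> z f k = emb_first x k + emb_last n v k"
      using Khat_mem(3)[OF pencil_Khat[OF fK]] by (auto simp: emb_first_def emb_last_def)
  qed
  then have "R (\<lambda>k. emb_first x k + emb_last n v k) = f" by (intro Rhat_eqI z fK) auto
  then have "(\<lambda>k. R (emb_first x) k + R (emb_last n v) k) = f"
    using Rhat_add[OF z emb_first_Khat emb_last_Khat[OF v], of x] by (simp only:)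
  then have fR: "f k = R (emb_first x) k + R (emb_last n v) k" for k by (rule fun_cong[OF sym])
  have "Y 0 = fst (rrot f 0)" by (simp add: rf scaleC_one)
  also have "\<dots> = theta_fun n \<Gamma> z x + c_fun n \<Gamma> z v"
  proof -
    have "rrot f 0 = rrot (R (emb_first x)) 0 + rrot (R (emb_last n v)) 0"
      by (simp only: rrot_add[symmetric] fR[symmetric])
    then show ?thesis by (simp add: theta_fun_def c_fun_def row_first_eq)
  qed
  finally have Y0: "\<Theta> 0 z x = theta_fun n \<Gamma> z x + c_fun n \<Gamma> z v"
    by (simp add: Y_def X0)
  define u where "u = z ^ Suc n *\<^sub>C X (2 * n + 1)"
  have u: "u \<in> dom (2 * n + 1)" unfolding u_def by (intro csub_scaleC csub_dspaces Xmem) auto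
  \<comment> \<open>\<open>u\<close> and \<open>v\<close> carry the same power of z, so homogeneity
    of the last function closes the loop.\<close>
  have Eu: "\<Theta> (2 * n + 1) z u = v"
    unfolding u_def v_def Y_def by (rule bop_scaleC[OF \<Theta>b(1)]) simp
  have "u = z *\<^sub>C snd (rrot f n)" by (simp add: rf u_def scaleC_scaleC)
  also have "\<dots> = b_fun n \<Gamma> z x + A v"
  proof -
    have "rrot f n = rrot (R (emb_first x)) n + rrot (R (emb_last n v)) n"
      by (simp only: rrot_add[symmetric] fR[symmetric])
    then show ?thesis by (simp add: b_fun_def a_fun_def row_last_eq scaleC_add_right)
  qed
  finally have "u - A v = b_fun n \<Gamma> z x" by (simp only: add_diff_cancel_right')
  then have "u - A (\<Theta> (2 * n + 1) z u) = b_fun n \<Gamma> z x" by (simp only: Eu)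
  then have "the_inv_into (dom (2 * n + 1)) (\<lambda>u. u - A (\<Theta> (2 * n + 1) z u)) (b_fun n \<Gamma> z x) = u"
    using feedback_bij[OF \<Theta>b] u by (intro the_inv_into_f_eq) (auto simp: bij_betw_def)
  then show ?thesis by (simp only: Y0 Eu)
qed

end

end

text \<open>The first two conjuncts guarantee that the inverses hidden in \<open>Rhat\<close> and in
  the formula are genuine, since \<open>the_inv_into\<close> has a value in any case. The map is
  quantified existentially because the formula describes plain functions of \<open>x\<close>; that
  they form a Schur function is part of the claim.\<close>

theorem theorem4p10:
  fixes \<Gamma> :: "nat \<Rightarrow> 'm::{complex_hilbert, second_countable_topology}
                 \<Rightarrow>\<^sub>L 'n::{complex_hilbert, second_countable_topology}"
    and n :: nat
  defines "U \<equiv> dspace \<Gamma> (2 * n + 1)"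
    and "V \<equiv> dspace_adj \<Gamma> (2 * n + 1)"
  assumes "choice_sequence_upto (2 * n) \<Gamma>"
    and "U \<noteq> {0}" and "V \<noteq> {0}"
  shows "(\<forall>z\<in>ball 0 1. bij_betw (pencil n \<Gamma> z) (Khat n \<Gamma>) (Khat n \<Gamma>)) \<and>
    (\<forall>\<E>\<in>schur_class U V. \<forall>z\<in>ball 0 1.
      bij_betw (\<lambda>u. u - a_fun n \<Gamma> z (blinfun_apply (\<E> z) u)) U U) \<and>
    (\<exists>\<Phi>.
      (\<forall>\<E>\<in>schur_class U V. \<forall>z\<in>ball 0 1. \<forall>x.
        blinfun_apply (\<Phi> \<E> z) x = theta_fun n \<Gamma> z x +
          c_fun n \<Gamma> z (blinfun_apply (\<E> z)
            (the_inv_into U (\<lambda>u. u - a_fun n \<Gamma> z (blinfun_apply (\<E> z) u)) (b_fun n \<Gamma> z x)))) \<and>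
      bij_betw \<Phi> (schur_class U V)
        {\<Theta> \<in> schur_class UNIV UNIV. \<forall>k\<le>2 * n. schur_param UNIV UNIV \<Theta> k = \<Gamma> k} \<and>
      (\<forall>\<E>\<in>schur_class U V.
        (\<forall>k\<le>2 * n. schur_param UNIV UNIV (\<Phi> \<E>) k = \<Gamma> k) \<and>
        (\<forall>k. schur_param UNIV UNIV (\<Phi> \<E>) (2 * n + 1 + k) = schur_param U V \<E> k)))"
proof -
  interpret choice_seq \<Gamma> n by unfold_locales (rule assms)
  let ?T = "{\<Theta> \<in> schur_class UNIV UNIV. \<forall>k\<le>2 * n. schur_param UNIV UNIV \<Theta> k = \<Gamma> k}"
  have "\<exists>\<Theta>. schur_chain (2 * n) \<Gamma> \<Theta> \<and> \<Theta> (2 * n + 1) = \<E>" if "\<E> \<in> schur_class U V" for \<E>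
    using schur_chain_exists[OF choice] that by (simp add: U_def V_def del: dspace.simps)
  then obtain C where C: "\<And>\<E>. \<E> \<in> schur_class U V \<Longrightarrow> schur_chain (2 * n) \<Gamma> (C \<E>)"
    "\<And>\<E>. \<E> \<in> schur_class U V \<Longrightarrow> C \<E> (2 * n + 1) = \<E>" by metis
  define \<Phi> where "\<Phi> \<E> = C \<E> 0" for \<E>
  have it: "(schur_step ^^ k) (UNIV, UNIV, \<Theta> 0) = (dspace \<Gamma> k, dspace_adj \<Gamma> k, \<Theta> k)"
    if "schur_chain (2 * n) \<Gamma> \<Theta>" "k \<le> 2 * n + 1" for \<Theta> k
    using schur_chain_iterate[OF choice] that by simp
  have par: "schur_param UNIV UNIV (\<Theta> 0) k = \<Gamma> k" if "schur_chain (2 * n) \<Gamma> \<Theta>" "k \<le> 2 * n" for \<Theta> k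
    using it[of \<Theta> k] that by (simp add: schur_param_def) (simp add: schur_chain_def)
  have form: "\<Theta> 0 z x = theta_fun n \<Gamma> z x + c_fun n \<Gamma> z (\<Theta> (2 * n + 1) z
      (the_inv_into U (\<lambda>u. u - a_fun n \<Gamma> z (\<Theta> (2 * n + 1) z u)) (b_fun n \<Gamma> z x)))"
    if "schur_chain (2 * n) \<Gamma> \<Theta>" "z \<in> ball 0 1" for \<Theta> z x
    using chain_formula[OF _ that(1)] that(2) by (simp add: U_def del: dspace.simps)
  have S0: "\<Theta> 0 \<in> schur_class UNIV UNIV" if "schur_chain (2 * n) \<Gamma> \<Theta>" for \<Theta>
    using that by (auto simp: schur_chain_def dest: spec[of _ 0])
  \<comment> \<open>The state of the Schur algorithm after 2 n + 1 steps contains the parameter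
    function.\<close>
  have inj: "inj_on \<Phi> (schur_class U V)"
  proof (rule inj_onI)
    fix \<E> \<F> assume E: "\<E> \<in> schur_class U V" "\<F> \<in> schur_class U V" "\<Phi> \<E> = \<Phi> \<F>"
    show "\<E> = \<F>"
      using it[OF C(1)[OF E(1)], of "2 * n + 1"] it[OF C(1)[OF E(2)], of "2 * n + 1"] E(3)
        C(2)[OF E(1)] C(2)[OF E(2)] unfolding \<Phi>_def by (metis order_refl prod.inject)
  qed
  have img: "\<Phi> ` schur_class U V = ?T"
  proof (intro equalityI subsetI)
    fix \<Theta> assume "\<Theta> \<in> ?T"
    then obtain \<Psi> where \<Psi>: "schur_chain (2 * n) \<Gamma> \<Psi>" "\<Psi> 0 = \<Theta>" and \<Theta>: "\<Theta> \<in> schur_class UNIV UNIV"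
      using schur_chain_of_params[OF choice] by blast
    define \<E> where "\<E> = \<Psi> (2 * n + 1)"
    have E: "\<E> \<in> schur_class U V"
      using \<Psi>(1) unfolding schur_chain_def \<E>_def U_def V_def by auto
    \<comment> \<open>Both are first members of chains that end in the same function, and the
      formula expresses the first member of a chain by the last.\<close>
    have "\<Phi> \<E> = \<Theta>"
    proof (rule extensionalityI)
      show "\<Phi> \<E> \<in> extensional (ball 0 1)" "\<Theta> \<in> extensional (ball 0 1)"
        using S0[OF C(1)[OF E]] \<Theta> by (auto simp: \<Phi>_def schur_class_iff)
      show "\<Phi> \<E> z = \<Theta> z" if "z \<in> ball 0 1" for z
        using form[OF \<Psi>(1) that] form[OF C(1)[OF E] that] C(2)[OF E] \<Psi>(2)
        by (intro blinfun_eqI) (simp add: \<Phi>_def \<E>_def)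
    qed
    then show "\<Theta> \<in> \<Phi> ` schur_class U V" using E by blast
  qed (use S0[OF C(1)] par[OF C(1)] in \<open>auto simp: \<Phi>_def\<close>)
  have tail: "schur_param UNIV UNIV (\<Phi> \<E>) (2 * n + 1 + k) = schur_param U V \<E> k"
    if E: "\<E> \<in> schur_class U V" for \<E> k
  proof -
    \<comment> \<open>After 2 n + 1 steps the state is the initial state of the algorithm for the
      parameter function on its own spaces.\<close>
    have "(schur_step ^^ (2 * n + 1 + k)) (UNIV, UNIV, \<Phi> \<E>) = (schur_step ^^ k) (U, V, \<E>)"
      unfolding add.commute[of _ k] funpow_add[of k "2 * n + 1"] o_apply \<Phi>_def it[OF C(1)[OF E] order_refl]
      by (simp only: C(2)[OF E] U_def V_def)
    then show ?thesis by (simp only: schur_param_def)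
  qed
  have "\<forall>z\<in>ball 0 1. bij_betw (pencil n \<Gamma> z) (Khat n \<Gamma>) (Khat n \<Gamma>)"
    using pencil_bij by simp
  moreover have "bij_betw (\<lambda>u. u - a_fun n \<Gamma> z (\<E> z u)) U U" if "\<E> \<in> schur_class U V" "z \<in> ball 0 1" for \<E> z
    using feedback_bij[of z "\<E> z"] that unfolding U_def V_def by (simp add: schur_class_iff)
  moreover have "\<Phi> \<E> z x = theta_fun n \<Gamma> z x + c_fun n \<Gamma> z (\<E> z
      (the_inv_into U (\<lambda>u. u - a_fun n \<Gamma> z (\<E> z u)) (b_fun n \<Gamma> z x)))"
    if "\<E> \<in> schur_class U V" "z \<in> ball 0 1" for \<E> z x
    using form[OF C(1)[OF that(1)] that(2), of x] by (simp only: C(2)[OF that(1)] \<Phi>_def)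
  moreover have "bij_betw \<Phi> (schur_class U V) ?T" using inj img by (simp add: bij_betw_def)
  moreover have "schur_param UNIV UNIV (\<Phi> \<E>) k = \<Gamma> k" if "\<E> \<in> schur_class U V" "k \<le> 2 * n" for \<E> k
    unfolding \<Phi>_def using C(1)[OF that(1)] that(2) by (rule par)
  ultimately show ?thesis using tail by (intro conjI exI[of _ \<Phi>] ballI allI impI) simp_all
qed

end
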